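(* Let $I,J$ be admissible subsets of $\{1,\dots,n-1\}$ and let $\eta^*$ be a composition with $\eta^*_i\ge\eta^*_{i+1}$ for all $i\in I$ and $\eta^*_j>\eta^*_{j+1}$ for all $j\in J$. Let $\omega\in W_{I\cup J}$ be decomposed as $\omega=\omega_I\omega_J$ with $\omega_I\in W_I$, $\omega_J\in W_J$. Let $\omega\eta^*=\mu$ and $\omega_I\eta^*=\mu_I$. The coefficients in $$S^{(I,J)}_{\eta^*}(z^{-1};q^{-1},t^{-1})=\sum_{\mu\in W_{I\cup J}(\eta^* )}\widehat b_{\eta^*\mu}\,E_\mu(z^{-1};q^{-1},t^{-1}),\qquad \widehat b_{\eta^*\eta^*}=1,$$ are specified by $$\widehat b_{\eta^*\mu}=(-1)^{l(\omega_J)}\,t^{\,l(\omega_I)}\,\frac{d'_{\eta^*}\,d_\mu}{d'_{\mu_I}\,d_{\mu_I}}.$$ Similarly, the coefficients in $$S^{(I,J)}_{\eta^*}(z;q,t)=\sum_{\mu\in W_{I\cup J}(\eta^* )}\widehat c_{\eta^*\mu}\,E_\mu(z;q,t),\qquad \widehat c_{\eta^*\eta^*}=1,$$ are specified by $$\widehat c_{\eta^*\mu}=\left(-\frac1t\right)^{l(\omega_J)}\frac{d'_{\eta^*}\,d_\mu}{d'_{\mu_I}\,d_{\mu_I}}.$$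
   Context: Let $n\ge1$, let $q,t$ be indeterminates and $z=(z_1,\dots,z_n)$. The transposition $s_i$ ($1\le i\le n-1$) acts on functions by exchanging $z_i,z_{i+1}$ and on compositions by exchanging the $i$-th and $(i+1)$-st entries (the symmetric group $S_n$ acts on compositions accordingly). Put $$T_i:=t+\frac{tz_i-z_{i+1}}{z_i-z_{i+1}}(s_i-1),\qquad (\omega_0 f)(z_1,\dots,z_n):=f(qz_n,z_1,\dots,z_{n-1}),$$ $$Y_i:=t^{-n+i}\,T_i\cdots T_{n-1}\,\omega_0\,T_1^{-1}\cdots T_{i-1}^{-1}\qquad(1\le i\le n).$$ A composition is $\eta=(\eta_1,\dots,\eta_n)\in\mathbb Z_{\ge0}^n$; $|\eta|=\sum\eta_i$ is its modulus; $\eta^+$ is the partition obtained by permuting the entries of $\eta$; $l'_\eta(i):=\#\{j<i:\eta_j\ge\eta_i\}+\#\{j>i:\eta_j>\eta_i\}$ and $\overline\eta_i:=q^{\eta_i}t^{-l'_\eta(i)}$. For compositions of equal modulus, $\mu<\eta$ iff $\mu\ne\eta$ and $\sum_{i=1}^p(\eta_i-\mu_i)\ge0$ for all $1\le p\le n$; and $\mu\prec\eta$ iff $\mu^+<\eta^+$, or $\mu^+=\eta^+$ and $\mu<\eta$. The nonsymmetric Macdonald polynomial $E_\eta=E_\eta(z;q,t)$ is the unique polynomial with coefficients in $\mathbb Q(q,t)$ of the form $E_\eta=z^\eta+\sum_{\nu\prec\eta}b_{\eta\nu}z^\nu$ with $Y_iE_\eta=\overline\eta_iE_\eta$ for all $i$.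 For $f(z;q,t)$, $f(z^{-1};q^{-1},t^{-1})$ is obtained by replacing every $z_i,q,t$ by its inverse. Let $\mathrm{diag}(\eta)=\{(i,j):1\le i\le n,\ 1\le j\le\eta_i\}$. For $s=(i,j)\in\mathrm{diag}(\eta)$ let $a_\eta(s):=\eta_i-j$ and $l_\eta(s):=\#\{k<i:\ j\le\eta_k+1\le\eta_i\}+\#\{k>i:\ j\le\eta_k\le\eta_i\}$. Put $$d_\eta:=\prod_{s\in\mathrm{diag}(\eta)}(1-q^{a_\eta(s)+1}t^{l_\eta(s)+1}),\qquad d'_\eta:=\prod_{s\in\mathrm{diag}(\eta)}(1-q^{a_\eta(s)+1}t^{l_\eta(s)}).$$ Subsets $I,J\subseteq\{1,\dots,n-1\}$ are admissible if they are disjoint, $i\pm1\notin J$ for $i\in I$, and $j\pm1\notin I$ for $j\in J$. Let $W_I,W_J,W_{I\cup J}\subseteq S_n$ be the subgroups generated by the $s_k$ with $k\in I$, $k\in J$, $k\in I\cup J$ respectively; every $\omega\in W_{I\cup J}$ is uniquely $\omega=\omega_I\omega_J$ with $\omega_I\in W_I$, $\omega_J\in W_J$. $W_{I\cup J}(\eta^* )$ denotes the orbit of $\eta^*$ under $W_{I\cup J}$. $l(\cdot)$ is the length function on $S_n$; for a reduced word $\sigma=s_{i_l}\cdots s_{i_1}$ put $T_\sigma:=T_{i_l}\cdots T_{i_1}$. Let $$O_{I,J}:=\sum_{\omega\in W_{I\cup J}}\left(-\tfrac1t\right)^{l(\omega_J)}T_\omega .$$ For $\eta^*$ with $\eta^*_i\ge\eta^*_{i+1}$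 ($i\in I$) and $\eta^*_j>\eta^*_{j+1}$ ($j\in J$), the Macdonald polynomial with prescribed symmetry $S^{(I,J)}_{\eta^*}(z)=S^{(I,J)}_{\eta^*}(z;q,t)$ is the polynomial with coefficient of $z^{\eta^*}$ equal to $1$ such that, for every $\eta\in W_{I\cup J}(\eta^* )$, $O_{I,J}E_\eta=a^{(I,J)}_\eta S^{(I,J)}_{\eta^*}$ for some nonzero $a^{(I,J)}_\eta\in\mathbb Q(q,t)$.
   Formalization: In the first formula ω_I is taken of minimal length among elements of W_I sending η* to μ_I; for arbitrary ω_I the formula is contradictory (n=2, I={1}, η*=(0,0): ω=1 and ω=s_1 would give 1=t). *)

theory Defs
  imports
    "HOL-Library.Poly_Mapping"
    "HOL-Computational_Algebra.Polynomial"
    "HOL-Computational_Algebra.Fraction_Field"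
    "HOL-Algebra.Sym_Groups"
begin

abbreviation lookup :: "('a \<Rightarrow>\<^sub>0 'b::zero) \<Rightarrow> 'a \<Rightarrow> 'b"
  where "lookup \<equiv> Poly_Mapping.lookup"

abbreviation keys :: "('a \<Rightarrow>\<^sub>0 'b::zero) \<Rightarrow> 'a set"
  where "keys \<equiv> Poly_Mapping.keys"

abbreviation single :: "'a \<Rightarrow> 'b \<Rightarrow> 'a \<Rightarrow>\<^sub>0 'b::zero"
  where "single \<equiv> Poly_Mapping.single"

text \<open>Coefficients live in the fraction field of the polynomials in t over the polynomials
  in q over the rationals.\<close>

type_synonym qt = "rat poly poly fract"

definition q :: qt where "q = Fract [:[:0, 1:]:] 1"
definition t :: qt where "t = Fract [:0, 1:] 1"

definition poly_qt_inv :: "rat poly poly \<Rightarrow> qt" where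
  "poly_qt_inv p = poly (map_poly (\<lambda>c. poly (map_poly of_rat c) (inverse q)) p) (inverse t)"

text \<open>The field automorphism inverting q and t; \<open>poly_qt_inv\<close> is injective, so the value does
  not depend on the fraction chosen to represent the argument.\<close>

definition qt_inv :: "qt \<Rightarrow> qt" where
  "qt_inv x = (THE y. \<exists>a b. b \<noteq> 0 \<and> x = Fract a b \<and> y = poly_qt_inv a / poly_qt_inv b)"

text \<open>Finitely supported maps from exponent vectors to coefficients. The variables are
  indexed by all natural numbers; those in use are numbered 1 to n.\<close>

type_synonym laurent = "(nat \<Rightarrow>\<^sub>0 int) \<Rightarrow>\<^sub>0 qt"

definition var :: "nat \<Rightarrow> laurent" where "var i = single (single i 1) 1"

definition scal :: "qt \<Rightarrow> laurent \<Rightarrow> laurent" where "scal c f = single 0 c * f"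

text \<open>The substitution of \<open>c i\<close> times variable number \<open>\<pi> i\<close> for variable number \<open>i\<close>, where
  \<open>\<pi>\<close> is a bijection.\<close>

definition subst_vars :: "(nat \<Rightarrow> qt) \<Rightarrow> (nat \<Rightarrow> nat) \<Rightarrow> laurent \<Rightarrow> laurent" where
  "subst_vars c \<pi> f = (\<Sum>a\<in>keys f.
     single (Poly_Mapping.map_key (Hilbert_Choice.inv \<pi>) a)
       (lookup f a * (\<Prod>i\<in>keys a. c i powi lookup a i)))"

definition laurent_inv :: "laurent \<Rightarrow> laurent" where
  "laurent_inv f = (\<Sum>a\<in>keys f. single (- a) (qt_inv (lookup f a)))"

abbreviation s :: "nat \<Rightarrow> nat \<Rightarrow> nat" where "s i \<equiv> transpose i (Suc i)"

definition word_perm :: "nat list \<Rightarrow> nat \<Rightarrow> nat" where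
  "word_perm w = foldr (\<lambda>i \<sigma>. s i \<circ> \<sigma>) w id"

definition len :: "nat \<Rightarrow> (nat \<Rightarrow> nat) \<Rightarrow> nat" where
  "len n \<sigma> = (LEAST k. \<exists>w. set w \<subseteq> {1..<n} \<and> word_perm w = \<sigma> \<and> length w = k)"

definition reduced_word :: "nat \<Rightarrow> (nat \<Rightarrow> nat) \<Rightarrow> nat list \<Rightarrow> bool" where
  "reduced_word n \<sigma> w \<longleftrightarrow> set w \<subseteq> {1..<n} \<and> word_perm w = \<sigma> \<and> length w = len n \<sigma>"

definition W :: "nat \<Rightarrow> nat set \<Rightarrow> (nat \<Rightarrow> nat) set" where
  "W n K = generate (sym_group n) (s ` K)"

definition admissible :: "nat \<Rightarrow> nat set \<Rightarrow> nat set \<Rightarrow> bool" where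
  "admissible n I J \<longleftrightarrow> I \<subseteq> {1..<n} \<and> J \<subseteq> {1..<n} \<and> I \<inter> J = {} \<and>
     (\<forall>i\<in>I. i + 1 \<notin> J \<and> i - 1 \<notin> J) \<and> (\<forall>j\<in>J. j + 1 \<notin> I \<and> j - 1 \<notin> I)"

definition J_part :: "nat \<Rightarrow> nat set \<Rightarrow> nat set \<Rightarrow> (nat \<Rightarrow> nat) \<Rightarrow> (nat \<Rightarrow> nat)" where
  "J_part n I J \<omega> = (THE \<omega>J. \<omega>J \<in> W n J \<and> (\<exists>\<omega>I\<in>W n I. \<omega> = \<omega>I \<circ> \<omega>J))"

type_synonym comp = "nat \<Rightarrow>\<^sub>0 nat"

definition composition :: "nat \<Rightarrow> comp \<Rightarrow> bool" where
  "composition n \<eta> \<longleftrightarrow> keys \<eta> \<subseteq> {1..n}"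

definition expo :: "comp \<Rightarrow> (nat \<Rightarrow>\<^sub>0 int)" where
  "expo \<eta> = Poly_Mapping.map int \<eta>"

text \<open>Entry \<open>i\<close> moves to position \<open>\<sigma> i\<close>, so that this is a left action in which \<open>s i\<close>
  exchanges the entries at \<open>i\<close> and \<open>Suc i\<close>.\<close>

definition act :: "(nat \<Rightarrow> nat) \<Rightarrow> comp \<Rightarrow> comp" where
  "act \<sigma> \<eta> = Poly_Mapping.map_key (Hilbert_Choice.inv \<sigma>) \<eta>"

definition orbit_W :: "nat \<Rightarrow> nat set \<Rightarrow> comp \<Rightarrow> comp set" where
  "orbit_W n K \<eta> = (\<lambda>\<sigma>. act \<sigma> \<eta>) ` W n K"

definition modulus :: "nat \<Rightarrow> comp \<Rightarrow> nat" where
  "modulus n \<eta> = (\<Sum>i=1..n. lookup \<eta> i)"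

definition part_of :: "nat \<Rightarrow> comp \<Rightarrow> comp" where
  "part_of n \<eta> = (THE \<kappa>. (\<forall>i\<in>{1..n}. \<forall>j\<in>{1..n}. i \<le> j \<longrightarrow> lookup \<kappa> j \<le> lookup \<kappa> i) \<and>
     (\<exists>\<sigma>. \<sigma> permutes {1..n} \<and> \<kappa> = act \<sigma> \<eta>))"

definition dom_less :: "nat \<Rightarrow> comp \<Rightarrow> comp \<Rightarrow> bool" where
  "dom_less n \<mu> \<eta> \<longleftrightarrow> modulus n \<mu> = modulus n \<eta> \<and> \<mu> \<noteq> \<eta> \<and>
     (\<forall>p\<in>{1..n}. (\<Sum>i=1..p. int (lookup \<eta> i) - int (lookup \<mu> i)) \<ge> 0)"

definition prec :: "nat \<Rightarrow> comp \<Rightarrow> comp \<Rightarrow> bool" where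
  "prec n \<mu> \<eta> \<longleftrightarrow> modulus n \<mu> = modulus n \<eta> \<and>
     (dom_less n (part_of n \<mu>) (part_of n \<eta>) \<or>
      part_of n \<mu> = part_of n \<eta> \<and> dom_less n \<mu> \<eta>)"

definition leg_colength :: "nat \<Rightarrow> comp \<Rightarrow> nat \<Rightarrow> nat" where
  "leg_colength n \<eta> i =
     card {j\<in>{1..n}. j < i \<and> lookup \<eta> j \<ge> lookup \<eta> i} +
     card {j\<in>{1..n}. j > i \<and> lookup \<eta> j > lookup \<eta> i}"

definition eigenval :: "nat \<Rightarrow> comp \<Rightarrow> nat \<Rightarrow> qt" where
  "eigenval n \<eta> i = q ^ lookup \<eta> i * t powi (- int (leg_colength n \<eta> i))"

definition diag :: "nat \<Rightarrow> comp \<Rightarrow> (nat \<times> nat) set" where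
  "diag n \<eta> = {(i, j). 1 \<le> i \<and> i \<le> n \<and> 1 \<le> j \<and> j \<le> lookup \<eta> i}"

definition arm :: "comp \<Rightarrow> nat \<times> nat \<Rightarrow> nat" where
  "arm \<eta> = (\<lambda>(i, j). lookup \<eta> i - j)"

definition leg :: "nat \<Rightarrow> comp \<Rightarrow> nat \<times> nat \<Rightarrow> nat" where
  "leg n \<eta> = (\<lambda>(i, j).
     card {k\<in>{1..n}. k < i \<and> j \<le> lookup \<eta> k + 1 \<and> lookup \<eta> k + 1 \<le> lookup \<eta> i} +
     card {k\<in>{1..n}. k > i \<and> j \<le> lookup \<eta> k \<and> lookup \<eta> k \<le> lookup \<eta> i})"

definition d :: "nat \<Rightarrow> comp \<Rightarrow> qt" where
  "d n \<eta> = (\<Prod>x\<in>diag n \<eta>. 1 - q ^ (arm \<eta> x + 1) * t ^ (leg n \<eta> x + 1))"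

definition d' :: "nat \<Rightarrow> comp \<Rightarrow> qt" where
  "d' n \<eta> = (\<Prod>x\<in>diag n \<eta>. 1 - q ^ (arm \<eta> x + 1) * t ^ leg n \<eta> x)"

definition s_op :: "nat \<Rightarrow> laurent \<Rightarrow> laurent" where
  "s_op i = subst_vars (\<lambda>_. 1) (s i)"

text \<open>The description selects the quotient of
  \<open>(scal t (var i) - var (Suc i)) * (s_op i f - f)\<close> by \<open>var i - var (Suc i)\<close>, which is again
  a Laurent polynomial.\<close>

definition T :: "nat \<Rightarrow> laurent \<Rightarrow> laurent" where
  "T i f = scal t f +
     (THE g. (var i - var (Suc i)) * g = (scal t (var i) - var (Suc i)) * (s_op i f - f))"

definition \<omega>0 :: "nat \<Rightarrow> laurent \<Rightarrow> laurent" where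
  "\<omega>0 n = subst_vars (\<lambda>i. if i = 1 then q else 1)
     (\<lambda>i. if i = 1 then n else if 2 \<le> i \<and> i \<le> n then i - 1 else i)"

definition T_word :: "nat list \<Rightarrow> laurent \<Rightarrow> laurent" where
  "T_word w = foldr (\<lambda>i F. T i \<circ> F) w id"

definition Tinv_word :: "nat list \<Rightarrow> laurent \<Rightarrow> laurent" where
  "Tinv_word w = foldr (\<lambda>i F. Hilbert_Choice.inv (T i) \<circ> F) w id"

definition Y :: "nat \<Rightarrow> nat \<Rightarrow> laurent \<Rightarrow> laurent" where
  "Y n i f = scal (t powi (int i - int n)) (T_word [i..<n] (\<omega>0 n (Tinv_word [1..<i] f)))"

text \<open>By the braid relations, the operator does not depend on the reduced word chosen.\<close>

definition T_perm :: "nat \<Rightarrow> (nat \<Rightarrow> nat) \<Rightarrow> laurent \<Rightarrow> laurent" where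
  "T_perm n \<sigma> = T_word (SOME w. reduced_word n \<sigma> w)"

definition O_IJ :: "nat \<Rightarrow> nat set \<Rightarrow> nat set \<Rightarrow> laurent \<Rightarrow> laurent" where
  "O_IJ n I J f =
     (\<Sum>\<omega>\<in>W n (I \<union> J). scal ((- 1 / t) ^ len n (J_part n I J \<omega>)) (T_perm n \<omega> f))"

definition is_nonsym_macdonald :: "nat \<Rightarrow> comp \<Rightarrow> laurent \<Rightarrow> bool" where
  "is_nonsym_macdonald n \<eta> f \<longleftrightarrow>
     lookup f (expo \<eta>) = 1 \<and>
     keys f \<subseteq> insert (expo \<eta>) (expo ` {\<nu>. composition n \<nu> \<and> prec n \<nu> \<eta>}) \<and>
     (\<forall>i\<in>{1..n}. Y n i f = scal (eigenval n \<eta> i) f)"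

text \<open>Here \<open>E\<close> is the family of nonsymmetric Macdonald polynomials.\<close>

definition is_prescribed_macdonald ::
  "nat \<Rightarrow> (comp \<Rightarrow> laurent) \<Rightarrow> nat set \<Rightarrow> nat set \<Rightarrow> comp \<Rightarrow> laurent \<Rightarrow> bool" where
  "is_prescribed_macdonald n E I J \<eta>s f \<longleftrightarrow>
     keys f \<subseteq> expo ` {\<nu>. composition n \<nu>} \<and>
     lookup f (expo \<eta>s) = 1 \<and>
     (\<forall>\<eta>\<in>orbit_W n (I \<union> J) \<eta>s. \<exists>a. a \<noteq> 0 \<and> O_IJ n I J (E \<eta>) = scal a f)"

end

(* The operator T_i acts on a nonsymmetric Macdonald polynomial E_eta by a two-term formula in E_eta
and E_{s_i eta}: T_i plus a suitable scalar intertwines Y_i and Y_{i+1}, so it sends E_eta to a joint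
eigenvector with the eigenvalues of s_i eta; since the E_mu span all polynomials and joint
eigenvalues separate compositions, the image is a multiple of E_{s_i eta}. If eta_i < eta_{i+1},
comparing the coefficients of z^{s_i eta} shows that this multiple is t: any other nu preceding eta
that could contribute would have a larger sum of squares than eta, which dominance forbids.

Hence O_IJ maps the span of the E_mu over an orbit to itself, and T_i S = t S for i in I, T_j S = - S
for j in J. Comparing coefficients of E_mu for mu_i > mu_{i+1} determines the ratio of the coefficients
at s_i mu and mu in terms of delta, the ratio of the eigenvalues of Y_i and Y_{i+1} on E_mu. The same
factors 1 - delta, 1 - t delta, 1 - delta / t describe how d and d' change under s_i, because exactly
one leg length changes. The formulas follow by induction along reduced words; the coefficients of
the inverted polynomials are the images of the others under inversion of q and t. *)

theory Submission
  imports Defs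
begin

subsection \<open>The coefficient field\<close>

text \<open>Several objects are given by a choice: \<open>T\<close> by a unique quotient,
  \<open>T_perm\<close> by some reduced word, \<open>qt_inv\<close> by some fraction,
  \<open>part_of\<close> by a unique rearrangement. Each must be shown independent of the choice;
  hence the braid relation and Matsumoto's theorem come before any statement about the symmetrizer.
  The coefficient of E_{s_i mu} in T_i E_mu is computed only for mu_i < mu_{i+1}. This suffices: for
  mu_i > mu_{i+1} the coefficient of E_mu in T_i S is fed by E_mu and by E_{s_i mu}, whose entries
  at i and i+1 increase. If \<open>\<eta>s\<close> has equal neighbours along \<open>I\<close>,
  several \<open>\<omega>I\<close> give the same \<open>\<mu>I\<close>. The quotient of the
  \<open>d\<close> and \<open>d'\<close> depends on the compositions alone, but the power of t in
  the inverted formula depends on the length of \<open>\<omega>I\<close>, so that formula is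
  attached to a shortest \<open>\<omega>I\<close>. The other formula has no such power and carries
  over from a shortest \<open>\<omega>I\<close> to every other one. Strict descent along
  \<open>J\<close> excludes this ambiguity there.\<close>

lemma Fract_power: "b \<noteq> 0 \<Longrightarrow> Fract a b ^ k = Fract (a ^ k) (b ^ k)"
  by (induction k) (auto simp: One_fract_def)

lemma q_t_monomial: "q ^ a * t ^ b = Fract (monom (monom 1 a) b) 1"
proof -
  have qt: "q = Fract (monom (monom 1 1) 0) 1" "t = Fract (monom 1 1) 1"
    by (simp_all add: q_def t_def monom_Suc monom_0)
  have "q ^ a = Fract (monom (monom 1 a) 0) 1" "t ^ b = Fract (monom 1 b) 1"
    unfolding qt by (simp_all add: Fract_power monom_power)
  then show ?thesis by (simp add: mult_monom)
qed

lemma q_t_monomial_eq_iff: "q ^ a * t ^ b = q ^ a' * t ^ b' \<longleftrightarrow> a = a' \<and> b = b'"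
proof
  assume "q ^ a * t ^ b = q ^ a' * t ^ b'"
  then have eq: "monom (monom (1::rat) a) b = monom (monom 1 a') b'"
    by (simp add: q_t_monomial eq_fract)
  have "b = b'" using arg_cong[OF eq, of degree] by (simp add: degree_monom_eq)
  moreover have "monom (1::rat) a = monom 1 a'"
    using arg_cong[OF eq, of lead_coeff] by (simp add: degree_monom_eq)
  then have "a = a'" using arg_cong[of _ _ degree] by (metis degree_monom_eq one_neq_zero)
  ultimately show "a = a' \<and> b = b'" by simp
qed auto

lemma q_nonzero [simp]: "q \<noteq> 0" and t_nonzero [simp]: "t \<noteq> 0"
  by (simp_all add: q_def t_def Zero_fract_def eq_fract)

text \<open>Independence of q and t, with integer powers of t allowed: it lets an eigenvalue
  determine both the entry and its colength.\<close>

lemma q_t_powi_eq_iff: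
  "q ^ a * t powi x = q ^ b * t powi y \<longleftrightarrow> a = b \<and> x = y"
proof
  \<comment> \<open>Large enough to make x + m and y + m nonnegative, so that multiplying by t^m
    leads back to natural exponents.\<close>
  define m where "m = nat (\<bar>x\<bar> + \<bar>y\<bar>)"
  have *: "t powi z * t ^ m = t ^ nat (z + int m)" if "\<bar>z\<bar> \<le> \<bar>x\<bar> + \<bar>y\<bar>" for z
  proof -
    have "t powi z * t powi int m = t powi (z + int m)"
      by (simp add: power_int_add)
    moreover have "z + int m = int (nat (z + int m))" using that by (auto simp: m_def)
    ultimately show ?thesis by (metis power_int_of_nat)
  qed
  assume "q ^ a * t powi x = q ^ b * t powi y"
  from arg_cong[OF this, of "\<lambda>u. u * t ^ m"]
  have "q ^ a * (t powi x * t ^ m) = q ^ b * (t powi y * t ^ m)" by (simp only: mult.assoc)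
  moreover have "t powi x * t ^ m = t ^ nat (x + int m)" "t powi y * t ^ m = t ^ nat (y + int m)"
    by (rule *, simp)+
  ultimately have "a = b \<and> nat (x + int m) = nat (y + int m)"
    by (simp only: q_t_monomial_eq_iff)
  then show "a = b \<and> x = y" by (auto simp: m_def)
qed auto

lemma q_t_monomial_eq_1_iff: "q ^ a * t ^ b = 1 \<longleftrightarrow> a = 0 \<and> b = 0"
  using q_t_monomial_eq_iff[of a b 0 0] by simp

lemma t_neq_1: "t \<noteq> 1"
  using q_t_monomial_eq_1_iff[of 0 1] by simp

section \<open>Inversion of q and t as a field homomorphism\<close>

lemma poly_map_poly_hom_add:
  assumes "\<And>x y. h (x + y) = h x + h y" "h 0 = 0"
  shows "poly (map_poly h (p + r)) x = poly (map_poly h p) x + poly (map_poly h r) x"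
proof -
  have "map_poly h (p + r) = map_poly h p + map_poly h r"
    by (rule poly_eqI) (simp add: coeff_map_poly assms)
  then show ?thesis by simp
qed

lemma poly_map_poly_hom_mult:
  fixes h :: "'a :: comm_ring_1 \<Rightarrow> 'b :: comm_ring_1"
  assumes "\<And>x y. h (x + y) = h x + h y" "h 0 = 0" "\<And>x y. h (x * y) = h x * h y"
  shows "poly (map_poly h (p * r)) x = poly (map_poly h p) x * poly (map_poly h r) x"
proof -
  have h_sum: "h (sum f A) = (\<Sum>a\<in>A. h (f a))" for f and A :: "nat set"
    by (induction A rule: infinite_finite_induct) (auto simp: assms)
  have "map_poly h (p * r) = map_poly h p * map_poly h r"
    by (rule poly_eqI) (simp add: coeff_map_poly assms coeff_mult h_sum)
  then show ?thesis by simp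
qed

definition inv_q_coeff :: "rat poly \<Rightarrow> qt" where
  "inv_q_coeff c = poly (map_poly of_rat c) (inverse q)"

lemma inv_q_coeff_hom:
  "inv_q_coeff (a + b) = inv_q_coeff a + inv_q_coeff b"
  "inv_q_coeff (a * b) = inv_q_coeff a * inv_q_coeff b"
  "inv_q_coeff 0 = 0"
  unfolding inv_q_coeff_def
  by (auto intro!: poly_map_poly_hom_add poly_map_poly_hom_mult simp: of_rat_add of_rat_mult)

lemma poly_qt_inv_alt: "poly_qt_inv p = poly (map_poly inv_q_coeff p) (inverse t)"
  by (simp add: poly_qt_inv_def inv_q_coeff_def[abs_def])

lemma poly_qt_inv_hom:
  "poly_qt_inv (a + b) = poly_qt_inv a + poly_qt_inv b"
  "poly_qt_inv (a * b) = poly_qt_inv a * poly_qt_inv b"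
  "poly_qt_inv 0 = 0"
  unfolding poly_qt_inv_alt
  by (auto intro!: poly_map_poly_hom_add poly_map_poly_hom_mult simp: inv_q_coeff_hom)

definition const_fract :: "'a::idom poly \<Rightarrow> 'a poly poly fract" where
  "const_fract c = Fract [:c:] 1"

lemma const_fract_hom:
  "const_fract (a + b) = const_fract a + const_fract b"
  "const_fract (a * b) = const_fract a * const_fract b"
  "const_fract 0 = 0"
  by (simp_all add: const_fract_def Zero_fract_def mult.commute)

text \<open>Both maps are determined by their values on integers, since a rational number is a
  quotient of two of them.\<close>

lemma of_rat_eq_const_fract: "(of_rat r :: qt) = const_fract [:r:]"
proof -
  have of_nat_eq: "of_nat k = const_fract [:of_nat k:]" for k
    by (simp add: const_fract_def of_nat_fract of_nat_poly)
  have of_int_eq: "of_int k = const_fract [:of_int k:]" for k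
  proof (cases k)
    case (nonneg m) then show ?thesis by (simp add: of_nat_eq)
  next
    case (neg m)
    have "- const_fract [:of_nat (Suc m):] = const_fract [:- of_nat (Suc m):]"
      by (simp add: const_fract_def)
    with neg show ?thesis by (metis of_int_minus of_int_of_nat_eq of_nat_eq)
  qed
  obtain a b where "quotient_of r = (a, b)" by force
  then have r: "r = of_int a / of_int b" and b: "b > 0"
    by (simp_all add: quotient_of_div quotient_of_denom_pos)
  have "of_rat r = const_fract [:of_int a:] / const_fract [:of_int b:]"
    by (simp add: r of_rat_divide of_int_eq)
  also have "\<dots> = const_fract [:r:]"
    using b by (simp add: const_fract_def eq_fract r)
  finally show ?thesis .
qed

lemma poly_map_const_fract: "poly (map_poly const_fract p) t = Fract p 1"
proof (induction p)
  case 0 then show ?case by (simp add: Zero_fract_def)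
next
  case (pCons a p)
  then show ?case
    by (simp add: map_poly_pCons const_fract_hom) (simp add: const_fract_def t_def)
qed

lemma poly_map_of_rat_q: "poly (map_poly of_rat c) q = const_fract c"
proof (induction c)
  case 0 then show ?case by (simp add: const_fract_hom)
next
  case (pCons a c)
  have "map_poly of_rat (pCons a c) = pCons (of_rat a :: qt) (map_poly of_rat c)"
    by (rule map_poly_pCons) simp
  then show ?case
    by (simp add: pCons) (simp add: of_rat_eq_const_fract const_fract_def q_def)
qed

text \<open>Up to a power of q and a power of t, inverting both indeterminates reverses coefficient
  lists, and the reverse of a nonzero polynomial is nonzero. This is the injectivity that makes
  \<open>qt_inv\<close> well defined on fractions.\<close>

lemma poly_qt_inv_nonzero:
  assumes "p \<noteq> 0"
  shows "poly_qt_inv p \<noteq> 0"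
proof -
  \<comment> \<open>A common bound for the q-degrees: the single factor q^N clears the denominators
    of all coefficients at once.\<close>
  define N where "N = Max (insert 0 (degree ` set (coeffs p)))"
  have deg: "degree (coeff p i) \<le> N" for i
  proof (cases "coeff p i = 0")
    case False
    then have "coeff p i \<in> set (coeffs p)" using range_coeff by fastforce
    then show ?thesis by (simp add: N_def)
  qed auto
  \<comment> \<open>For degree at most N this is the polynomial q^N c(1/q).\<close>
  define g where "g c = monom 1 (N - degree c) * reflect_poly c" for c :: "rat poly"
  have g: "q ^ N * inv_q_coeff c = const_fract (g c)" if "degree c \<le> N" for c
  proof -
    have "const_fract (reflect_poly c) = poly (map_poly of_rat (reflect_poly c)) q"
      by (simp add: poly_map_of_rat_q)
    also have "map_poly of_rat (reflect_poly c) = reflect_poly (map_poly of_rat c :: qt poly)"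
      by (rule poly_eqI) (simp add: coeff_map_poly coeff_reflect_poly degree_map_poly)
    also have "poly \<dots> q = q ^ degree c * inv_q_coeff c"
      by (simp add: poly_reflect_poly_nz inv_q_coeff_def degree_map_poly)
    finally have *: "const_fract (reflect_poly c) = q ^ degree c * inv_q_coeff c" .
    have "const_fract (monom 1 k) = q ^ k" for k
      using q_t_monomial[of k 0] by (simp add: const_fract_def monom_0)
    with * have "const_fract (g c) = q ^ (N - degree c) * (q ^ degree c * inv_q_coeff c)"
      by (simp add: g_def const_fract_hom)
    with that show ?thesis by (simp add: power_add[symmetric] mult.assoc[symmetric])
  qed
  have g0: "g c = 0 \<longleftrightarrow> c = 0" for c by (simp add: g_def)
  have "smult (q ^ N) (map_poly inv_q_coeff p) = map_poly const_fract (map_poly g p)"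
    by (rule poly_eqI) (simp add: coeff_map_poly inv_q_coeff_hom const_fract_hom g deg g0)
  then have "q ^ N * poly_qt_inv p = poly (map_poly const_fract (map_poly g p)) (inverse t)"
    unfolding poly_qt_inv_alt by (metis poly_smult)
  moreover have "poly (map_poly const_fract (map_poly g p)) (inverse t) \<noteq> 0"
  proof
    \<comment> \<open>Reflecting in t trades evaluation at 1/t for evaluation at t. The latter is
      the embedding of polynomials into the field and cannot kill a nonzero polynomial.\<close>
    assume *: "poly (map_poly const_fract (map_poly g p)) (inverse t) = 0"
    have c0: "const_fract c = 0 \<longleftrightarrow> c = 0" for c :: "rat poly"
      by (simp add: const_fract_def Zero_fract_def eq_fract)
    have "reflect_poly (map_poly const_fract (map_poly g p))
        = map_poly const_fract (reflect_poly (map_poly g p))"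
      by (rule poly_eqI) (simp add: coeff_map_poly coeff_reflect_poly degree_map_poly c0 g0)
    moreover have "poly (reflect_poly (map_poly const_fract (map_poly g p))) t = 0"
      by (simp add: poly_reflect_poly_nz *)
    ultimately have "reflect_poly (map_poly g p) = 0"
      by (simp add: poly_map_const_fract Zero_fract_def eq_fract)
    with assms show False
      by (simp add: map_poly_eq_0_iff g0)
  qed
  ultimately show ?thesis by auto
qed

lemma qt_inv_Fract:
  assumes "b \<noteq> 0"
  shows "qt_inv (Fract a b) = poly_qt_inv a / poly_qt_inv b"
  unfolding qt_inv_def
proof (rule the_equality)
  show "\<exists>a' b'. b' \<noteq> 0 \<and> Fract a b = Fract a' b' \<and>
      poly_qt_inv a / poly_qt_inv b = poly_qt_inv a' / poly_qt_inv b'"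
    using assms by blast
next
  fix y assume "\<exists>a' b'. b' \<noteq> 0 \<and> Fract a b = Fract a' b' \<and> y = poly_qt_inv a' / poly_qt_inv b'"
  then obtain a' b' where *: "b' \<noteq> 0" "Fract a b = Fract a' b'"
    and y: "y = poly_qt_inv a' / poly_qt_inv b'" by blast
  have "a * b' = a' * b" using * assms by (simp add: eq_fract)
  then have "poly_qt_inv a * poly_qt_inv b' = poly_qt_inv a' * poly_qt_inv b"
    by (metis poly_qt_inv_hom(2))
  then show "y = poly_qt_inv a / poly_qt_inv b"
    using poly_qt_inv_nonzero *(1) assms y by (simp add: frac_eq_eq)
qed

lemma qt_inv_hom:
  "qt_inv (x + y) = qt_inv x + qt_inv y"
  "qt_inv (x * y) = qt_inv x * qt_inv y"
proof -
  obtain a b a' b' where xy: "x = Fract a b" "b \<noteq> 0" "y = Fract a' b'" "b' \<noteq> 0"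
    by (meson Fract_cases)
  then show "qt_inv (x + y) = qt_inv x + qt_inv y" "qt_inv (x * y) = qt_inv x * qt_inv y"
    by (simp_all add: qt_inv_Fract poly_qt_inv_hom poly_qt_inv_nonzero add_frac_eq)
qed

lemma poly_qt_inv_1: "poly_qt_inv 1 = 1"
  using poly_qt_inv_hom(2)[of 1 1] poly_qt_inv_nonzero[of 1] by simp

lemma qt_inv_0 [simp]: "qt_inv 0 = 0"
  and qt_inv_1 [simp]: "qt_inv 1 = 1"
  and qt_inv_q [simp]: "qt_inv q = inverse q"
  and qt_inv_t [simp]: "qt_inv t = inverse t"
proof -
  show "qt_inv 0 = 0" using qt_inv_hom(1)[of 0 0] by simp
  show "qt_inv 1 = 1" by (simp add: One_fract_def qt_inv_Fract poly_qt_inv_1)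
  have i1: "inv_q_coeff 1 = 1" by (simp add: inv_q_coeff_def one_pCons map_poly_pCons)
  have iq: "inv_q_coeff [:0, 1:] = inverse q" by (simp add: inv_q_coeff_def map_poly_pCons)
  show "qt_inv q = inverse q"
    by (simp add: q_def qt_inv_Fract poly_qt_inv_1 poly_qt_inv_alt[of "[:_:]"] map_poly_pCons inv_q_coeff_hom)
      (simp add: iq q_def)
  show "qt_inv t = inverse t"
    by (simp add: t_def qt_inv_Fract poly_qt_inv_1 poly_qt_inv_alt[of "[:_, _:]"] map_poly_pCons inv_q_coeff_hom i1)
qed

lemma qt_inv_uminus: "qt_inv (- x) = - qt_inv x"
  using qt_inv_hom(1)[of x "- x"] by (simp add: eq_neg_iff_add_eq_0 add.commute)

lemma qt_inv_diff: "qt_inv (x - y) = qt_inv x - qt_inv y"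
  using qt_inv_hom(1)[of x "- y"] by (simp add: qt_inv_uminus)

lemma qt_inv_inverse: "qt_inv (inverse x) = inverse (qt_inv x)"
proof (cases "x = 0")
  case False
  then have "qt_inv x * qt_inv (inverse x) = 1" by (simp flip: qt_inv_hom)
  then show ?thesis by (metis inverse_unique)
qed auto

lemma qt_inv_divide: "qt_inv (x / y) = qt_inv x / qt_inv y"
  by (simp add: divide_inverse qt_inv_hom qt_inv_inverse)

lemma qt_inv_power: "qt_inv (x ^ k) = qt_inv x ^ k"
  by (induction k) (auto simp: qt_inv_hom)
text \<open>Here \<open>x, y, z\<close> are three consecutive variables, \<open>u\<close> is \<open>t\<close>, and an index string such as
  \<open>21\<close> means that \<open>s\<^sub>2 s\<^sub>1\<close> has been applied to \<open>f\<close>. The hypotheses \<open>e1\<close> to \<open>e7\<close> build up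
  \<open>A = T\<^sub>1 T\<^sub>2 T\<^sub>1 f\<close>, while \<open>k1\<close> to \<open>k7\<close> build up \<open>B = T\<^sub>2 T\<^sub>1 T\<^sub>2 f\<close>.\<close>

lemma braid_identity:
  fixes x y z u :: "'a :: idom"
  assumes ne: "x \<noteq> y" "y \<noteq> z" "x \<noteq> z"
  assumes e1: "(x - y) * g1 = (1 - u) * y * f + (u * x - y) * f1"
    and e2: "(x - z) * g2 = (1 - u) * z * f2 + (u * x - z) * f21"
    and e3: "(y - x) * g1' = (1 - u) * x * f1 + (u * y - x) * f"
    and e4: "(y - z) * g12 = (1 - u) * z * f12 + (u * y - z) * f121"
    and e5: "(y - z) * h = (1 - u) * z * g1 + (u * y - z) * g2"
    and e6: "(x - z) * h1 = (1 - u) * z * g1' + (u * x - z) * g12"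
    and e7: "(x - y) * A = (1 - u) * y * h + (u * x - y) * h1"
    and k1: "(y - z) * p = (1 - u) * z * f + (u * y - z) * f2"
    and k2: "(x - z) * p1 = (1 - u) * z * f1 + (u * x - z) * f12"
    and k3: "(z - y) * p2 = (1 - u) * y * f2 + (u * z - y) * f"
    and k4: "(x - y) * p21 = (1 - u) * y * f21 + (u * x - y) * f121"
    and k5: "(x - y) * r = (1 - u) * y * p + (u * x - y) * p1"
    and k6: "(x - z) * r2 = (1 - u) * z * p2 + (u * x - z) * p21"
    and k7: "(y - z) * B = (1 - u) * z * r + (u * y - z) * r2"
  shows "A = B"
proof -
  let ?D = "(x - y)\<^sup>2 * (y - z) * (x - z)"
  let ?D' = "(y - z)\<^sup>2 * (x - y) * (x - z)"
  have A: "?D * A = (1 - u) * y * (x - z) * ((1 - u) * z * ((1 - u) * y * f + (u * x - y) * f1))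
      + (1 - u) * y * (x - y) * (u * y - z) * ((1 - u) * z * f2 + (u * x - z) * f21)
      - (u * x - y) * (y - z) * ((1 - u) * z) * ((1 - u) * x * f1 + (u * y - x) * f)
      + (u * x - y) * (x - y) * (u * x - z) * ((1 - u) * z * f12 + (u * y - z) * f121)" (is "_ = ?A")
  proof -
    have "?D * A = (x - y) * (y - z) * (x - z) * ((x - y) * A)"
      by (simp add: power2_eq_square mult_ac)
    also have "\<dots> = (1 - u) * y * (x - y) * (x - z) * ((y - z) * h)
        + (u * x - y) * (x - y) * (y - z) * ((x - z) * h1)"
      unfolding e7 by (simp add: algebra_simps)
    also have "\<dots> = (1 - u) * y * (x - z) * ((1 - u) * z * ((x - y) * g1))
        + (1 - u) * y * (x - y) * (u * y - z) * ((x - z) * g2)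
        - (u * x - y) * (y - z) * ((1 - u) * z) * ((y - x) * g1')
        + (u * x - y) * (x - y) * (u * x - z) * ((y - z) * g12)"
      unfolding e5 e6 by (simp add: algebra_simps)
    finally show ?thesis unfolding e1 e2 e3 e4 .
  qed
  have B: "?D' * B = (1 - u) * z * (x - z) * ((1 - u) * y * ((1 - u) * z * f + (u * y - z) * f2))
      + (1 - u) * z * (y - z) * (u * x - y) * ((1 - u) * z * f1 + (u * x - z) * f12)
      - (u * y - z) * (x - y) * ((1 - u) * z) * ((1 - u) * y * f2 + (u * z - y) * f)
      + (u * y - z) * (y - z) * (u * x - z) * ((1 - u) * y * f21 + (u * x - y) * f121)" (is "_ = ?B")
  proof -
    have "?D' * B = (y - z) * (x - y) * (x - z) * ((y - z) * B)"
      by (simp add: power2_eq_square mult_ac)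
    also have "\<dots> = (1 - u) * z * (y - z) * (x - z) * ((x - y) * r)
        + (u * y - z) * (x - y) * (y - z) * ((x - z) * r2)"
      unfolding k7 by (simp add: algebra_simps)
    also have "\<dots> = (1 - u) * z * (x - z) * ((1 - u) * y * ((y - z) * p))
        + (1 - u) * z * (y - z) * (u * x - y) * ((x - z) * p1)
        - (u * y - z) * (x - y) * ((1 - u) * z) * ((z - y) * p2)
        + (u * y - z) * (y - z) * (u * x - z) * ((x - y) * p21)"
      unfolding k5 k6 by (simp add: algebra_simps)
    finally show ?thesis unfolding k1 k2 k3 k4 .
  qed
  \<comment> \<open>Opaque letters keep the expansion small: X, Y', Z stand for x - y, y - z, x - z,
    and v for 1 - u. The terms in \<open>f12\<close>, \<open>f21\<close> and \<open>f121\<close>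
    cancel identically; the coefficients of \<open>f\<close>, \<open>f1\<close> and
    \<open>f2\<close> vanish by the three identities below.\<close>
  have collect: "Y' * (v * y * Z * (v * z * (v * y * f + a * f1)) + v * y * X * b * (v * z * f2 + c * f21)
        - a * Y' * (v * z) * (v * x * f1 + e * f) + a * X * c * (v * z * f12 + b * f121))
      - X * (v * z * Z * (v * y * (v * z * f + b * f2)) + v * z * Y' * a * (v * z * f1 + c * f12)
        - b * X * (v * z) * (v * y * f2 + g * f) + b * Y' * c * (v * y * f21 + a * f121))
      = v * z * (Y' * (v * v * y * y * Z - a * Y' * e) - X * (v * v * y * z * Z - b * X * g)) * f
        + v * v * z * a * Y' * (y * Z - Y' * x - X * z) * f1
        + v * v * y * z * b * X * (Y' - Z + X) * f2"
    for v a b c e g X Y' Z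
    by (simp add: algebra_simps)
  have "(y - z) * ((1 - u) * (1 - u) * y * y * (x - z) - (u * x - y) * (y - z) * (u * y - x))
      - (x - y) * ((1 - u) * (1 - u) * y * z * (x - z) - (u * y - z) * (x - y) * (u * z - y)) = 0"
    by (simp add: algebra_simps)
  moreover have "y * (x - z) - (y - z) * x - (x - y) * z = 0" "(y - z) - (x - z) + (x - y) = 0"
    by (simp_all add: algebra_simps)
  ultimately have "(y - z) * ?A - (x - y) * ?B = 0"
    unfolding collect by (simp only: mult_zero_right mult_zero_left add_0_right)
  then have AB: "(y - z) * ?A = (x - y) * ?B" by simp
  have "(x - y)\<^sup>2 * (y - z)\<^sup>2 * (x - z) * A = (y - z) * (?D * A)"
    by (simp add: power2_eq_square mult_ac)
  also have "\<dots> = (x - y) * (?D' * B)" unfolding A B by (rule AB)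
  also have "\<dots> = (x - y)\<^sup>2 * (y - z)\<^sup>2 * (x - z) * B"
    by (simp add: power2_eq_square mult_ac)
  finally have "(x - y)\<^sup>2 * (y - z)\<^sup>2 * (x - z) * A = (x - y)\<^sup>2 * (y - z)\<^sup>2 * (x - z) * B" .
  with ne show ?thesis by simp
qed

subsection \<open>Laurent polynomials and the Hecke algebra\<close>

lemma scal_simps:
  "scal c (f + g) = scal c f + scal c g"
  "scal c (f - g) = scal c f - scal c g"
  "scal (a + c) f = scal a f + scal c f"
  "scal (a - c) f = scal a f - scal c f"
  "scal (a * c) f = scal a (scal c f)"
  "scal 1 f = f" "scal 0 f = 0" "scal c 0 = 0"
  "scal c (- f) = - scal c f" "scal (- c) f = - scal c f"
  by (simp_all add: scal_def algebra_simps single_add single_diff single_uminus mult_single)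

lemma scal_mult: "scal c f * g = scal c (f * g)" "f * scal c g = scal c (f * g)"
  by (simp_all add: scal_def algebra_simps)

lemma scal_single: "scal c (single a x) = single a (c * x)"
  by (simp add: scal_def mult_single)

lemma lookup_scal: "lookup (scal c f) a = c * lookup f a"
  unfolding scal_def mult_map_scale_conv_mult[symmetric]
  by transfer (simp add: when_def)

lemma scal_sum: "scal c (sum f A) = (\<Sum>a\<in>A. scal c (f a))"
  by (simp add: scal_def sum_distrib_left)

lemma scal_cancel: "c \<noteq> 0 \<Longrightarrow> scal c f = scal c g \<longleftrightarrow> f = g"
  by (metis left_inverse scal_simps(5,6))

lemma laurent_as_sum: "f = (\<Sum>a\<in>keys f. scal (lookup f a) (single a 1))"
  by (rule poly_mapping_eqI)
    (simp add: lookup_sum lookup_scal lookup_single when_def in_keys_iff if_distrib[of "(*) _"] cong: if_cong)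

section \<open>Linear operators and substitutions of variables\<close>

definition linear_op :: "(laurent \<Rightarrow> laurent) \<Rightarrow> bool" where
  "linear_op F \<longleftrightarrow> (\<forall>f g. F (f + g) = F f + F g) \<and> (\<forall>c f. F (scal c f) = scal c (F f))"

lemma linear_opI:
  "\<lbrakk>\<And>f g. F (f + g) = F f + F g; \<And>c f. F (scal c f) = scal c (F f)\<rbrakk> \<Longrightarrow> linear_op F"
  by (simp add: linear_op_def)

lemma linear_op_add: "linear_op F \<Longrightarrow> F (f + g) = F f + F g"
  and linear_op_scal: "linear_op F \<Longrightarrow> F (scal c f) = scal c (F f)"
  by (simp_all add: linear_op_def)

lemma linear_op_0: "linear_op F \<Longrightarrow> F 0 = 0"
  using linear_op_scal[of F 0 0] by (simp add: scal_simps)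

lemma linear_op_uminus: "linear_op F \<Longrightarrow> F (- f) = - F f"
  using linear_op_scal[of F "-1" f] by (simp add: scal_simps)

lemma linear_op_diff: "linear_op F \<Longrightarrow> F (f - g) = F f - F g"
  using linear_op_add[of F f "- g"] by (simp add: linear_op_uminus)

lemma linear_op_sum: "linear_op F \<Longrightarrow> F (sum f A) = (\<Sum>a\<in>A. F (f a))"
  by (induction A rule: infinite_finite_induct) (auto simp: linear_op_0 linear_op_add)

lemma linear_op_comp: "linear_op F \<Longrightarrow> linear_op G \<Longrightarrow> linear_op (\<lambda>f. F (G f))"
  by (simp add: linear_op_def)

lemma linear_op_mult: "linear_op (\<lambda>f. g * f)" "linear_op (\<lambda>f. f * g)"
  by (auto intro!: linear_opI simp: algebra_simps scal_mult)

lemma linear_op_eqI: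
  assumes "linear_op F" "linear_op G" "\<And>a. F (single a 1) = G (single a 1)"
  shows "F f = G f"
  by (subst (1 2) laurent_as_sum) (simp add: linear_op_sum linear_op_scal assms)

lemma linear_op_bilinear_eqI:
  assumes "\<And>g. linear_op (\<lambda>f. F f g)" "\<And>g. linear_op (\<lambda>f. G f g)"
    and "\<And>f. linear_op (F f)" "\<And>f. linear_op (G f)"
    and "\<And>a b. F (single a 1) (single b 1) = G (single a 1) (single b 1)"
  shows "F f g = G f g"
  by (rule linear_op_eqI[of "\<lambda>f. F f g" "\<lambda>f. G f g"])
    (auto intro: assms linear_op_eqI[of "F _" "G _"])

definition weight :: "(nat \<Rightarrow> qt) \<Rightarrow> (nat \<Rightarrow>\<^sub>0 int) \<Rightarrow> qt" where
  "weight c a = (\<Prod>i\<in>keys a. c i powi lookup a i)"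

lemma weight_superset: "finite A \<Longrightarrow> keys a \<subseteq> A \<Longrightarrow> weight c a = (\<Prod>i\<in>A. c i powi lookup a i)"
  unfolding weight_def by (rule prod.mono_neutral_left) (auto simp: in_keys_iff)

lemma weight_add:
  assumes "\<And>i. c i \<noteq> 0"
  shows "weight c (a + b) = weight c a * weight c b"
  using keys_add[of a b] assms
  by (simp add: weight_superset[of "keys a \<union> keys b"] lookup_add power_int_add prod.distrib)

lemma subst_vars_superset:
  assumes "finite A" "keys f \<subseteq> A"
  shows "subst_vars c \<pi> f
    = (\<Sum>a\<in>A. single (Poly_Mapping.map_key (inv' \<pi>) a) (lookup f a * weight c a))"
  unfolding subst_vars_def weight_def using assms
  by (intro sum.mono_neutral_left) (auto simp: in_keys_iff)

lemma linear_op_subst_vars: "linear_op (subst_vars c \<pi>)"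
proof (rule linear_opI)
  fix f g
  show "subst_vars c \<pi> (f + g) = subst_vars c \<pi> f + subst_vars c \<pi> g"
    using keys_add[of f g]
    by (simp add: subst_vars_superset[of "keys f \<union> keys g"] lookup_add distrib_right single_add
        sum.distrib)
next
  fix x f
  have "keys (scal x f) \<subseteq> keys f" by (auto simp: in_keys_iff lookup_scal)
  then show "subst_vars c \<pi> (scal x f) = scal x (subst_vars c \<pi> f)"
    by (simp add: subst_vars_superset[of "keys f"] lookup_scal scal_sum scal_single mult_ac)
qed

lemma subst_vars_single:
  "subst_vars c \<pi> (single a x) = single (Poly_Mapping.map_key (inv' \<pi>) a) (x * weight c a)"
  by (subst subst_vars_superset[of "{a}"]) auto

lemma subst_vars_mult:
  assumes "\<And>i. c i \<noteq> 0" "bij \<pi>"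
  shows "subst_vars c \<pi> (f * g) = subst_vars c \<pi> f * subst_vars c \<pi> g"
proof (rule linear_op_bilinear_eqI[of "\<lambda>f g. subst_vars c \<pi> (f * g)"])
  fix a b
  have "inj (inv' \<pi>)" using assms by (simp add: bij_imp_bij_inv bij_is_inj)
  then show "subst_vars c \<pi> (single a 1 * single b 1) = subst_vars c \<pi> (single a 1) * subst_vars c \<pi> (single b 1)"
    by (simp add: mult_single subst_vars_single weight_add assms map_key_plus)
qed (auto intro!: linear_op_comp[OF linear_op_subst_vars] linear_op_mult
      linear_op_comp[OF linear_op_mult(1) linear_op_subst_vars]
      linear_op_comp[OF linear_op_mult(2) linear_op_subst_vars])

lemma subst_vars_var:
  assumes "bij \<pi>"
  shows "subst_vars c \<pi> (var i) = scal (c i) (var (\<pi> i))"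
proof -
  have "inj (inv' \<pi>)" using assms by (simp add: bij_imp_bij_inv bij_is_inj)
  from map_key_single[OF this, of "\<pi> i" "1 :: int"] show ?thesis
    using assms by (simp add: var_def subst_vars_single scal_single weight_def bij_is_inj)
qed

lemma bij_s [simp]: "bij (s i)" and inv_s [simp]: "inv' (s i) = s i"
  by (auto simp: inv_transpose_eq)

lemma s_involutive [simp]: "s i (s i k) = k"
  by simp

text \<open>Polymorphic in the entries because it serves both integer exponent vectors and
  compositions.\<close>

definition swap_expo :: "nat \<Rightarrow> (nat \<Rightarrow>\<^sub>0 'a::zero) \<Rightarrow> (nat \<Rightarrow>\<^sub>0 'a)" where
  "swap_expo i a = Poly_Mapping.map_key (s i) a"

lemma lookup_swap_expo: "lookup (swap_expo i a) k = lookup a (s i k)"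
  by (simp add: swap_expo_def map_key.rep_eq)

lemma swap_swap: "swap_expo i (swap_expo i a) = a"
  by (rule poly_mapping_eqI) (simp add: lookup_swap_expo)

lemma swap_expo_equal: "lookup a (Suc i) = lookup a i \<Longrightarrow> swap_expo i a = a"
  by (rule poly_mapping_eqI) (auto simp: lookup_swap_expo transpose_def)

lemma s_op_single: "s_op i (single a x) = single (swap_expo i a) x"
  by (simp add: s_op_def subst_vars_single swap_expo_def weight_def)

lemma linear_op_s_op: "linear_op (s_op i)"
  unfolding s_op_def by (rule linear_op_subst_vars)

lemma s_op_mult: "s_op i (f * g) = s_op i f * s_op i g"
  by (simp add: s_op_def subst_vars_mult)

lemma s_op_var: "s_op i (var k) = var (s i k)"
  by (simp add: s_op_def subst_vars_var scal_simps)

lemma s_op_involutive: "s_op i (s_op i f) = f"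
proof (rule linear_op_eqI[of "\<lambda>f. s_op i (s_op i f)" "\<lambda>f. f"])
  show "s_op i (s_op i (single a 1)) = single a 1" for a
    by (simp add: s_op_single swap_swap)
qed (auto intro: linear_op_comp linear_op_s_op linear_opI)

lemma s_op_commute:
  assumes "Suc i < j \<or> Suc j < i"
  shows "s_op i (s_op j f) = s_op j (s_op i f)"
proof (rule linear_op_eqI[of "\<lambda>f. s_op i (s_op j f)" "\<lambda>f. s_op j (s_op i f)"])
  have "swap_expo i (swap_expo j a) = swap_expo j (swap_expo i a)" for a :: "nat \<Rightarrow>\<^sub>0 int"
    using assms by (intro poly_mapping_eqI) (auto simp: lookup_swap_expo transpose_def)
  then show "s_op i (s_op j (single a 1)) = s_op j (s_op i (single a 1))" for a
    by (simp add: s_op_single)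
qed (auto intro: linear_op_comp linear_op_s_op)

lemma s_op_braid: "s_op i (s_op (Suc i) (s_op i f)) = s_op (Suc i) (s_op i (s_op (Suc i) f))"
proof (rule linear_op_eqI[of "\<lambda>f. s_op i (s_op (Suc i) (s_op i f))" "\<lambda>f. s_op (Suc i) (s_op i (s_op (Suc i) f))"])
  have "swap_expo i (swap_expo (Suc i) (swap_expo i a))
      = swap_expo (Suc i) (swap_expo i (swap_expo (Suc i) a))" for a :: "nat \<Rightarrow>\<^sub>0 int"
    by (intro poly_mapping_eqI) (auto simp: lookup_swap_expo transpose_def)
  then show "s_op i (s_op (Suc i) (s_op i (single a 1))) = s_op (Suc i) (s_op i (s_op (Suc i) (single a 1)))" for a
    by (simp add: s_op_single)
qed (auto intro!: linear_op_comp[OF linear_op_s_op] linear_op_s_op)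

section \<open>Divided differences and the cleared form of T\<close>

lemma var_neq: "i \<noteq> j \<Longrightarrow> var i \<noteq> var j"
proof
  assume "i \<noteq> j" "var i = var j"
  then have "single i (1::int) = single j 1"
    by (metis lookup_single_eq lookup_single_not_eq one_neq_zero var_def)
  with \<open>i \<noteq> j\<close> show False by (metis lookup_single_eq lookup_single_not_eq one_neq_zero)
qed

text \<open>The exponents met when walking from a towards its swap in the direction of the i-th
  simple root.\<close>

definition string_expo :: "nat \<Rightarrow> (nat \<Rightarrow>\<^sub>0 int) \<Rightarrow> nat \<Rightarrow> (nat \<Rightarrow>\<^sub>0 int)" where
  "string_expo i a k = a + single i (int k) - single (Suc i) (int k)"

lemma lookup_string_expo:
  "lookup (string_expo i a k) j
    = (if j = i then lookup a i + int k else if j = Suc i then lookup a j - int k else lookup a j)"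
  by (auto simp: string_expo_def lookup_add lookup_minus lookup_single when_def)

text \<open>The geometric sum that results from dividing the difference of the two ends of a string
  by z_i - z_{i+1}.\<close>

definition divided_diff :: "nat \<Rightarrow> (nat \<Rightarrow>\<^sub>0 int) \<Rightarrow> nat \<Rightarrow> laurent" where
  "divided_diff i a m = (\<Sum>k<m. single (string_expo i a k - single (Suc i) 1) 1)"

lemma var_mult_divided_diff:
  "var i * divided_diff i a m = (\<Sum>k<m. single (string_expo i a (Suc k)) 1)"
  "var (Suc i) * divided_diff i a m = (\<Sum>k<m. single (string_expo i a k) 1)"
proof -
  have "single i 1 + (string_expo i a k - single (Suc i) 1) = string_expo i a (Suc k)"
    "single (Suc i) 1 + (string_expo i a k - single (Suc i) 1) = string_expo i a k" for k
    by (intro poly_mapping_eqI;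
        auto simp: lookup_string_expo lookup_add lookup_minus lookup_single when_def)+
  then show
    "var i * divided_diff i a m = (\<Sum>k<m. single (string_expo i a (Suc k)) 1)"
    "var (Suc i) * divided_diff i a m = (\<Sum>k<m. single (string_expo i a k) 1)"
    by (simp_all add: var_def divided_diff_def sum_distrib_left mult_single)
qed

lemma divided_diff_telescope:
  "(var i - var (Suc i)) * divided_diff i a m = single (string_expo i a m) 1 - single a 1"
proof -
  have "string_expo i a 0 = a" by (simp add: string_expo_def)
  then show ?thesis
    using sum_lessThan_telescope[of "\<lambda>k. single (string_expo i a k) (1::qt)" m]
    by (simp add: left_diff_distrib var_mult_divided_diff flip: sum_subtractf)
qed

lemma swap_expo_eq_string_expo:
  assumes "lookup a i \<le> lookup a (Suc i)"
  shows "swap_expo i a = string_expo i a (nat (lookup a (Suc i) - lookup a i))"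
  using assms by (intro poly_mapping_eqI) (auto simp: lookup_string_expo lookup_swap_expo transpose_def)

text \<open>By linearity monomials suffice. If entry i does not exceed entry i+1, the string leads
  from the exponent to its swap; otherwise the string starts at the swap and the quotient changes
  sign.\<close>

lemma divided_diff_ex: "\<exists>g. (var i - var (Suc i)) * g = s_op i f - f"
proof -
  have single: "\<exists>g. (var i - var (Suc i)) * g = s_op i (single a 1) - single a 1" for a
  proof (cases "lookup a i \<le> lookup a (Suc i)")
    case True
    then show ?thesis
      by (auto simp: s_op_single swap_expo_eq_string_expo intro: divided_diff_telescope)
  next
    case False
    define b where "b = swap_expo i a"
    have b: "swap_expo i b = a" "lookup b i \<le> lookup b (Suc i)"
      using False by (auto simp: b_def lookup_swap_expo intro: poly_mapping_eqI)
    have "(var i - var (Suc i)) * - divided_diff i b (nat (lookup b (Suc i) - lookup b i)) = single b 1 - single a 1"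
      using divided_diff_telescope[of i b] swap_expo_eq_string_expo[OF b(2)] b(1)
      by (metis minus_diff_eq mult_minus_right)
    then show ?thesis by (metis b_def s_op_single)
  qed
  then obtain G where G: "\<And>a. (var i - var (Suc i)) * G a = s_op i (single a 1) - single a 1" by metis
  have "(var i - var (Suc i)) * (\<Sum>a\<in>keys f. scal (lookup f a) (G a)) = s_op i f - f"
    by (subst (3 4) laurent_as_sum)
      (simp add: sum_distrib_left scal_mult G linear_op_sum[OF linear_op_s_op]
        linear_op_scal[OF linear_op_s_op] scal_simps sum_subtractf)
  then show ?thesis by blast
qed

text \<open>The quotient in the definition of \<open>T\<close> exists by divided differences and is
  unique because Laurent polynomials have no zero divisors. From here on \<open>T\<close> is handled
  in this cleared form: with \<open>T_unique\<close>, operator identities become polynomial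
  identities.\<close>

lemma T_mult_diff:
  "(var i - var (Suc i)) * T i f
    = scal (1 - t) (var (Suc i)) * f + (scal t (var i) - var (Suc i)) * s_op i f"
proof -
  let ?D = "var i - var (Suc i)" and ?R = "(scal t (var i) - var (Suc i)) * (s_op i f - f)"
  obtain g where g: "?D * g = s_op i f - f" using divided_diff_ex by blast
  then have "?D * ((scal t (var i) - var (Suc i)) * g) = ?R" by (simp add: mult.left_commute)
  moreover have "?D \<noteq> 0" using var_neq[of i "Suc i"] by simp
  ultimately have "\<exists>!g. ?D * g = ?R" by (metis mult_left_cancel)
  from theI'[OF this] show ?thesis
    unfolding T_def by (simp add: algebra_simps scal_simps scal_mult)
qed

lemma T_unique:
  assumes "(var i - var (Suc i)) * g
    = scal (1 - t) (var (Suc i)) * f + (scal t (var i) - var (Suc i)) * s_op i f"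
  shows "T i f = g"
  using assms var_neq[of i "Suc i"] by (simp flip: T_mult_diff)

text \<open>The same bracket occurs with opposite signs because s_i - 1 takes opposite values on a
  monomial and on its swap.\<close>

lemma T_single:
  assumes "lookup a i \<le> lookup a (Suc i)"
  defines "m \<equiv> nat (lookup a (Suc i) - lookup a i)"
  shows "T i (single a 1) = scal t (single a 1)
      + (scal t (\<Sum>k<m. single (string_expo i a (Suc k)) 1) - (\<Sum>k<m. single (string_expo i a k) 1))"
    and "T i (single (swap_expo i a) 1) = scal t (single (swap_expo i a) 1)
      - (scal t (\<Sum>k<m. single (string_expo i a (Suc k)) 1) - (\<Sum>k<m. single (string_expo i a k) 1))"
proof -
  let ?G = "scal t (\<Sum>k<m. single (string_expo i a (Suc k)) 1) - (\<Sum>k<m. single (string_expo i a k) (1::qt))"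
  have G: "?G = (scal t (var i) - var (Suc i)) * divided_diff i a m"
    by (simp add: left_diff_distrib scal_mult var_mult_divided_diff)
  have "(var i - var (Suc i)) * ?G = (scal t (var i) - var (Suc i)) * (s_op i (single a 1) - single a 1)"
    unfolding G mult.left_commute[of "var i - var (Suc i)"] divided_diff_telescope
    by (simp add: s_op_single m_def swap_expo_eq_string_expo assms)
  moreover have "T i (single a 1) = scal t (single a 1) + G"
      "T i (single (swap_expo i a) 1) = scal t (single (swap_expo i a) 1) - G"
    if G: "(var i - var (Suc i)) * G = (scal t (var i) - var (Suc i)) * (s_op i (single a 1) - single a 1)" for G
  proof -
    show "T i (single a 1) = scal t (single a 1) + G"
      by (rule T_unique) (simp only: distrib_left G, simp add: algebra_simps scal_simps scal_mult)
    have "s_op i (single (swap_expo i a) 1) = single a 1"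
      by (metis s_op_involutive s_op_single)
    then show "T i (single (swap_expo i a) 1) = scal t (single (swap_expo i a) 1) - G"
      by (intro T_unique) (simp only: right_diff_distrib[of _ _ G] G, simp add: s_op_single algebra_simps scal_simps scal_mult)
  qed
  ultimately show "T i (single a 1) = scal t (single a 1) + ?G"
      "T i (single (swap_expo i a) 1) = scal t (single (swap_expo i a) 1) - ?G"
    by blast+
qed

lemma linear_op_T: "linear_op (T i)"
proof (rule linear_opI; rule T_unique)
  fix f g c
  show "(var i - var (Suc i)) * (T i f + T i g) = scal (1 - t) (var (Suc i)) * (f + g)
      + (scal t (var i) - var (Suc i)) * s_op i (f + g)"
    unfolding distrib_left[of "var i - var (Suc i)"] T_mult_diff
    by (simp add: linear_op_add[OF linear_op_s_op] algebra_simps)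
  show "(var i - var (Suc i)) * scal c (T i f) = scal (1 - t) (var (Suc i)) * scal c f
      + (scal t (var i) - var (Suc i)) * s_op i (scal c f)"
    unfolding scal_mult(2) T_mult_diff
    by (simp add: linear_op_scal[OF linear_op_s_op] scal_simps scal_mult)
qed

lemmas T_add = linear_op_add[OF linear_op_T] and T_scal = linear_op_scal[OF linear_op_T]
  and T_diff = linear_op_diff[OF linear_op_T] and T_sum = linear_op_sum[OF linear_op_T]

section \<open>Quadratic, commutation and braid relations\<close>

lemma s_op_hom: "s_op i (f + g) = s_op i f + s_op i g" "s_op i (f - g) = s_op i f - s_op i g"
  "s_op i (scal c f) = scal c (s_op i f)"
  by (simp_all add: linear_op_add linear_op_diff linear_op_scal linear_op_s_op)

lemma s_op_const [simp]: "s_op k (single 0 c) = single 0 c" "s_op k 1 = 1"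
proof -
  have "swap_expo k (0 :: nat \<Rightarrow>\<^sub>0 int) = 0" by (rule poly_mapping_eqI) (simp add: lookup_swap_expo)
  then show "s_op k (single 0 c) = single 0 c" "s_op k 1 = 1"
    using s_op_single[of k 0 1] by (simp_all add: s_op_single)
qed

lemma T_quadratic: "T i (T i f) = scal (t - 1) (T i f) + scal t f"
proof (rule T_unique)
  let ?x = "var i" and ?y = "var (Suc i)" and ?g = "T i f"
  let ?u = "single 0 t :: laurent"
  have u: "scal t h = ?u * h" "scal (1 - t) h = (1 - ?u) * h" "scal (t - 1) h = (?u - 1) * h" for h
    by (simp_all add: scal_def single_diff)
  have g: "(?x - ?y) * ?g = (1 - ?u) * ?y * f + (?u * ?x - ?y) * s_op i f"
    using T_mult_diff[of i f] by (simp add: u)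
  have sg: "(?y - ?x) * s_op i ?g = (1 - ?u) * ?x * s_op i f + (?u * ?y - ?x) * f"
    using arg_cong[OF T_mult_diff[of i f], of "s_op i"]
    by (simp add: s_op_mult s_op_hom s_op_var s_op_involutive u)
  \<comment> \<open>The equation is multiplied once more by z_i - z_{i+1}, since \<open>g\<close>
    and \<open>sg\<close> describe T_i f and its swap only after such a multiplication.\<close>
  have "(?x - ?y) * ((?x - ?y) * ((?u - 1) * ?g + ?u * f))
      = (?x - ?y) * ((1 - ?u) * ?y * ?g + (?u * ?x - ?y) * s_op i ?g)"
    using g sg by algebra
  moreover have "?x - ?y \<noteq> 0" using var_neq[of i "Suc i"] by simp
  ultimately show "(?x - ?y) * (scal (t - 1) ?g + scal t f)
      = scal (1 - t) ?y * ?g + (scal t ?x - ?y) * s_op i ?g"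
    by (simp add: u)
qed

lemma T_mult_invariant:
  assumes "s_op i p = p"
  shows "T i (p * f) = p * T i f"
  by (rule T_unique) (simp add: s_op_mult assms mult.left_commute[of _ p] T_mult_diff, simp add: algebra_simps)

text \<open>T_i is built from two variables, their swap and scalars, so any linear ring homomorphism
  that transports these data transports T_i. It is applied to the swaps and to
  \<open>\<omega>0\<close>.\<close>

lemma T_intertwine:
  assumes lin: "linear_op F" and mult: "\<And>f g. F (f * g) = F f * F g"
    and "F (var i) = var j" "F (var (Suc i)) = var (Suc j)" "\<And>f. F (s_op i f) = s_op j (F f)"
  shows "F (T i f) = T j (F f)"
proof (rule T_unique[symmetric])
  show "(var j - var (Suc j)) * F (T i f)
      = scal (1 - t) (var (Suc j)) * F f + (scal t (var j) - var (Suc j)) * s_op j (F f)"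
    using arg_cong[OF T_mult_diff[of i f], of F] assms(3-)
    by (simp add: mult linear_op_add[OF lin] linear_op_diff[OF lin] linear_op_scal[OF lin])
qed

text \<open>z_j and z_{j+1} are fixed by s_i, so T_i passes through the cleared equation that
  characterises T_j f.\<close>

lemma T_commute:
  assumes "Suc i < j \<or> Suc j < i"
  shows "T i (T j f) = T j (T i f)"
proof -
  let ?x = "var j" and ?y = "var (Suc j)"
  have inv: "s_op i ?x = ?x" "s_op i ?y = ?y"
    using assms by (auto simp: s_op_var transpose_def)
  have sT: "s_op j (T i f) = T i (s_op j f)"
    using assms by (intro T_intertwine) (auto simp: linear_op_s_op s_op_mult s_op_var s_op_commute transpose_def)
  have "(?x - ?y) * T i (T j f) = T i ((?x - ?y) * T j f)"
    by (rule T_mult_invariant[symmetric]) (simp add: s_op_hom inv)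
  also have "\<dots> = T i (scal (1 - t) ?y * f) + T i ((scal t ?x - ?y) * s_op j f)"
    by (simp add: T_mult_diff T_add)
  also have "\<dots> = scal (1 - t) ?y * T i f + (scal t ?x - ?y) * s_op j (T i f)"
    by (simp add: T_mult_invariant s_op_hom inv sT)
  finally show ?thesis by (rule T_unique[symmetric])
qed

lemma T_braid: "T i (T (Suc i) (T i f)) = T (Suc i) (T i (T (Suc i) f))"
proof -
  let ?j = "Suc i"
  let ?x = "var i" and ?y = "var (Suc i)" and ?z = "var (Suc (Suc i))" and ?u = "single 0 t :: laurent"
  have u: "scal t h = ?u * h" "scal (1 - t) h = (1 - ?u) * h" for h
    by (simp_all add: scal_def single_diff)
  have T1: "(?x - ?y) * T i h = (1 - ?u) * ?y * h + (?u * ?x - ?y) * s_op i h" for h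
    using T_mult_diff[of i h] by (simp add: u)
  have T2: "(?y - ?z) * T ?j h = (1 - ?u) * ?z * h + (?u * ?y - ?z) * s_op ?j h" for h
    using T_mult_diff[of ?j h] by (simp add: u)
  have v: "s_op i ?x = ?y" "s_op i ?y = ?x" "s_op i ?z = ?z"
    "s_op ?j ?x = ?x" "s_op ?j ?y = ?z" "s_op ?j ?z = ?y"
    by (simp_all add: s_op_var transpose_def)
  note S = s_op_hom s_op_mult v s_op_involutive
  have T1_1: "(?y - ?x) * s_op i (T i h) = (1 - ?u) * ?x * s_op i h + (?u * ?y - ?x) * h" for h
    using arg_cong[OF T1[of h], of "s_op i"] by (simp add: S)
  have T1_2: "(?x - ?z) * s_op ?j (T i h) = (1 - ?u) * ?z * s_op ?j h + (?u * ?x - ?z) * s_op ?j (s_op i h)" for h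
    using arg_cong[OF T1[of h], of "s_op ?j"] by (simp add: S)
  have T2_1: "(?x - ?z) * s_op i (T ?j h) = (1 - ?u) * ?z * s_op i h + (?u * ?x - ?z) * s_op i (s_op ?j h)" for h
    using arg_cong[OF T2[of h], of "s_op i"] by (simp add: S)
  have T2_2: "(?z - ?y) * s_op ?j (T ?j h) = (1 - ?u) * ?y * s_op ?j h + (?u * ?z - ?y) * h" for h
    using arg_cong[OF T2[of h], of "s_op ?j"] by (simp add: S)
  have T1_12: "(?y - ?z) * s_op i (s_op ?j (T i h))
      = (1 - ?u) * ?z * s_op i (s_op ?j h) + (?u * ?y - ?z) * s_op i (s_op ?j (s_op i h))" for h
    using arg_cong[OF T1_2[of h], of "s_op i"] by (simp add: S)
  have T2_21: "(?x - ?y) * s_op ?j (s_op i (T ?j h))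
      = (1 - ?u) * ?y * s_op ?j (s_op i h) + (?u * ?x - ?y) * s_op ?j (s_op i (s_op ?j h))" for h
    using arg_cong[OF T2_1[of h], of "s_op ?j"] by (simp add: S)
  \<comment> \<open>Folding with \<open>s_op_braid\<close> makes the two threefold swaps of f, which
    arise on the two sides, the same term \<open>f121\<close>.\<close>
  show ?thesis
    by (rule braid_identity[OF _ _ _ T1[of f] T1_2[of f] T1_1[of f] T1_12[of f] T2[of "T i f"]
          T2_1[of "T i f"] T1[of "T ?j (T i f)"] T2[of f] T2_1[of f] T2_2[of f]
          T2_21[of f, folded s_op_braid] T1[of "T ?j f"] T1_2[of "T ?j f"] T2[of "T i (T ?j f)"]])
      (auto simp: var_neq)
qed

lemma T_inverse:
  "T i (scal (1 / t) (T i f - scal (t - 1) f)) = f"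
  "scal (1 / t) (T i (T i f) - scal (t - 1) (T i f)) = f"
proof -
  have "scal (1 / t) (T i (T i f) - scal (t - 1) (T i f)) = scal (1 / t * t) f"
    by (simp only: T_quadratic add_diff_cancel_left' scal_simps(5))
  then show "scal (1 / t) (T i (T i f) - scal (t - 1) (T i f)) = f"
    by (simp add: scal_simps(6))
  then show "T i (scal (1 / t) (T i f - scal (t - 1) f)) = f"
    by (simp add: T_scal T_diff)
qed

lemma bij_T: "bij (T i)"
  by (rule o_bij[of "\<lambda>f. scal (1 / t) (T i f - scal (t - 1) f)"]) (auto simp: T_inverse)

lemma T_inv_T [simp]: "T i (inv' (T i) f) = f"
  and inv_T_T [simp]: "inv' (T i) (T i f) = f"
  using bij_T[of i] by (simp_all add: bij_is_surj surj_f_inv_f bij_is_inj)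

subsection \<open>The operators Y\<close>

definition cycle_perm :: "nat \<Rightarrow> nat \<Rightarrow> nat" where
  "cycle_perm n i = (if i = 1 then n else if 2 \<le> i \<and> i \<le> n then i - 1 else i)"

lemma cycle_perm_bij:
  assumes "n \<ge> 1"
  shows "bij (cycle_perm n)"
    and "inv' (cycle_perm n) = (\<lambda>j. if j = n then 1 else if 1 \<le> j \<and> j < n then j + 1 else j)"
proof -
  let ?\<rho> = "\<lambda>j. if j = n then 1 else if 1 \<le> j \<and> j < n then j + 1 else j"
  have *: "cycle_perm n \<circ> ?\<rho> = id" "?\<rho> \<circ> cycle_perm n = id"
    using assms by (auto simp: cycle_perm_def fun_eq_iff)
  from o_bij[OF *(2) *(1)] show "bij (cycle_perm n)" .
  from inv_unique_comp[OF *] show "inv' (cycle_perm n) = ?\<rho>" .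
qed

lemma \<omega>0_alt: "\<omega>0 n = subst_vars (\<lambda>i. if i = 1 then q else 1) (cycle_perm n)"
  by (simp add: \<omega>0_def cycle_perm_def[abs_def])

lemma linear_op_\<omega>0: "linear_op (\<omega>0 n)"
  by (simp add: \<omega>0_alt linear_op_subst_vars)

lemma \<omega>0_s_op:
  assumes "1 \<le> i" "Suc i < n"
  shows "\<omega>0 n (s_op (Suc i) f) = s_op i (\<omega>0 n f)"
proof (rule linear_op_eqI[of "\<lambda>f. \<omega>0 n (s_op (Suc i) f)" "\<lambda>f. s_op i (\<omega>0 n f)"])
  fix a
  let ?c = "\<lambda>i. if i = 1 then q else 1"
  \<comment> \<open>Only the exponent of z_1 contributes a power of q, and it is not moved by
    s_{i+1} for i at least 1.\<close>
  have weight: "weight ?c b = q powi lookup b 1" for b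
  proof -
    have "weight ?c b = (\<Prod>k\<in>insert 1 (keys b). (if k = 1 then q else 1) powi lookup b k)"
      by (rule weight_superset) auto
    also have "\<dots> = (\<Prod>k\<in>insert 1 (keys b). if k = 1 then q powi lookup b 1 else 1)"
      by (rule prod.cong) auto
    finally show ?thesis by simp
  qed
  have "weight ?c (swap_expo (Suc i) a) = weight ?c a"
    unfolding weight using assms by (simp add: lookup_swap_expo)
  moreover have inj: "inj (inv' (cycle_perm n))"
    using cycle_perm_bij(1)[of n] assms by (simp add: bij_imp_bij_inv bij_is_inj)
  note lk = fun_cong[OF map_key.rep_eq[OF inj, unfolded comp_def]]
  have "Poly_Mapping.map_key (inv' (cycle_perm n)) (swap_expo (Suc i) a)
      = swap_expo i (Poly_Mapping.map_key (inv' (cycle_perm n)) a)"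
    using assms by (intro poly_mapping_eqI, simp only: lk lookup_swap_expo)
      (auto simp: cycle_perm_bij(2) transpose_def)
  ultimately show "\<omega>0 n (s_op (Suc i) (single a 1)) = s_op i (\<omega>0 n (single a 1))"
    by (simp add: \<omega>0_alt s_op_single subst_vars_single)
qed (auto intro: linear_op_comp linear_op_s_op linear_op_\<omega>0)

text \<open>Away from the first variable \<open>\<omega>0\<close> lowers the index of a variable by
  one without a factor q, so \<open>T_intertwine\<close> applies.\<close>

lemma \<omega>0_T:
  assumes "1 \<le> i" "Suc i < n"
  shows "\<omega>0 n (T (Suc i) f) = T i (\<omega>0 n f)"
proof (rule T_intertwine)
  show "\<omega>0 n (var (Suc i)) = var i" "\<omega>0 n (var (Suc (Suc i))) = var (Suc i)"
    using assms by (simp_all add: \<omega>0_alt subst_vars_var cycle_perm_bij scal_simps)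
      (simp_all add: cycle_perm_def)
  show "\<omega>0 n (f * g) = \<omega>0 n f * \<omega>0 n g" for f g
    using assms by (simp add: \<omega>0_alt subst_vars_mult cycle_perm_bij)
qed (use assms in \<open>auto simp: linear_op_\<omega>0 \<omega>0_s_op\<close>)

section \<open>Words in T and the relations between Y and T\<close>

lemma T_word_simps [simp]:
  "T_word [] f = f" "T_word (i # w) f = T i (T_word w f)"
  "T_word (v @ w) f = T_word v (T_word w f)"
proof -
  have "T_word (v @ w) = T_word v \<circ> T_word w"
    by (induction v) (auto simp: T_word_def)
  then show "T_word (v @ w) f = T_word v (T_word w f)" by simp
qed (auto simp: T_word_def)

lemma Tinv_word_simps [simp]:
  "Tinv_word [] f = f" "Tinv_word (i # w) f = inv' (T i) (Tinv_word w f)"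
  "Tinv_word (v @ w) f = Tinv_word v (Tinv_word w f)"
proof -
  have "Tinv_word (v @ w) = Tinv_word v \<circ> Tinv_word w"
    by (induction v) (auto simp: Tinv_word_def)
  then show "Tinv_word (v @ w) f = Tinv_word v (Tinv_word w f)" by simp
qed (auto simp: Tinv_word_def)

lemma linear_op_inv_T: "linear_op (inv' (T i))"
proof (rule linear_opI)
  show "inv' (T i) (f + g) = inv' (T i) f + inv' (T i) g" for f g
    by (metis T_inv_T inv_T_T linear_op_T linear_op_add)
  show "inv' (T i) (scal c f) = scal c (inv' (T i) f)" for c f
    by (metis T_inv_T inv_T_T linear_op_T linear_op_scal)
qed

lemma linear_op_T_word: "linear_op (T_word w)" and linear_op_Tinv_word: "linear_op (Tinv_word w)"
proof -
  have "T_word (i # w) = (\<lambda>f. T i (T_word w f))"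
    "Tinv_word (i # w) = (\<lambda>f. inv' (T i) (Tinv_word w f))" for i w
    by auto
  then show "linear_op (T_word w)" "linear_op (Tinv_word w)"
    by (induction w) (auto intro: linear_op_comp linear_op_T linear_op_inv_T linear_opI)
qed

lemma linear_op_Y: "linear_op (Y n i)"
proof -
  have scal: "linear_op (scal c)" for c
    by (rule linear_opI) (simp_all add: scal_simps(1) mult.commute flip: scal_simps(5))
  show ?thesis
    unfolding Y_def[abs_def]
    by (rule linear_op_comp[OF scal] linear_op_comp[OF linear_op_T_word]
        linear_op_comp[OF linear_op_\<omega>0] linear_op_Tinv_word)+
qed

lemmas Y_add = linear_op_add[OF linear_op_Y] and Y_scal = linear_op_scal[OF linear_op_Y]

lemma T_word_commute:
  "(\<And>m. m \<in> set w \<Longrightarrow> Suc k < m \<or> Suc m < k) \<Longrightarrow> T k (T_word w f) = T_word w (T k f)"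
  by (induction w) (simp_all add: T_commute)

lemma inv_T_commute:
  assumes "Suc k < m \<or> Suc m < k"
  shows "T k (inv' (T m) f) = inv' (T m) (T k f)"
proof -
  have "T m (T k (inv' (T m) f)) = T k f"
    using assms by (subst T_commute) auto
  then show ?thesis by (metis inv_T_T)
qed

lemma Tinv_word_commute:
  "(\<And>m. m \<in> set w \<Longrightarrow> Suc k < m \<or> Suc m < k) \<Longrightarrow> T k (Tinv_word w f) = Tinv_word w (T k f)"
  by (induction w) (simp_all add: inv_T_commute)

text \<open>The braid relation rearranged. Passing two inverses raises the index by one, which
  offsets the lowering by \<open>\<omega>0\<close> in \<open>Y_T_commute\<close>.\<close>

lemma inv_T_braid:
  "inv' (T i) (inv' (T (Suc i)) (T i f))
    = T (Suc i) (inv' (T i) (inv' (T (Suc i)) f))"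
proof -
  define u where "u = inv' (T i) (inv' (T (Suc i)) f)"
  have "f = T (Suc i) (T i u)" by (simp add: u_def)
  then have "T i f = T (Suc i) (T i (T (Suc i) u))" by (simp add: T_braid)
  then show ?thesis by (simp add: u_def)
qed

text \<open>The word for Y_i has one more T_i on the left and one T_i^{-1} less on the right than
  the word for Y_{i+1}, and the powers of t differ by one.\<close>

lemma T_Y_Suc_T:
  assumes "1 \<le> i" "i < n"
  shows "T i (Y n (Suc i) (T i f)) = scal t (Y n i f)"
proof -
  have "[i..<n] = i # [Suc i..<n]" "[1..<Suc i] = [1..<i] @ [i]"
    using assms by (simp_all add: upt_conv_Cons)
  moreover have "t powi (int (Suc i) - int n) = t * t powi (int i - int n)"
    using power_int_add_1'[of t "int i - int n"] by (simp add: algebra_simps)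
  ultimately show ?thesis
    by (simp add: Y_def T_scal scal_simps(5))
qed

text \<open>Push T_i through the word for Y_j. For j < i it commutes with the inverses,
  \<open>\<omega>0\<close> lowers it to T_{i-1}, and the braid relation inside T_j ... T_{n-1}
  raises it again. For j > i + 1 the inverses raise it to T_{i+1}, \<open>\<omega>0\<close> lowers
  it to T_i, and the rest commutes with it.\<close>

lemma Y_T_commute:
  assumes i: "1 \<le> i" "i < n" and j: "1 \<le> j" "j \<le> n" "j \<noteq> i" "j \<noteq> Suc i"
  shows "Y n j (T i f) = T i (Y n j f)"
proof -
  define c where "c = t powi (int j - int n)"
  consider "j < i" | "Suc i < j" using j by linarith
  then show ?thesis
  proof cases
    case 1
    then obtain k where k: "i = Suc k" "1 \<le> k" "j \<le> k" using j by (cases i) auto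
    have w: "[j..<n] = [j..<k] @ [k, Suc k] @ [Suc (Suc k)..<n]"
    proof -
      have "[j..<n] = [j..<k] @ [k..<n]" using k i by (metis upt_add_eq_append le_add_diff_inverse less_imp_le Suc_lessD)
      with k i show ?thesis by (simp add: upt_conv_Cons)
    qed
    have c1: "T_word [Suc (Suc k)..<n] (T k h) = T k (T_word [Suc (Suc k)..<n] h)" for h
      by (rule T_word_commute[symmetric]) auto
    have c2: "T_word [j..<k] (T (Suc k) h) = T (Suc k) (T_word [j..<k] h)" for h
      by (rule T_word_commute[symmetric]) auto
    have "Y n j (T i f) = scal c (T_word [j..<n] (\<omega>0 n (T i (Tinv_word [1..<j] f))))"
      unfolding Y_def c_def by (subst Tinv_word_commute) (use 1 in auto)
    also have "\<dots> = scal c (T_word [j..<n] (T k (\<omega>0 n (Tinv_word [1..<j] f))))"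
      using k i by (simp add: \<omega>0_T)
    also have "T_word [j..<n] (T k h) = T i (T_word [j..<n] h)" for h
    proof -
      have "T_word [j..<n] (T k h) = T_word [j..<k] (T k (T (Suc k) (T k (T_word [Suc (Suc k)..<n] h))))"
        by (simp add: w c1)
      also have "\<dots> = T_word [j..<k] (T (Suc k) (T k (T (Suc k) (T_word [Suc (Suc k)..<n] h))))"
        by (simp only: T_braid)
      also have "\<dots> = T (Suc k) (T_word [j..<n] h)"
        by (simp add: w c2)
      finally show ?thesis by (simp add: k)
    qed
    finally show ?thesis
      by (simp add: Y_def c_def T_scal)
  next
    case 2
    have w: "[1..<j] = [1..<i] @ [i, Suc i] @ [Suc (Suc i)..<j]"
    proof -
      have "[1..<j] = [1..<i] @ [i..<j]" using 2 i by (metis upt_add_eq_append le_add_diff_inverse less_imp_le Suc_lessD)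
      with 2 i show ?thesis by (simp add: upt_conv_Cons)
    qed
    have c1: "Tinv_word [Suc (Suc i)..<j] (T i h) = T i (Tinv_word [Suc (Suc i)..<j] h)" for h
      by (rule Tinv_word_commute[symmetric]) auto
    have c2: "Tinv_word [1..<i] (T (Suc i) h) = T (Suc i) (Tinv_word [1..<i] h)" for h
      by (rule Tinv_word_commute[symmetric]) auto
    have inv: "Tinv_word [1..<j] (T i f) = T (Suc i) (Tinv_word [1..<j] f)"
    proof -
      have "Tinv_word [1..<j] (T i f) = Tinv_word [1..<i] (inv' (T i)
          (inv' (T (Suc i)) (T i (Tinv_word [Suc (Suc i)..<j] f))))"
        by (simp add: w c1 del: One_nat_def)
      also have "\<dots> = T (Suc i) (Tinv_word [1..<j] f)"
        by (simp add: w inv_T_braid c2 del: One_nat_def)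
      finally show ?thesis .
    qed
    have "Y n j (T i f) = scal c (T_word [j..<n] (T i (\<omega>0 n (Tinv_word [1..<j] f))))"
      using 2 i j by (simp only: Y_def c_def inv) (simp add: \<omega>0_T)
    also have "\<dots> = scal c (T i (T_word [j..<n] (\<omega>0 n (Tinv_word [1..<j] f))))"
      by (subst T_word_commute) (use 2 in auto)
    finally show ?thesis
      by (simp add: Y_def c_def T_scal)
  qed
qed

text \<open>On f and T_i f the operators Y_i and Y_{i+1} are triangular: Y_i T_i f = y T_i f + (t-1)
  x f and Y_{i+1} T_i f = x T_i f - (t-1) x f. Diagonalising leads for both to the single equation y
  kappa = (t-1) x + x kappa, which is solvable because x and y differ.\<close>

lemma Y_intertwiner:
  assumes i: "1 \<le> i" "i < n"
    and ev: "Y n i f = scal x f" "Y n (Suc i) f = scal y f"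
    and xy: "x \<noteq> y"
  defines "\<kappa> \<equiv> (t - 1) * x / (y - x)"
  shows "Y n i (T i f + scal \<kappa> f) = scal y (T i f + scal \<kappa> f)"
    and "Y n (Suc i) (T i f + scal \<kappa> f) = scal x (T i f + scal \<kappa> f)"
proof -
  have "(y - x) * \<kappa> = (t - 1) * x" using xy by (simp add: \<kappa>_def)
  then have \<kappa>: "y * \<kappa> = (t - 1) * x + x * \<kappa>" by (simp add: algebra_simps)
  \<comment> \<open>What is known is T_i h = t x f for the left side h. The quadratic relation
    expresses t h through T_i h and its image, and t is cancelled.\<close>
  have "Y n (Suc i) (T i f) = T i (scal x f) - scal (t - 1) (scal x f)"
  proof -
    let ?h = "Y n (Suc i) (T i f)"
    have Th: "T i ?h = scal t (scal x f)" using T_Y_Suc_T[OF i, of f] ev by simp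
    have "scal t ?h = T i (T i ?h) - scal (t - 1) (T i ?h)" by (simp add: T_quadratic)
    also have "\<dots> = scal t (T i (scal x f)) - scal (t - 1) (scal t (scal x f))"
      unfolding Th by (simp add: T_scal)
    also have "\<dots> = scal t (T i (scal x f) - scal (t - 1) (scal x f))"
      by (simp add: scal_simps flip: scal_simps(5)) (simp add: mult_ac)
    finally show ?thesis by (simp add: scal_cancel)
  qed
  then have Y2: "Y n (Suc i) (T i f) = scal x (T i f) - scal ((t - 1) * x) f"
    by (simp add: T_scal scal_simps(5))
  have "scal t (Y n i (T i f)) = T i (Y n (Suc i) (T i (T i f)))"
    by (rule T_Y_Suc_T[OF i, symmetric])
  also have "\<dots> = scal (t - 1) (scal t (Y n i f)) + scal t (T i (Y n (Suc i) f))"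
    by (simp add: T_quadratic Y_add Y_scal
        T_add T_scal T_Y_Suc_T[OF i])
  also have "\<dots> = scal t (scal ((t - 1) * x) f + scal y (T i f))"
    by (simp add: ev T_scal scal_simps(1) flip: scal_simps(5)) (simp add: mult_ac)
  finally have Y1: "Y n i (T i f) = scal ((t - 1) * x) f + scal y (T i f)"
    by (simp add: scal_cancel)
  show "Y n i (T i f + scal \<kappa> f) = scal y (T i f + scal \<kappa> f)"
    by (simp only: Y_add Y_scal Y1 ev scal_simps(1)
        scal_simps(5)[symmetric] \<kappa>)
      (simp add: scal_simps(3) mult.commute)
  have "\<kappa> * y = (t - 1) * x + x * \<kappa>" using \<kappa> by (simp add: mult.commute)
  then show "Y n (Suc i) (T i f + scal \<kappa> f) = scal x (T i f + scal \<kappa> f)"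
    by (simp only: Y_add Y_scal Y2 ev scal_simps(1)
        scal_simps(5)[symmetric])
      (simp add: scal_simps(3))
qed

subsection \<open>Reduced words\<close>

lemma word_perm_simps [simp]:
  "word_perm [] = id" "word_perm (i # w) = s i \<circ> word_perm w"
  "word_perm (v @ w) = word_perm v \<circ> word_perm w"
proof -
  show "word_perm (v @ w) = word_perm v \<circ> word_perm w"
    by (induction v) (auto simp: word_perm_def)
qed (auto simp: word_perm_def)

lemma s_s_comp [simp]: "s i \<circ> s i = id" "s i \<circ> (s i \<circ> \<sigma>) = \<sigma>"
  by (auto simp: fun_eq_iff)

lemma bij_word_perm [simp]: "bij (word_perm w)"
  by (induction w) (simp_all only: word_perm_simps bij_id bij_s bij_comp)

lemma inv_s_comp: "bij \<sigma> \<Longrightarrow> inv' (s i \<circ> \<sigma>) = inv' \<sigma> \<circ> s i"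
  by (simp add: o_inv_distrib)

lemma inv_word_perm: "inv' (word_perm w) = word_perm (rev w)"
  by (induction w) (simp_all only: word_perm_simps rev.simps inv_id inv_s_comp bij_word_perm comp_id)

lemma s_permutes: "i \<in> {1..<n} \<Longrightarrow> s i permutes {1..n}"
  by (rule permutes_swap_id) simp_all

lemma word_perm_permutes: "set w \<subseteq> {1..<n} \<Longrightarrow> word_perm w permutes {1..n}"
proof (induction w)
  case Nil
  show ?case by (simp only: word_perm_simps permutes_id)
next
  case (Cons i w)
  then have "word_perm w permutes {1..n}" "s i permutes {1..n}"
    using s_permutes[of i n] by simp_all
  then show ?case by (simp only: word_perm_simps permutes_compose)
qed

lemma W_iff:
  assumes "K \<subseteq> {1..<n}"
  shows "\<sigma> \<in> W n K \<longleftrightarrow> (\<exists>w. set w \<subseteq> K \<and> word_perm w = \<sigma>)"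
proof
  assume "\<sigma> \<in> W n K"
  then show "\<exists>w. set w \<subseteq> K \<and> word_perm w = \<sigma>" unfolding W_def
  proof (induction rule: generate.induct)
    case one
    then show ?case by (intro exI[of _ "[]"]) (simp add: sym_group_one)
  next
    case (incl h)
    then obtain i where "i \<in> K" "h = s i" by auto
    then show ?case by (intro exI[of _ "[i]"]) auto
  next
    case (inv h)
    then obtain i where i: "i \<in> K" "h = s i" by auto
    then have "s i \<in> carrier (sym_group n)"
      using assms s_permutes[of i n] by (auto simp: sym_group_carrier)
    then have "inv\<^bsub>sym_group n\<^esub> h = s i" using i by simp
    then show ?case using i by (intro exI[of _ "[i]"]) auto
  next
    case (eng h1 h2)
    then obtain v w where "set v \<subseteq> K" "word_perm v = h1" "set w \<subseteq> K" "word_perm w = h2" by auto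
    then show ?case by (intro exI[of _ "v @ w"]) (auto simp: sym_group_mult)
  qed
next
  have "word_perm w \<in> generate (sym_group n) (s ` K)" if "set w \<subseteq> K" for w
    using that
  proof (induction w)
    case Nil
    then show ?case using generate.one[of "sym_group n" "s ` K"] by (simp only: sym_group_one word_perm_simps)
  next
    case (Cons i w)
    then show ?case
      using generate.eng[OF generate.incl[of "s i" "s ` K" "sym_group n"], of "word_perm w"]
      by (simp only: sym_group_mult word_perm_simps set_simps insert_subset image_eqI)
  qed
  then show "\<exists>w. set w \<subseteq> K \<and> word_perm w = \<sigma> \<Longrightarrow> \<sigma> \<in> W n K"
    by (auto simp: W_def)
qed

context
  fixes n :: nat and K :: "nat set"
  assumes K: "K \<subseteq> {1..<n}"
begin

lemma W_permutes: "\<sigma> \<in> W n K \<Longrightarrow> \<sigma> permutes {1..n}"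
  unfolding W_iff[OF K] using K word_perm_permutes by blast

lemma W_bij: "\<sigma> \<in> W n K \<Longrightarrow> bij \<sigma>"
  using K by (auto simp: W_iff)

lemma finite_W: "finite (W n K)"
  by (rule finite_subset[of _ "{\<sigma>. \<sigma> permutes {1..n}}"]) (auto intro: W_permutes finite_permutations simp del: One_nat_def)

lemma W_id: "id \<in> W n K"
  using K by (auto simp: W_iff intro: exI[of _ "[]"])

lemma W_s_comp: "i \<in> K \<Longrightarrow> \<sigma> \<in> W n K \<Longrightarrow> s i \<circ> \<sigma> \<in> W n K"
proof -
  assume "i \<in> K" "\<sigma> \<in> W n K"
  then obtain w where "set (i # w) \<subseteq> K" "word_perm (i # w) = s i \<circ> \<sigma>" using K by (auto simp: W_iff)
  then show ?thesis unfolding W_iff[OF K] by blast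
qed

lemma W_comp: "\<sigma> \<in> W n K \<Longrightarrow> \<tau> \<in> W n K \<Longrightarrow> \<sigma> \<circ> \<tau> \<in> W n K"
proof -
  assume "\<sigma> \<in> W n K" "\<tau> \<in> W n K"
  then obtain v w where "set (v @ w) \<subseteq> K" "word_perm (v @ w) = \<sigma> \<circ> \<tau>" using K by (auto simp: W_iff)
  then show ?thesis unfolding W_iff[OF K] by blast
qed

lemma W_inv: "\<sigma> \<in> W n K \<Longrightarrow> inv' \<sigma> \<in> W n K"
  unfolding W_iff[OF K] using inv_word_perm by (metis set_rev)

lemma W_induct [consumes 1, case_names id s]:
  assumes "\<sigma> \<in> W n K" "P id" "\<And>i \<sigma>. i \<in> K \<Longrightarrow> \<sigma> \<in> W n K \<Longrightarrow> P \<sigma> \<Longrightarrow> P (s i \<circ> \<sigma>)"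
  shows "P \<sigma>"
proof -
  have "set w \<subseteq> K \<Longrightarrow> P (word_perm w)" for w
  proof (induction w)
    case (Cons i w)
    moreover from Cons have "word_perm w \<in> W n K" using K by (auto simp: W_iff)
    ultimately show ?case using assms(3)[of i "word_perm w"] by (simp only: word_perm_simps set_simps insert_subset)
  qed (use assms(2) in \<open>simp only: word_perm_simps\<close>)
  then show ?thesis using assms(1) K by (auto simp: W_iff)
qed

text \<open>Only s_r moves a point across the border between r and r + 1. This simple invariant
  replaces the theory of parabolic subgroups: it confines descents to \<open>K\<close> and makes the
  elements of W_I fix the places that belong to \<open>J\<close>.\<close>

lemma W_preserves:
  assumes "\<sigma> \<in> W n K" "r \<notin> K"
  shows "\<sigma> x \<le> r \<longleftrightarrow> x \<le> r"
  using assms(1)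
proof (induction rule: W_induct)
  case (s i \<sigma>)
  then have "i \<noteq> r" using assms by auto
  then have "s i y \<le> r \<longleftrightarrow> y \<le> r" for y by (auto simp: transpose_def)
  with s show ?case by simp
qed simp

end

text \<open>\<open>ascent \<sigma> i\<close> means that multiplying by \<open>s i\<close> on the left increases the length.\<close>

definition ascent :: "(nat \<Rightarrow> nat) \<Rightarrow> nat \<Rightarrow> bool" where
  "ascent \<sigma> i \<longleftrightarrow> inv' \<sigma> i < inv' \<sigma> (Suc i)"

lemma ascent_s_comp:
  assumes "bij \<sigma>"
  shows "ascent (s i \<circ> \<sigma>) i \<longleftrightarrow> \<not> ascent \<sigma> i"
proof -
  have "inv' \<sigma> i \<noteq> inv' \<sigma> (Suc i)"
    using assms bij_inv_eq_iff by (metis n_not_Suc_n)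
  then show ?thesis using assms by (auto simp: ascent_def inv_s_comp)
qed

text \<open>For i outside \<open>K\<close> the inverse permutation preserves the initial segment up
  to i, which forces an ascent at i.\<close>

lemma W_descent_in:
  assumes "K \<subseteq> {1..<n}" "\<sigma> \<in> W n K" "\<not> ascent \<sigma> i"
  shows "i \<in> K"
proof (rule ccontr)
  assume "i \<notin> K"
  note * = W_preserves[OF assms(1) W_inv[OF assms(1,2)] this]
  show False using *[of i] *[of "Suc i"] assms(3) by (auto simp: ascent_def)
qed

section \<open>Length as the number of inversions\<close>

definition inversions :: "nat \<Rightarrow> (nat \<Rightarrow> nat) \<Rightarrow> (nat \<times> nat) set" where
  "inversions n \<sigma> = {(a, b). 1 \<le> a \<and> a < b \<and> b \<le> n \<and> \<sigma> b < \<sigma> a}"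

lemma finite_inversions: "finite (inversions n \<sigma>)"
  by (rule finite_subset[of _ "{1..n} \<times> {1..n}"]) (auto simp: inversions_def)

text \<open>Exchanging the adjacent values i and i+1 affects the relative order of just one pair of
  positions, the one where these values sit.\<close>

lemma card_inversions_s_comp:
  assumes \<sigma>: "\<sigma> permutes {1..n}" and i: "i \<in> {1..<n}" and "ascent \<sigma> i"
  shows "card (inversions n (s i \<circ> \<sigma>)) = Suc (card (inversions n \<sigma>))"
proof -
  define a b where "a = inv' \<sigma> i" and "b = inv' \<sigma> (Suc i)"
  have ab: "\<sigma> x = i \<longleftrightarrow> x = a" "\<sigma> x = Suc i \<longleftrightarrow> x = b" for x
    using permutes_inv_eq[OF \<sigma>, of i x] permutes_inv_eq[OF \<sigma>, of "Suc i" x]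
    by (metis a_def, metis b_def)
  have "a \<in> {1..n}" "b \<in> {1..n}"
    using i permutes_in_image[OF permutes_inv[OF \<sigma>]] by (auto simp: a_def b_def)
  moreover have "a < b" using assms(3) by (simp add: ascent_def a_def b_def)
  moreover have "s i (\<sigma> y) < s i (\<sigma> x) \<longleftrightarrow> \<sigma> y < \<sigma> x \<or> (x = a \<and> y = b)" if "x < y" for x y
  proof -
    have "\<sigma> x \<noteq> \<sigma> y" using \<sigma> that by (metis permutes_inj injD less_irrefl)
    moreover have "\<not> (\<sigma> x = Suc i \<and> \<sigma> y = i)" using that \<open>a < b\<close> by (auto simp: ab)
    moreover have "\<sigma> x = i \<and> \<sigma> y = Suc i \<longleftrightarrow> x = a \<and> y = b" by (simp add: ab)
    ultimately show ?thesis by (auto simp: transpose_def split: if_splits)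
  qed
  ultimately have "inversions n (s i \<circ> \<sigma>) = insert (a, b) (inversions n \<sigma>)"
    by (auto simp: inversions_def)
  moreover have "(a, b) \<notin> inversions n \<sigma>"
    using ab(1)[of a] ab(2)[of b] by (simp add: inversions_def)
  ultimately show ?thesis by (simp add: finite_inversions)
qed

lemma strictly_increasing_permutes_id:
  assumes p: "p permutes {1..n}" and mono: "\<And>i. i \<in> {1..<n} \<Longrightarrow> p i < p (Suc i)"
  shows "p = id"
proof -
  have ge: "1 \<le> i \<Longrightarrow> i \<le> n \<Longrightarrow> i \<le> p i" for i
  proof (induction i rule: nat_induct_at_least)
    case base
    then show ?case using permutes_in_image[OF p, of 1] by auto
  next
    case (Suc i)
    then show ?case using mono[of i] by simp
  qed
  have le: "k < n \<Longrightarrow> p (n - k) \<le> n - k" for k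
  proof (induction k)
    case 0
    then show ?case using permutes_in_image[OF p, of n] by auto
  next
    case (Suc k)
    then show ?case using mono[of "n - Suc k"] by (simp add: Suc_diff_Suc) linarith
  qed
  show ?thesis
  proof
    fix i show "p i = id i"
    proof (cases "i \<in> {1..n}")
      case True
      then show ?thesis using ge[of i] le[of "n - i"] by auto
    qed (use p in \<open>auto simp: permutes_def\<close>)
  qed
qed

lemma card_inversions_s_comp_descent:
  assumes \<sigma>: "\<sigma> permutes {1..n}" and i: "i \<in> {1..<n}" and "\<not> ascent \<sigma> i"
  shows "card (inversions n \<sigma>) = Suc (card (inversions n (s i \<circ> \<sigma>)))"
  using card_inversions_s_comp[OF permutes_compose[OF \<sigma> s_permutes[OF i]] i] assms
  by (simp add: ascent_s_comp permutes_bij)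

lemma card_inversions_le_length: "set w \<subseteq> {1..<n} \<Longrightarrow> card (inversions n (word_perm w)) \<le> length w"
proof (induction w)
  case Nil
  have "inversions n id = {}" by (auto simp: inversions_def)
  then show ?case by (simp only: word_perm_simps card.empty list.size order_refl)
next
  case (Cons i w)
  then have w: "word_perm w permutes {1..n}" and i: "i \<in> {1..<n}"
    and le: "card (inversions n (word_perm w)) \<le> length w"
    by (auto intro: word_perm_permutes simp del: One_nat_def)
  have "card (inversions n (s i \<circ> word_perm w)) \<le> Suc (card (inversions n (word_perm w)))"
    using card_inversions_s_comp[OF w i] card_inversions_s_comp_descent[OF w i]
    by (cases "ascent (word_perm w) i") linarith+
  with le show ?case by (simp only: word_perm_simps list.size)
qed

text \<open>Sorting by adjacent exchanges: each descent can be removed at the price of one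
  inversion, and without descents the permutation is the identity.\<close>

lemma word_of_permutes:
  assumes "\<sigma> permutes {1..n}"
  shows "\<exists>w. set w \<subseteq> {1..<n} \<and> word_perm w = \<sigma> \<and> length w = card (inversions n \<sigma>)"
  using assms
proof (induction "card (inversions n \<sigma>)" arbitrary: \<sigma> rule: less_induct)
  case less
  show ?case
  proof (cases "\<exists>i\<in>{1..<n}. \<not> ascent \<sigma> i")
    case True
    then obtain i where i: "i \<in> {1..<n}" "\<not> ascent \<sigma> i" by blast
    note c = card_inversions_s_comp_descent[OF less.prems i]
    obtain w where w: "set w \<subseteq> {1..<n}" "word_perm w = s i \<circ> \<sigma>"
      "length w = card (inversions n (s i \<circ> \<sigma>))"
      using less.hyps[of "s i \<circ> \<sigma>"] c permutes_compose[OF less.prems s_permutes[OF i(1)]] by auto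
    then show ?thesis using c i by (intro exI[of _ "i # w"]) auto
  next
    case False
    then have "inv' \<sigma> = id"
      by (intro strictly_increasing_permutes_id[OF permutes_inv[OF less.prems]]) (auto simp: ascent_def)
    then have "\<sigma> = id" using less.prems by (metis inv_inv_eq inv_id permutes_bij)
    moreover have "inversions n id = {}" by (auto simp: inversions_def)
    ultimately show ?thesis by (intro exI[of _ "[]"]) auto
  qed
qed

lemma len_eq_card_inversions:
  assumes "\<sigma> permutes {1..n}"
  shows "len n \<sigma> = card (inversions n \<sigma>)"
  unfolding len_def
  by (rule Least_equality) (use word_of_permutes[OF assms] card_inversions_le_length in auto)

lemma reduced_word_ex: "\<sigma> permutes {1..n} \<Longrightarrow> \<exists>w. reduced_word n \<sigma> w"
  using word_of_permutes[of \<sigma> n] by (auto simp: reduced_word_def len_eq_card_inversions)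

lemma len_ascent:
  assumes "\<sigma> permutes {1..n}" "i \<in> {1..<n}"
  shows "ascent \<sigma> i \<Longrightarrow> len n (s i \<circ> \<sigma>) = Suc (len n \<sigma>)"
    and "\<not> ascent \<sigma> i \<Longrightarrow> len n \<sigma> = Suc (len n (s i \<circ> \<sigma>))"
  using assms card_inversions_s_comp[of \<sigma> n i] card_inversions_s_comp_descent[of \<sigma> n i]
    permutes_compose[OF assms(1) s_permutes[OF assms(2)]]
  by (simp_all add: len_eq_card_inversions)

lemma len_id: "len n id = 0"
  unfolding len_def by (rule Least_eq_0) (auto intro: exI[of _ "[]"])

lemma reduced_word_ConsD:
  assumes "reduced_word n \<sigma> (i # w)"
  shows "i \<in> {1..<n}" "reduced_word n (s i \<circ> \<sigma>) w" "\<not> ascent \<sigma> i"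
proof -
  have *: "i \<in> {1..<n}" "set w \<subseteq> {1..<n}" "word_perm w = s i \<circ> \<sigma>" "len n \<sigma> = Suc (length w)"
    and \<sigma>: "\<sigma> permutes {1..n}"
    using assms word_perm_permutes[of "i # w" n] by (auto simp: reduced_word_def)
  show "i \<in> {1..<n}" by fact
  have "s i \<circ> \<sigma> permutes {1..n}" using * \<sigma> by (intro permutes_compose s_permutes)
  then have le: "len n (s i \<circ> \<sigma>) \<le> length w"
    using card_inversions_le_length[OF *(2)] *(3) by (simp add: len_eq_card_inversions)
  with len_ascent(1)[OF \<sigma> *(1)] *(4) show "\<not> ascent \<sigma> i" by (cases "ascent \<sigma> i") linarith+
  with len_ascent(2)[OF \<sigma> *(1)] * show "reduced_word n (s i \<circ> \<sigma>) w" by (simp add: reduced_word_def)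
qed

lemma reduced_word_ConsI:
  assumes "\<sigma> permutes {1..n}" "i \<in> {1..<n}" "\<not> ascent \<sigma> i" "reduced_word n (s i \<circ> \<sigma>) w"
  shows "reduced_word n \<sigma> (i # w)"
  using assms len_ascent[of \<sigma> n i] by (simp add: reduced_word_def)

text \<open>The first letter of a reduced word is a descent, and descents of elements of W_K lie in
  \<open>K\<close>. Hence reduced words taken in S_n for elements of a subgroup W_K use its own
  generators.\<close>

lemma reduced_word_letters:
  assumes "K \<subseteq> {1..<n}" "\<sigma> \<in> W n K" "reduced_word n \<sigma> w"
  shows "set w \<subseteq> K"
  using assms(2,3)
proof (induction w arbitrary: \<sigma>)
  case (Cons i w)
  note * = reduced_word_ConsD[OF Cons.prems(2)]
  have "i \<in> K" using W_descent_in[OF assms(1) Cons.prems(1) *(3)] .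
  with Cons.IH[OF W_s_comp[OF assms(1) _ Cons.prems(1)] *(2)] show ?case by simp
qed simp

lemma s_comp_commute: "Suc i < j \<or> Suc j < i \<Longrightarrow> s i \<circ> s j = s j \<circ> s i"
  by (auto simp: fun_eq_iff transpose_def)

text \<open>Matsumoto's theorem: if two reduced words start with different letters, both letters are
  descents, so each word can be traded for one starting with the longest element of the dihedral
  group that the two letters generate.\<close>

lemma T_word_reduced_unique:
  assumes "reduced_word n \<sigma> w" "reduced_word n \<sigma> v"
  shows "T_word w f = T_word v f"
  using assms
proof (induction "length w" arbitrary: \<sigma> w v f rule: less_induct)
  case less
  have \<sigma>: "\<sigma> permutes {1..n}" and len: "length v = length w"
    using less.prems word_perm_permutes by (auto simp: reduced_word_def)
  show ?case
  proof (cases w)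
    case Nil
    with len show ?thesis by simp
  next
    case w: (Cons i w')
    with len obtain j v' where v: "v = j # v'" by (cases v) auto
    note i = reduced_word_ConsD[OF less.prems(1)[unfolded w]]
    note j = reduced_word_ConsD[OF less.prems(2)[unfolded v]]
    have IHw: "T_word w' g = T_word u g" if "reduced_word n (s i \<circ> \<sigma>) u" for u g
      using less.hyps[OF _ i(2) that] w by simp
    have IHv: "T_word v' g = T_word u g" if "reduced_word n (s j \<circ> \<sigma>) u" for u g
      using less.hyps[OF _ j(2) that] v len w by simp
    have perm: "s k \<circ> \<tau> permutes {1..n}" if "\<tau> permutes {1..n}" "k \<in> {1..<n}" for k \<tau>
      using permutes_compose[OF that(1) s_permutes[OF that(2)]] .
    note inv = inv_s_comp bij_comp permutes_bij[OF \<sigma>]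
    \<comment> \<open>Stated for the unordered pair of letters, so that it covers both orders of two
      neighbours.\<close>
    have braid: "T_word w f = T_word v f" if k: "{i, j} = {k, Suc k}" for k
    proof -
      have kn: "k \<in> {1..<n}" "Suc k \<in> {1..<n}" and d: "\<not> ascent \<sigma> k" "\<not> ascent \<sigma> (Suc k)"
        using i j k by (auto simp: doubleton_eq_iff)
      let ?a = "s k" and ?b = "s (Suc k)"
      have eq: "?a \<circ> (?b \<circ> (?a \<circ> \<sigma>)) = ?b \<circ> (?a \<circ> (?b \<circ> \<sigma>))"
        by (auto simp: fun_eq_iff transpose_def)
      obtain x where x: "reduced_word n (?a \<circ> (?b \<circ> (?a \<circ> \<sigma>))) x"
        using reduced_word_ex perm \<sigma> kn by meson
      have d2: "\<not> ascent (?b \<circ> (?a \<circ> \<sigma>)) k" "\<not> ascent (?a \<circ> \<sigma>) (Suc k)"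
        "\<not> ascent (?a \<circ> (?b \<circ> \<sigma>)) (Suc k)" "\<not> ascent (?b \<circ> \<sigma>) k"
        using d by (simp_all add: ascent_def inv transpose_def)
      have a: "reduced_word n (?a \<circ> \<sigma>) (Suc k # k # x)"
        using x d2 by (intro reduced_word_ConsI perm \<sigma> kn)
      have b: "reduced_word n (?b \<circ> \<sigma>) (k # Suc k # x)"
        using x d2 unfolding eq by (intro reduced_word_ConsI perm \<sigma> kn)
      from k consider "i = k" "j = Suc k" | "i = Suc k" "j = k" by (auto simp: doubleton_eq_iff)
      then show ?thesis
        by cases (use IHw IHv a b T_braid[of k] w v in auto)
    qed
    consider "i = j" | "Suc i < j \<or> Suc j < i" | "j = Suc i" | "i = Suc j" by linarith
    then show ?thesis
    proof cases
      case 1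
      then show ?thesis using IHw[of v'] j w v by simp
    next
      case 2
      then have eq: "s i \<circ> (s j \<circ> \<sigma>) = s j \<circ> (s i \<circ> \<sigma>)"
        using s_comp_commute[of i j] by (simp add: o_assoc)
      obtain x where x: "reduced_word n (s j \<circ> (s i \<circ> \<sigma>)) x"
        using reduced_word_ex perm \<sigma> i(1) j(1) by meson
      have d: "\<not> ascent (s i \<circ> \<sigma>) j" "\<not> ascent (s j \<circ> \<sigma>) i"
        using i(3) j(3) 2 by (auto simp: ascent_def inv transpose_def)
      have "reduced_word n (s i \<circ> \<sigma>) (j # x)"
        using x d by (intro reduced_word_ConsI perm \<sigma> i j)
      moreover have "reduced_word n (s j \<circ> \<sigma>) (i # x)"
        using x d unfolding eq[symmetric] by (intro reduced_word_ConsI perm \<sigma> i j)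
      ultimately show ?thesis using IHw IHv T_commute[OF 2] w v by simp
    qed (use braid in auto)
  qed
qed

lemma T_perm_eq_T_word:
  assumes "reduced_word n \<sigma> w"
  shows "T_perm n \<sigma> f = T_word w f"
  unfolding T_perm_def using T_word_reduced_unique assms someI[of "reduced_word n \<sigma>"] by metis

lemma T_perm_s_comp:
  assumes "\<sigma> permutes {1..n}" "i \<in> {1..<n}" "ascent \<sigma> i"
  shows "T_perm n (s i \<circ> \<sigma>) f = T i (T_perm n \<sigma> f)"
proof -
  obtain w where w: "reduced_word n \<sigma> w" using reduced_word_ex assms by blast
  have "reduced_word n (s i \<circ> \<sigma>) (i # w)"
    using assms w by (intro reduced_word_ConsI permutes_compose s_permutes)
      (simp_all add: ascent_s_comp permutes_bij)
  with w show ?thesis by (simp add: T_perm_eq_T_word)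
qed

subsection \<open>The symmetrizer\<close>

lemma act_apply:
  assumes "bij \<sigma>"
  shows "lookup (act \<sigma> \<eta>) k = lookup \<eta> (inv' \<sigma> k)"
  using map_key.rep_eq[of "inv' \<sigma>" \<eta>] assms
  by (simp add: act_def bij_imp_bij_inv bij_is_inj)

lemma act_id [simp]: "act id \<eta> = \<eta>"
  by (rule poly_mapping_eqI) (simp add: act_apply)

lemma act_comp: "bij \<sigma> \<Longrightarrow> bij \<tau> \<Longrightarrow> act (\<sigma> \<circ> \<tau>) \<eta> = act \<sigma> (act \<tau> \<eta>)"
  by (rule poly_mapping_eqI) (simp add: act_apply bij_comp o_inv_distrib)

lemma act_s: "act (s i) \<eta> = swap_expo i \<eta>"
  by (simp add: act_def swap_expo_def)

section \<open>The subgroups of an admissible pair and the symmetrizer\<close>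

context
  fixes n :: nat and I J :: "nat set"
  assumes adm: "admissible n I J"
begin

lemma adm_subset: "I \<subseteq> {1..<n}" "J \<subseteq> {1..<n}" "I \<union> J \<subseteq> {1..<n}"
  using adm by (auto simp: admissible_def)

text \<open>None of j - 1, j, j + 1 lies in \<open>I\<close>, so the three initial segments ending
  there are preserved; comparing them isolates the points j and j + 1.\<close>

lemma W_I_fixes_J:
  assumes "j \<in> J" "\<sigma> \<in> W n I"
  shows "\<sigma> j = j" "\<sigma> (Suc j) = Suc j"
proof -
  have j: "j \<notin> I" "Suc j \<notin> I" "j - 1 \<notin> I" "1 \<le> j" using adm assms(1) by (auto simp: admissible_def)
  note pres = W_preserves[OF adm_subset(1) assms(2)]
  have "\<sigma> j \<le> j" "\<not> \<sigma> j \<le> j - 1" "\<sigma> (Suc j) \<le> Suc j" "\<not> \<sigma> (Suc j) \<le> j"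
    using j by (auto simp: pres)
  then show "\<sigma> j = j" "\<sigma> (Suc j) = Suc j" by auto
qed

lemma s_J_commute_W_I:
  assumes "j \<in> J" "\<sigma> \<in> W n I"
  shows "s j \<circ> \<sigma> = \<sigma> \<circ> s j"
proof -
  have "inj \<sigma>" using W_bij[OF adm_subset(1) assms(2)] by (rule bij_is_inj)
  then have *: "\<sigma> x = j \<longleftrightarrow> x = j" "\<sigma> x = Suc j \<longleftrightarrow> x = Suc j" for x
    using W_I_fixes_J[OF assms] by (metis injD)+
  have "s j (\<sigma> x) = \<sigma> (s j x)" for x
  proof (cases "x = j \<or> x = Suc j")
    case True
    with W_I_fixes_J[OF assms] show ?thesis by auto
  qed (simp add: *)
  then show ?thesis by (simp add: fun_eq_iff)
qed

lemma W_J_commute_W_I: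
  assumes "\<tau> \<in> W n J" "\<sigma> \<in> W n I"
  shows "\<tau> \<circ> \<sigma> = \<sigma> \<circ> \<tau>"
  using assms(1)
proof (induction rule: W_induct[OF adm_subset(2), consumes 1, case_names id s])
  case (s j \<tau>)
  have "(s j \<circ> \<tau>) \<circ> \<sigma> = s j \<circ> (\<tau> \<circ> \<sigma>)" by (rule comp_assoc)
  also have "\<dots> = (s j \<circ> \<sigma>) \<circ> \<tau>" by (simp only: s.IH comp_assoc)
  also have "\<dots> = \<sigma> \<circ> (s j \<circ> \<tau>)" by (simp only: s_J_commute_W_I[OF s.hyps(1) assms(2)] comp_assoc)
  finally show ?case .
qed simp

lemma W_decomp:
  assumes "\<omega> \<in> W n (I \<union> J)"
  shows "\<exists>\<sigma>\<in>W n I. \<exists>\<tau>\<in>W n J. \<omega> = \<sigma> \<circ> \<tau>"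
  using assms
proof (induction rule: W_induct[OF adm_subset(3), consumes 1, case_names id s])
  case id
  have "id = id \<circ> (id :: nat \<Rightarrow> nat)" by simp
  then show ?case using W_id[OF adm_subset(1)] W_id[OF adm_subset(2)] by blast
next
  case (s i \<omega>)
  then obtain \<sigma> \<tau> where *: "\<sigma> \<in> W n I" "\<tau> \<in> W n J" "\<omega> = \<sigma> \<circ> \<tau>" by blast
  show ?case
  proof (cases "i \<in> I")
    case True
    then have "s i \<circ> \<sigma> \<in> W n I" using * by (intro W_s_comp[OF adm_subset(1)])
    moreover have "s i \<circ> \<omega> = (s i \<circ> \<sigma>) \<circ> \<tau>" using * by (simp only: comp_assoc)
    ultimately show ?thesis using * by blast
  next
    case False
    then have i: "i \<in> J" using s by blast
    then have "s i \<circ> \<tau> \<in> W n J" using * by (intro W_s_comp[OF adm_subset(2)])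
    moreover have "s i \<circ> \<omega> = \<sigma> \<circ> (s i \<circ> \<tau>)"
      unfolding *(3) comp_assoc[symmetric] s_J_commute_W_I[OF i *(1)] ..
    ultimately show ?thesis using * by blast
  qed
qed

lemma W_inter_trivial:
  assumes "\<sigma> \<in> W n I" "\<sigma> \<in> W n J"
  shows "\<sigma> = id"
proof -
  obtain w where w: "reduced_word n \<sigma> w"
    using reduced_word_ex W_permutes[OF adm_subset(1) assms(1)] by blast
  have "set w \<subseteq> I" "set w \<subseteq> J"
    using reduced_word_letters[OF adm_subset(1) assms(1) w] reduced_word_letters[OF adm_subset(2) assms(2) w]
    by auto
  then have "w = []" using adm by (cases w) (auto simp: admissible_def)
  then show ?thesis using w by (simp add: reduced_word_def)
qed

text \<open>Two factorizations of one element differ by an element of both W_I and W_J, which is the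
  identity since a reduced word of it has letters in two disjoint sets.\<close>

lemma J_part_eq:
  assumes \<sigma>: "\<sigma> \<in> W n I" and \<tau>: "\<tau> \<in> W n J"
  shows "J_part n I J (\<sigma> \<circ> \<tau>) = \<tau>"
  unfolding J_part_def
proof (rule the_equality)
  show "\<tau> \<in> W n J \<and> (\<exists>\<omega>I\<in>W n I. \<sigma> \<circ> \<tau> = \<omega>I \<circ> \<tau>)" using assms by blast
next
  fix \<tau>' assume "\<tau>' \<in> W n J \<and> (\<exists>\<omega>I\<in>W n I. \<sigma> \<circ> \<tau> = \<omega>I \<circ> \<tau>')"
  then obtain \<sigma>' where *: "\<tau>' \<in> W n J" "\<sigma>' \<in> W n I" and eq: "\<sigma> \<circ> \<tau> = \<sigma>' \<circ> \<tau>'" by blast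
  have bij: "bij \<sigma>'" "bij \<tau>"
    using W_bij[OF adm_subset(1) *(2)] W_bij[OF adm_subset(2) \<tau>] by auto
  have "inv' \<sigma>' \<circ> \<sigma> = inv' \<sigma>' \<circ> (\<sigma> \<circ> \<tau>) \<circ> inv' \<tau>"
    using bij by (simp add: comp_assoc bij_is_surj[THEN surj_iff[THEN iffD1]])
  also have "\<dots> = \<tau>' \<circ> inv' \<tau>"
    using bij unfolding eq comp_assoc[symmetric] by (simp add: bij_is_inj)
  finally have eq': "inv' \<sigma>' \<circ> \<sigma> = \<tau>' \<circ> inv' \<tau>" .
  have "inv' \<sigma>' \<circ> \<sigma> \<in> W n I"
    by (intro W_comp[OF adm_subset(1)] W_inv[OF adm_subset(1)] \<sigma> *)
  moreover have "\<tau>' \<circ> inv' \<tau> \<in> W n J"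
    by (intro W_comp[OF adm_subset(2)] W_inv[OF adm_subset(2)] \<tau> *)
  ultimately have "\<tau>' \<circ> inv' \<tau> = id" using eq' W_inter_trivial by metis
  then have "\<tau>' \<circ> (inv' \<tau> \<circ> \<tau>) = \<tau>" by (simp only: comp_assoc[symmetric] id_comp)
  then show "\<tau>' = \<tau>" using bij by (simp add: bij_is_inj)
qed

lemma J_part_s_comp:
  assumes "\<omega> \<in> W n (I \<union> J)"
  shows "i \<in> I \<Longrightarrow> J_part n I J (s i \<circ> \<omega>) = J_part n I J \<omega>"
    and "j \<in> J \<Longrightarrow> J_part n I J (s j \<circ> \<omega>) = s j \<circ> J_part n I J \<omega>"
    and "J_part n I J \<omega> \<in> W n J"
    and "j \<in> J \<Longrightarrow> ascent (J_part n I J \<omega>) j \<longleftrightarrow> ascent \<omega> j"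
proof -
  obtain \<sigma> \<tau> where *: "\<sigma> \<in> W n I" "\<tau> \<in> W n J" "\<omega> = \<sigma> \<circ> \<tau>" using W_decomp[OF assms] by blast
  then have \<tau>: "J_part n I J \<omega> = \<tau>" using J_part_eq by simp
  show "J_part n I J \<omega> \<in> W n J" using \<tau> * by simp
  show "J_part n I J (s i \<circ> \<omega>) = J_part n I J \<omega>" if "i \<in> I"
    using J_part_eq[OF W_s_comp[OF adm_subset(1) that *(1)] *(2)] \<tau> * by (simp add: comp_assoc)
  show "J_part n I J (s j \<circ> \<omega>) = s j \<circ> J_part n I J \<omega>" if "j \<in> J"
  proof -
    have "s j \<circ> \<omega> = \<sigma> \<circ> (s j \<circ> \<tau>)"
      unfolding *(3) comp_assoc[symmetric] s_J_commute_W_I[OF that *(1)] ..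
    then show ?thesis
      using J_part_eq[OF *(1) W_s_comp[OF adm_subset(2) that *(2)]] \<tau> by simp
  qed
  show "ascent (J_part n I J \<omega>) j \<longleftrightarrow> ascent \<omega> j" if "j \<in> J"
  proof -
    have "inv' \<omega> = inv' \<tau> \<circ> inv' \<sigma>"
      unfolding *(3) using W_bij adm_subset * by (intro o_inv_distrib) blast+
    then show ?thesis
      using W_I_fixes_J[OF that W_inv[OF adm_subset(1) *(1)]] \<tau> by (simp add: ascent_def)
  qed
qed

text \<open>Groups W_K into pairs of an element with an ascent at i and its longer neighbour, to
  which T_perm attaches T_i times the operator of the shorter one.\<close>

lemma sum_W_pairs:
  fixes g :: "(nat \<Rightarrow> nat) \<Rightarrow> 'a::comm_monoid_add"
  assumes "K \<subseteq> {1..<n}" "i \<in> K"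
  shows "(\<Sum>\<omega>\<in>W n K. g \<omega>) = (\<Sum>\<omega>\<in>{\<omega>\<in>W n K. ascent \<omega> i}. g \<omega> + g (s i \<circ> \<omega>))"
proof -
  let ?A = "{\<omega>\<in>W n K. ascent \<omega> i}"
  have inj: "inj_on (\<lambda>\<omega>. s i \<circ> \<omega>) ?A" by (rule inj_onI) (metis s_s_comp(2))
  have "W n K = ?A \<union> (\<lambda>\<omega>. s i \<circ> \<omega>) ` ?A"
  proof (intro equalityI subsetI)
    fix \<omega> assume \<omega>: "\<omega> \<in> W n K"
    show "\<omega> \<in> ?A \<union> (\<lambda>\<omega>. s i \<circ> \<omega>) ` ?A"
    proof (cases "ascent \<omega> i")
      case False
      have "s i \<circ> \<omega> \<in> ?A"
        using \<omega> False W_s_comp[OF assms \<omega>] ascent_s_comp[OF W_bij[OF assms(1) \<omega>], of i] by simp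
      moreover have "\<omega> = s i \<circ> (s i \<circ> \<omega>)" by simp
      ultimately show ?thesis by blast
    qed (use \<omega> in auto)
  qed (use W_s_comp[OF assms] in auto)
  moreover have "?A \<inter> (\<lambda>\<omega>. s i \<circ> \<omega>) ` ?A = {}"
    using ascent_s_comp W_bij[OF assms(1)] by blast
  ultimately have "(\<Sum>\<omega>\<in>W n K. g \<omega>) = sum g ?A + sum g ((\<lambda>\<omega>. s i \<circ> \<omega>) ` ?A)"
    using finite_W[OF assms(1)] by (metis (no_types, lifting) finite_Un sum.union_disjoint)
  then show ?thesis by (simp only: sum.reindex[OF inj] sum.distrib comp_def[of g])
qed

text \<open>A pair contributes a multiple of (1 + T_i) g for i in \<open>I\<close>, where both signs
  agree, and of (1 - T_j / t) g for j in \<open>J\<close>, where the J-part grows by one letter. The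
  quadratic relation makes these eigenvectors with eigenvalues t and -1.\<close>

lemma T_O_IJ:
  "i \<in> I \<Longrightarrow> T i (O_IJ n I J f) = scal t (O_IJ n I J f)"
  "j \<in> J \<Longrightarrow> T j (O_IJ n I J f) = - O_IJ n I J f"
proof -
  let ?K = "I \<union> J"
  let ?g = "\<lambda>\<omega>. scal ((- 1 / t) ^ len n (J_part n I J \<omega>)) (T_perm n \<omega> f)"
  have perm: "T_perm n (s i \<circ> \<omega>) f = T i (T_perm n \<omega> f)" if "i \<in> ?K" "\<omega> \<in> W n ?K" "ascent \<omega> i" for i \<omega>
    using that W_permutes[OF adm_subset(3)] adm_subset(3) by (intro T_perm_s_comp) auto
  show "T i (O_IJ n I J f) = scal t (O_IJ n I J f)" if i: "i \<in> I"
  proof -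
    have "T i (?g \<omega> + ?g (s i \<circ> \<omega>)) = scal t (?g \<omega> + ?g (s i \<circ> \<omega>))"
      if \<omega>: "\<omega> \<in> W n ?K" "ascent \<omega> i" for \<omega>
    proof -
      obtain c where c: "?g \<omega> = scal c (T_perm n \<omega> f)" "?g (s i \<circ> \<omega>) = scal c (T i (T_perm n \<omega> f))"
        using \<omega> i by (simp add: perm J_part_s_comp)
      show ?thesis
        unfolding c T_add T_scal T_quadratic
        by (simp add: scal_simps algebra_simps flip: scal_simps(5))
    qed
    then show ?thesis
      unfolding O_IJ_def sum_W_pairs[OF adm_subset(3), of i ?g, OF UnI1[OF i]]
      by (simp add: T_sum scal_sum)
  qed
  show "T j (O_IJ n I J f) = - O_IJ n I J f" if j: "j \<in> J"
  proof -
    have "T j (?g \<omega> + ?g (s j \<circ> \<omega>)) = - (?g \<omega> + ?g (s j \<circ> \<omega>))"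
      if \<omega>: "\<omega> \<in> W n ?K" "ascent \<omega> j" for \<omega>
    proof -
      have "len n (J_part n I J (s j \<circ> \<omega>)) = Suc (len n (J_part n I J \<omega>))"
        using \<omega> j J_part_s_comp[OF \<omega>(1)] adm_subset(2)
          len_ascent(1)[OF W_permutes[OF adm_subset(2) J_part_s_comp(3)[OF \<omega>(1)]], of j] by auto
      then obtain c where c: "?g \<omega> = scal c (T_perm n \<omega> f)"
        "?g (s j \<circ> \<omega>) = scal (c * (- 1 / t)) (T j (T_perm n \<omega> f))"
        using \<omega> j by (simp add: perm mult.commute)
      have t: "c * (- 1 / t) * (t - 1) = - c - c * (- 1 / t)" "c * (- 1 / t) * t = - c"
        by (simp_all add: field_simps)
      have "T j (?g \<omega> + ?g (s j \<circ> \<omega>)) = scal c (T j (T_perm n \<omega> f))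
          + scal (c * (- 1 / t) * (t - 1)) (T j (T_perm n \<omega> f)) + scal (c * (- 1 / t) * t) (T_perm n \<omega> f)"
        unfolding c T_add T_scal T_quadratic
        by (simp only: scal_simps(1) scal_simps(5) add.assoc)
      also have "\<dots> = - (?g \<omega> + ?g (s j \<circ> \<omega>))"
        unfolding c t by (simp only: scal_simps(4,10)) simp
      finally show ?thesis .
    qed
    then show ?thesis
      unfolding O_IJ_def sum_W_pairs[OF adm_subset(3), of j ?g, OF UnI2[OF j]]
      by (simp add: T_sum flip: sum_negf)
  qed
qed

end

subsection \<open>Compositions\<close>

lemma lookup_expo: "lookup (expo \<eta>) k = int (lookup \<eta> k)"
  by (simp add: expo_def map.rep_eq when_def)

lemma expo_inj: "expo \<mu> = expo \<eta> \<longleftrightarrow> \<mu> = \<eta>"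
  by (metis lookup_expo of_nat_eq_iff poly_mapping_eqI)

lemma swap_expo_expo: "swap_expo i (expo \<eta>) = expo (swap_expo i \<eta>)"
  by (rule poly_mapping_eqI) (simp add: lookup_swap_expo lookup_expo)

lemma composition_lookup: "composition n \<eta> \<longleftrightarrow> (\<forall>k. k \<notin> {1..n} \<longrightarrow> lookup \<eta> k = 0)"
  by (auto simp: composition_def in_keys_iff subset_iff)

lemma composition_swap: "1 \<le> i \<Longrightarrow> i < n \<Longrightarrow> composition n \<eta> \<Longrightarrow> composition n (swap_expo i \<eta>)"
  by (auto simp: composition_lookup lookup_swap_expo transpose_def)

lemma composition_act:
  assumes "\<sigma> permutes {1..n}" "composition n \<eta>"
  shows "composition n (act \<sigma> \<eta>)"
proof -
  have "k \<notin> {1..n} \<Longrightarrow> inv' \<sigma> k \<notin> {1..n}" for k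
    using permutes_in_image[OF permutes_inv[OF assms(1)]] by blast
  then show ?thesis using assms by (simp add: composition_lookup act_apply permutes_bij del: atLeastAtMost_iff)
qed

section \<open>Support of T on polynomials\<close>

definition is_polynomial :: "nat \<Rightarrow> laurent \<Rightarrow> bool" where
  "is_polynomial n f \<longleftrightarrow> keys f \<subseteq> expo ` {\<nu>. composition n \<nu>}"

lemma expo_image_iff:
  "b \<in> expo ` {\<nu>. composition n \<nu>} \<longleftrightarrow> (\<forall>k. 0 \<le> lookup b k) \<and> (\<forall>k. k \<notin> {1..n} \<longrightarrow> lookup b k = 0)"
proof
  assume *: "(\<forall>k. 0 \<le> lookup b k) \<and> (\<forall>k. k \<notin> {1..n} \<longrightarrow> lookup b k = 0)"
  define \<nu> where "\<nu> = Poly_Mapping.map nat b"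
  have "lookup \<nu> k = nat (lookup b k)" for k by (simp add: \<nu>_def map.rep_eq when_def)
  then have "composition n \<nu>" "b = expo \<nu>"
    using * by (auto simp: composition_lookup lookup_expo intro: poly_mapping_eqI)
  then show "b \<in> expo ` {\<nu>. composition n \<nu>}" by blast
qed (auto simp: composition_lookup lookup_expo)

text \<open>The support of T_i z^a lies on the string joining a and its swap. In the proof c is
  whichever of the two has entry i not larger than entry i+1.\<close>

lemma T_single_keys:
  assumes "b \<in> keys (T i (single a 1))"
  shows "\<And>j. j \<noteq> i \<Longrightarrow> j \<noteq> Suc i \<Longrightarrow> lookup b j = lookup a j"
    and "lookup b i + lookup b (Suc i) = lookup a i + lookup a (Suc i)"
    and "min (lookup a i) (lookup a (Suc i)) \<le> lookup b i"
    and "lookup b i \<le> max (lookup a i) (lookup a (Suc i))"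
proof -
  have *: "\<exists>k\<le>nat (lookup c (Suc i) - lookup c i). b = string_expo i c k"
    if c: "lookup c i \<le> lookup c (Suc i)" and b: "b \<in> keys (T i (single c 1)) \<or> b \<in> keys (T i (single (swap_expo i c) 1))" for c
  proof (rule ccontr)
    let ?m = "nat (lookup c (Suc i) - lookup c i)"
    assume "\<not> ?thesis"
    then have neq: "string_expo i c k \<noteq> b" if "k \<le> ?m" for k using that by blast
    have "c = string_expo i c 0" by (simp add: string_expo_def)
    then have "c \<noteq> b" "swap_expo i c \<noteq> b"
      using neq[of 0] neq[of ?m] swap_expo_eq_string_expo[OF c] by auto
    moreover have "(\<Sum>k<?m. lookup (single (string_expo i c (Suc k)) (1::qt)) b) = 0"
      "(\<Sum>k<?m. lookup (single (string_expo i c k) (1::qt)) b) = 0"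
      using neq by (auto intro!: sum.neutral simp: lookup_single when_def)
    ultimately show False
      using b by (simp add: T_single[OF c] in_keys_iff lookup_add lookup_minus lookup_scal lookup_sum lookup_single)
  qed
  have "\<exists>c k. lookup c i \<le> lookup c (Suc i) \<and> k \<le> nat (lookup c (Suc i) - lookup c i)
      \<and> b = string_expo i c k \<and> (a = c \<or> a = swap_expo i c)"
  proof (cases "lookup a i \<le> lookup a (Suc i)")
    case True
    then show ?thesis using *[OF True] assms by blast
  next
    case False
    define c where "c = swap_expo i a"
    have "swap_expo i c = a" by (simp add: c_def swap_swap)
    moreover have "lookup c i \<le> lookup c (Suc i)" using False by (simp add: c_def lookup_swap_expo)
    ultimately show ?thesis using *[of c] assms by metis
  qed
  then obtain c k where c: "lookup c i \<le> lookup c (Suc i)" "k \<le> nat (lookup c (Suc i) - lookup c i)"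
    and b: "b = string_expo i c k" and a: "a = c \<or> a = swap_expo i c" by blast
  from c a show "lookup b i + lookup b (Suc i) = lookup a i + lookup a (Suc i)"
    "min (lookup a i) (lookup a (Suc i)) \<le> lookup b i" "lookup b i \<le> max (lookup a i) (lookup a (Suc i))"
    by (auto simp: b lookup_string_expo lookup_swap_expo)
  from a show "lookup b j = lookup a j" if "j \<noteq> i" "j \<noteq> Suc i" for j
    using that by (auto simp: b lookup_string_expo lookup_swap_expo transpose_def)
qed

text \<open>The swap is the far end of the string. The only contribution there is the last term k =
  m - 1 of the sum that carries the factor t.\<close>

lemma T_single_swap_coeff:
  assumes "lookup a i < lookup a (Suc i)"
  shows "lookup (T i (single a 1)) (swap_expo i a) = t"
proof -
  define m where "m = nat (lookup a (Suc i) - lookup a i)"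
  have m: "m > 0" using assms by (simp add: m_def)
  have sw: "swap_expo i a = string_expo i a m"
    using assms by (simp add: m_def swap_expo_eq_string_expo)
  have inj: "string_expo i a k = string_expo i a m \<longleftrightarrow> k = m" for k
    using lookup_string_expo[of i a _ i] by (metis add_left_cancel of_nat_eq_iff)
  have "a \<noteq> string_expo i a m" using inj[of 0] m by (simp add: string_expo_def)
  moreover have "(\<Sum>k<m. lookup (single (string_expo i a (Suc k)) (1::qt)) (string_expo i a m))
      = (\<Sum>k<m. if k = m - 1 then 1 else 0)"
    by (intro sum.cong) (use m in \<open>auto simp: lookup_single inj when_def\<close>)
  moreover have "(\<Sum>k<m. lookup (single (string_expo i a k) (1::qt)) (string_expo i a m)) = 0"
    by (auto intro!: sum.neutral simp: lookup_single inj)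
  ultimately show ?thesis
    using assms m unfolding sw
    by (subst T_single(1)) (auto simp flip: m_def simp: lookup_add lookup_minus lookup_scal lookup_sum lookup_single)
qed

lemma lookup_T:
  "lookup (T i f) b = (\<Sum>a\<in>keys f. lookup f a * lookup (T i (single a 1)) b)"
  by (subst laurent_as_sum)
    (simp add: T_sum T_scal lookup_sum lookup_scal)

lemma T_is_polynomial:
  assumes "is_polynomial n f" "1 \<le> i" "i < n"
  shows "is_polynomial n (T i f)"
  unfolding is_polynomial_def
proof
  fix b assume "b \<in> keys (T i f)"
  then obtain a where "a \<in> keys f" "b \<in> keys (T i (single a 1))"
    by (metis (no_types, lifting) in_keys_iff lookup_T mult_zero_right sum.neutral)
  moreover from this assms(1) have "(\<forall>k. 0 \<le> lookup a k) \<and> (\<forall>k. k \<notin> {1..n} \<longrightarrow> lookup a k = 0)"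
    unfolding expo_image_iff[symmetric] is_polynomial_def by blast
  moreover have "0 \<le> lookup b k" if "\<forall>k. 0 \<le> lookup a k" for k
    using T_single_keys[OF \<open>b \<in> keys (T i (single a 1))\<close>] that[rule_format, of i] that[rule_format, of "Suc i"]
      that[rule_format, of k] by (cases "k = i"; cases "k = Suc i") auto
  moreover have "k \<noteq> i \<and> k \<noteq> Suc i" if "k \<notin> {1..n}" for k using that assms by auto
  ultimately show "b \<in> expo ` {\<nu>. composition n \<nu>}"
    unfolding expo_image_iff using T_single_keys(1)[of b i a] by simp
qed

lemma is_polynomial_add: "is_polynomial n f \<Longrightarrow> is_polynomial n g \<Longrightarrow> is_polynomial n (f + g)"
  using keys_add[of f g] by (auto simp: is_polynomial_def)

lemma is_polynomial_scal: "is_polynomial n f \<Longrightarrow> is_polynomial n (scal c f)"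
  by (auto simp: is_polynomial_def in_keys_iff lookup_scal subset_iff)

section \<open>Dominance and numerical ranks\<close>

definition partial_sums :: "nat \<Rightarrow> comp \<Rightarrow> nat" where
  "partial_sums n \<eta> = (\<Sum>p=1..n. \<Sum>i=1..p. lookup \<eta> i)"

text \<open>Dominance makes each partial sum weakly larger, and equality of all of them would
  recover all entries. Adding them up turns dominance into a comparison of natural numbers.\<close>

lemma partial_sums_less:
  assumes "dom_less n \<mu> \<eta>" "composition n \<mu>" "composition n \<eta>"
  shows "partial_sums n \<mu> < partial_sums n \<eta>"
proof -
  have le: "(\<Sum>i=1..p. lookup \<mu> i) \<le> (\<Sum>i=1..p. lookup \<eta> i)" if "p \<in> {1..n}" for p
  proof -
    have "0 \<le> (\<Sum>i=1..p. int (lookup \<eta> i) - int (lookup \<mu> i))"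
      using assms that by (auto simp: dom_less_def)
    then show ?thesis by (simp add: sum_subtractf flip: of_nat_sum)
  qed
  have "\<exists>p\<in>{1..n}. (\<Sum>i=1..p. lookup \<mu> i) \<noteq> (\<Sum>i=1..p. lookup \<eta> i)"
  proof (rule ccontr)
    assume "\<not> ?thesis"
    then have eq: "(\<Sum>i=1..p. lookup \<mu> i) = (\<Sum>i=1..p. lookup \<eta> i)" if "p \<le> n" for p
      using that by (cases "p = 0") auto
    have "lookup \<mu> k = lookup \<eta> k" for k
    proof (cases "k \<in> {1..n}")
      case True
      then obtain p where "k = Suc p" "Suc p \<le> n" by (cases k) auto
      then show ?thesis using eq[of p] eq[of "Suc p"] by simp
    qed (use assms(2,3) in \<open>auto simp: composition_lookup\<close>)
    then have "\<mu> = \<eta>" by (rule poly_mapping_eqI)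
    with assms(1) show False by (simp add: dom_less_def)
  qed
  then show ?thesis
    unfolding partial_sums_def using le by (intro sum_strict_mono_ex1) (auto simp: less_le)
qed

text \<open>Only the i-th partial sum is affected by exchanging entries i and i+1.\<close>

lemma partial_sums_swap:
  assumes "1 \<le> i" "i < n" "lookup \<eta> i < lookup \<eta> (Suc i)"
  shows "partial_sums n \<eta> < partial_sums n (swap_expo i \<eta>)"
proof -
  have low: "(\<Sum>k=1..p. lookup (swap_expo i \<eta>) k) = (\<Sum>k=1..p. lookup \<eta> k)" if "p < i" for p
    using that by (intro sum.cong) (auto simp: lookup_swap_expo)
  obtain j where j: "i = Suc j" using assms(1) by (cases i) auto
  have mid: "(\<Sum>k=1..i. lookup (swap_expo i \<eta>) k) = (\<Sum>k=1..i. lookup \<eta> k) + lookup \<eta> (Suc i) - lookup \<eta> i"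
    using low[of j] by (simp add: j lookup_swap_expo)
  have high: "(\<Sum>k=1..Suc (i + p). lookup (swap_expo i \<eta>) k) = (\<Sum>k=1..Suc (i + p). lookup \<eta> k)" for p
  proof (induction p)
    case 0
    show ?case using low[of j] by (simp add: j lookup_swap_expo)
  next
    case (Suc p)
    then show ?case by (simp add: lookup_swap_expo)
  qed
  have le: "(\<Sum>k=1..p. lookup \<eta> k) \<le> (\<Sum>k=1..p. lookup (swap_expo i \<eta>) k)" for p
  proof -
    consider "p < i" | "p = i" | "p = Suc (i + (p - Suc i))" by linarith
    then show ?thesis using low[of p] mid high[of "p - Suc i"] assms by cases auto
  qed
  show ?thesis
    unfolding partial_sums_def
    by (rule sum_strict_mono_ex1) (use le mid assms in \<open>auto intro!: bexI[of _ i]\<close>)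
qed

text \<open>A rearrangement keeps, for each v, the number of entries at least v. For a decreasing
  vector the places of these entries form an initial segment, so the numbers determine the
  vector.\<close>

lemma decreasing_rearrangement_unique:
  assumes dec: "\<And>i j. \<lbrakk>i \<in> {1..n}; j \<in> {1..n}; i \<le> j\<rbrakk> \<Longrightarrow> lookup \<kappa> j \<le> lookup \<kappa> i"
    and dec': "\<And>i j. \<lbrakk>i \<in> {1..n}; j \<in> {1..n}; i \<le> j\<rbrakk> \<Longrightarrow> lookup \<kappa>' j \<le> lookup \<kappa>' i"
    and \<sigma>: "\<sigma> permutes {1..n}" "\<kappa>' = act \<sigma> \<kappa>"
  shows "\<kappa>' = \<kappa>"
proof (rule poly_mapping_eqI)
  fix k
  have initial: "i \<in> S \<longleftrightarrow> i \<le> card S"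
    if "S \<subseteq> {1..n}" "\<And>i j. j \<in> S \<Longrightarrow> i \<in> {1..j} \<Longrightarrow> i \<in> S" "i \<in> {1..n}" for S and i :: nat
  proof
    assume "i \<in> S"
    then have "{1..i} \<subseteq> S" using that by blast
    then show "i \<le> card S" using card_mono[of S "{1..i}"] finite_subset[OF that(1)] by simp
  next
    assume i: "i \<le> card S"
    show "i \<in> S"
    proof (rule ccontr)
      assume "i \<notin> S"
      then have "S \<subseteq> {1..<i}" using that by (force simp: not_less)
      then have "card S \<le> i - 1" using card_mono[of "{1..<i}" S] by simp
      with i that show False by auto
    qed
  qed
  have lk: "lookup \<kappa>' j = lookup \<kappa> (inv' \<sigma> j)" for j
    using \<sigma> by (simp add: act_apply permutes_bij)
  show "lookup \<kappa>' k = lookup \<kappa> k"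
  proof (cases "k \<in> {1..n}")
    case False
    then show ?thesis using permutes_not_in[OF permutes_inv[OF \<sigma>(1)]] by (simp add: lk)
  next
    case True
    have "v \<le> lookup \<kappa>' k \<longleftrightarrow> v \<le> lookup \<kappa> k" for v
    proof -
      let ?S = "{j\<in>{1..n}. v \<le> lookup \<kappa> j}" and ?S' = "{j\<in>{1..n}. v \<le> lookup \<kappa>' j}"
      have "bij_betw (inv' \<sigma>) ?S' ?S"
        using permutes_inj[OF permutes_inv[OF \<sigma>(1)]] permutes_in_image[OF \<sigma>(1)]
          permutes_in_image[OF permutes_inv[OF \<sigma>(1)]]
        by (intro bij_betwI[where g = \<sigma>])
          (auto simp: lk permutes_inverses[OF \<sigma>(1)] simp del: atLeastAtMost_iff)
      then have "card ?S' = card ?S" by (rule bij_betw_same_card)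
      moreover have "k \<in> ?S \<longleftrightarrow> k \<le> card ?S"
      proof (rule initial)
        show "i \<in> ?S" if "j \<in> ?S" "i \<in> {1..j}" for i j
          using dec[of i j] that by auto
      qed (use True in auto)
      moreover have "k \<in> ?S' \<longleftrightarrow> k \<le> card ?S'"
      proof (rule initial)
        show "i \<in> ?S'" if "j \<in> ?S'" "i \<in> {1..j}" for i j
          using dec'[of i j] that by auto
      qed (use True in auto)
      ultimately show ?thesis using True by simp
    qed
    then show ?thesis by (meson order_antisym order_refl)
  qed
qed

text \<open>The decreasing rearrangement is found as one of largest \<open>partial_sums\<close>: an
  increasing pair of neighbours could be exchanged to enlarge it.\<close>

lemma part_of_props:
  assumes "n \<ge> 1"
  shows "\<forall>i\<in>{1..n}. \<forall>j\<in>{1..n}. i \<le> j \<longrightarrow> lookup (part_of n \<eta>) j \<le> lookup (part_of n \<eta>) i"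
    and "\<exists>\<sigma>. \<sigma> permutes {1..n} \<and> part_of n \<eta> = act \<sigma> \<eta>"
proof -
  let ?P = "\<lambda>\<kappa>. (\<forall>i\<in>{1..n}. \<forall>j\<in>{1..n}. i \<le> j \<longrightarrow> lookup \<kappa> j \<le> lookup \<kappa> i) \<and>
     (\<exists>\<sigma>. \<sigma> permutes {1..n} \<and> \<kappa> = act \<sigma> \<eta>)"
  let ?O = "(\<lambda>\<sigma>. act \<sigma> \<eta>) ` {\<sigma>. \<sigma> permutes {1..n}}"
  have fin: "finite (partial_sums n ` ?O)" by (simp add: finite_permutations)
  have "partial_sums n ` ?O \<noteq> {}" using permutes_id[of "{1..n}"] by blast
  from Max_in[OF fin this] obtain \<kappa> where \<kappa>: "\<kappa> \<in> ?O" "Max (partial_sums n ` ?O) = partial_sums n \<kappa>"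
    by blast
  then have max: "partial_sums n \<nu> \<le> partial_sums n \<kappa>" if "\<nu> \<in> ?O" for \<nu>
    using Max_ge[OF fin, of "partial_sums n \<nu>"] that by simp
  from \<kappa> obtain \<sigma> where \<sigma>: "\<sigma> permutes {1..n}" "\<kappa> = act \<sigma> \<eta>" by auto
  have step: "lookup \<kappa> (Suc i) \<le> lookup \<kappa> i" if "1 \<le> i" "i < n" for i
  proof (rule ccontr)
    assume "\<not> ?thesis"
    then have "partial_sums n \<kappa> < partial_sums n (swap_expo i \<kappa>)"
      using partial_sums_swap that by simp
    moreover have "swap_expo i \<kappa> = act (s i \<circ> \<sigma>) \<eta>"
      using \<sigma> by (simp add: act_comp permutes_bij act_s)
    moreover have "s i \<circ> \<sigma> permutes {1..n}" using that \<sigma> s_permutes[of i n] by (intro permutes_compose) auto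
    ultimately show False using max[of "swap_expo i \<kappa>"] by (metis imageI mem_Collect_eq not_le)
  qed
  have "lookup \<kappa> (i + k) \<le> lookup \<kappa> i" if "1 \<le> i" "i + k \<le> n" for i k
    using that
  proof (induction k)
    case (Suc k)
    then show ?case using step[of "i + k"] by simp
  qed simp
  then have dec: "\<forall>i\<in>{1..n}. \<forall>j\<in>{1..n}. i \<le> j \<longrightarrow> lookup \<kappa> j \<le> lookup \<kappa> i"
    by (metis atLeastAtMost_iff le_Suc_ex)
  have "?P (THE \<kappa>. ?P \<kappa>)"
  proof (rule theI[where a = \<kappa>])
    show "?P \<kappa>" using dec \<sigma> by blast
    fix \<kappa>' assume "?P \<kappa>'"
    then obtain \<sigma>' where \<sigma>': "\<sigma>' permutes {1..n}" "\<kappa>' = act \<sigma>' \<eta>"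
      and dec': "\<forall>i\<in>{1..n}. \<forall>j\<in>{1..n}. i \<le> j \<longrightarrow> lookup \<kappa>' j \<le> lookup \<kappa>' i" by blast
    have bij: "bij \<sigma>" "bij \<sigma>'" using \<sigma> \<sigma>' by (auto simp: permutes_bij)
    have "act (\<sigma>' \<circ> inv' \<sigma>) \<kappa> = act (\<sigma>' \<circ> inv' \<sigma> \<circ> \<sigma>) \<eta>"
      unfolding \<sigma>(2) by (intro act_comp[symmetric] bij_comp bij_imp_bij_inv bij)
    also have "\<dots> = \<kappa>'" using bij by (simp add: comp_assoc bij_is_inj \<sigma>')
    finally have eq: "\<kappa>' = act (\<sigma>' \<circ> inv' \<sigma>) \<kappa>" ..
    have perm: "\<sigma>' \<circ> inv' \<sigma> permutes {1..n}"
      by (intro permutes_compose permutes_inv \<sigma> \<sigma>')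
    show "\<kappa>' = \<kappa>"
      by (rule decreasing_rearrangement_unique[OF _ _ perm eq]) (use dec dec' in blast)+
  qed
  then show "\<forall>i\<in>{1..n}. \<forall>j\<in>{1..n}. i \<le> j \<longrightarrow> lookup (part_of n \<eta>) j \<le> lookup (part_of n \<eta>) i"
    "\<exists>\<sigma>. \<sigma> permutes {1..n} \<and> part_of n \<eta> = act \<sigma> \<eta>"
    unfolding part_of_def by blast+
qed

lemma part_of_act:
  assumes "\<sigma> permutes {1..n}"
  shows "part_of n (act \<sigma> \<eta>) = part_of n \<eta>"
proof -
  have "(\<exists>\<tau>. \<tau> permutes {1..n} \<and> \<kappa> = act \<tau> (act \<sigma> \<eta>)) \<longleftrightarrow> (\<exists>\<tau>. \<tau> permutes {1..n} \<and> \<kappa> = act \<tau> \<eta>)" for \<kappa>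
  proof
    assume "\<exists>\<tau>. \<tau> permutes {1..n} \<and> \<kappa> = act \<tau> (act \<sigma> \<eta>)"
    then obtain \<tau> where "\<tau> permutes {1..n}" "\<kappa> = act \<tau> (act \<sigma> \<eta>)" by blast
    then show "\<exists>\<tau>. \<tau> permutes {1..n} \<and> \<kappa> = act \<tau> \<eta>"
      using assms by (intro exI[of _ "\<tau> \<circ> \<sigma>"]) (simp add: permutes_compose act_comp permutes_bij)
  next
    assume "\<exists>\<tau>. \<tau> permutes {1..n} \<and> \<kappa> = act \<tau> \<eta>"
    then obtain \<tau> where \<tau>: "\<tau> permutes {1..n}" "\<kappa> = act \<tau> \<eta>" by blast
    let ?\<rho> = "\<tau> \<circ> inv' \<sigma>"
    have bij: "bij \<sigma>" "bij \<tau>" using assms \<tau> by (auto simp: permutes_bij)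
    have "act ?\<rho> (act \<sigma> \<eta>) = act (?\<rho> \<circ> \<sigma>) \<eta>"
      by (intro act_comp[symmetric] bij_comp bij_imp_bij_inv bij)
    also have "?\<rho> \<circ> \<sigma> = \<tau>" using bij by (simp add: comp_assoc bij_is_inj)
    finally have "\<kappa> = act ?\<rho> (act \<sigma> \<eta>)" by (simp only: \<tau>(2))
    moreover have "?\<rho> permutes {1..n}" by (intro permutes_compose permutes_inv \<tau> assms)
    ultimately show "\<exists>\<tau>. \<tau> permutes {1..n} \<and> \<kappa> = act \<tau> (act \<sigma> \<eta>)" by blast
  qed
  then show ?thesis by (simp add: part_of_def)
qed

text \<open>A lexicographic pair as one number. The second component is at most n times the modulus,
  so the successor of that bound is a valid base; elements compared by \<open>prec\<close> share the
  modulus and hence the base.\<close>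

definition prec_rank :: "nat \<Rightarrow> comp \<Rightarrow> nat" where
  "prec_rank n \<eta> = partial_sums n (part_of n \<eta>) * Suc (n * modulus n \<eta>) + partial_sums n \<eta>"

lemma partial_sums_le: "partial_sums n \<eta> \<le> n * modulus n \<eta>"
proof -
  have "(\<Sum>i=1..p. lookup \<eta> i) \<le> modulus n \<eta>" if "p \<in> {1..n}" for p
    unfolding modulus_def using that by (intro sum_mono2) auto
  then have "partial_sums n \<eta> \<le> of_nat (card {1..n}) * modulus n \<eta>"
    unfolding partial_sums_def by (rule sum_bounded_above)
  then show ?thesis by simp
qed

lemma prec_rank_less:
  assumes "n \<ge> 1" "prec n \<mu> \<eta>" "composition n \<mu>" "composition n \<eta>"
  shows "prec_rank n \<mu> < prec_rank n \<eta>"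
proof -
  have part: "composition n (part_of n \<nu>)" if "composition n \<nu>" for \<nu>
    using part_of_props(2)[OF assms(1), of \<nu>] composition_act[OF _ that] by auto
  have m: "modulus n \<mu> = modulus n \<eta>" using assms by (simp add: prec_def)
  let ?B = "Suc (n * modulus n \<eta>)"
  consider "partial_sums n (part_of n \<mu>) < partial_sums n (part_of n \<eta>)"
    | "part_of n \<mu> = part_of n \<eta>" "partial_sums n \<mu> < partial_sums n \<eta>"
    using assms partial_sums_less part by (auto simp: prec_def)
  then show ?thesis
  proof cases
    case 1
    have "prec_rank n \<mu> < partial_sums n (part_of n \<mu>) * ?B + ?B"
      using partial_sums_le[of n \<mu>] m by (simp add: prec_rank_def)
    also have "\<dots> = Suc (partial_sums n (part_of n \<mu>)) * ?B" by simp
    also have "\<dots> \<le> partial_sums n (part_of n \<eta>) * ?B" using 1 by (intro mult_le_mono1) simp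
    also have "\<dots> \<le> prec_rank n \<eta>" by (simp add: prec_rank_def)
    finally show ?thesis .
  qed (simp add: prec_rank_def m)
qed

text \<open>Summation by parts: with decreasing weights the weighted sum up to m stays at least w m
  times the plain sum.\<close>

lemma abel_sum_nonneg:
  fixes x w :: "nat \<Rightarrow> int"
  assumes "n \<ge> 1" "\<And>p. p \<in> {1..n} \<Longrightarrow> 0 \<le> (\<Sum>i=1..p. x i)"
    and "\<And>i. i \<in> {1..<n} \<Longrightarrow> w (Suc i) \<le> w i" "0 \<le> w n"
  shows "0 \<le> (\<Sum>i=1..n. x i * w i)"
proof -
  have "w m * (\<Sum>i=1..m. x i) \<le> (\<Sum>i=1..m. x i * w i)" if "1 \<le> m" "m \<le> n" for m
    using that
  proof (induction m rule: nat_induct_at_least)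
    case (Suc m)
    have "w (Suc m) * (\<Sum>i=1..m. x i) \<le> w m * (\<Sum>i=1..m. x i)"
      using Suc.prems Suc.hyps assms by (intro mult_right_mono) auto
    with Suc show ?case by (simp add: algebra_simps)
  qed (simp add: mult.commute)
  from this[of n] have "w n * (\<Sum>i=1..n. x i) \<le> (\<Sum>i=1..n. x i * w i)" using assms(1) by simp
  moreover have "0 \<le> w n * (\<Sum>i=1..n. x i)" using assms by simp
  ultimately show ?thesis by linarith
qed

definition sum_squares :: "nat \<Rightarrow> comp \<Rightarrow> int" where
  "sum_squares n \<eta> = (\<Sum>i=1..n. (int (lookup \<eta> i))\<^sup>2)"

lemma sum_squares_act:
  assumes "\<sigma> permutes {1..n}"
  shows "sum_squares n (act \<sigma> \<eta>) = sum_squares n \<eta>"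
  using sum.permute[OF permutes_inv[OF assms], of "\<lambda>i. (int (lookup \<eta> i))\<^sup>2"] assms
  by (simp add: sum_squares_def act_apply permutes_bij comp_def)

text \<open>On decreasing rearrangements, b^2 - a^2 = (b - a)(b + a) has weights b + a that
  decrease, so Abel summation turns dominance of the partial sums into an inequality of
  squares.\<close>

lemma prec_sum_squares:
  assumes "n \<ge> 1" "prec n \<mu> \<eta>"
  shows "sum_squares n \<mu> \<le> sum_squares n \<eta>"
proof -
  have part: "sum_squares n (part_of n \<nu>) = sum_squares n \<nu>" for \<nu>
    using part_of_props(2)[OF assms(1), of \<nu>] sum_squares_act by metis
  show ?thesis
  proof (cases "part_of n \<mu> = part_of n \<eta>")
    case True
    then show ?thesis using part by (metis order_refl)
  next
    case False
    define a b where "a i = int (lookup (part_of n \<mu>) i)" and "b i = int (lookup (part_of n \<eta>) i)" for i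
    have "0 \<le> (\<Sum>i=1..n. (b i - a i) * (a i + b i))"
    proof (rule abel_sum_nonneg[OF assms(1)])
      show "0 \<le> (\<Sum>i=1..p. b i - a i)" if "p \<in> {1..n}" for p
        using False assms that by (auto simp: prec_def dom_less_def a_def b_def)
      show "a (Suc i) + b (Suc i) \<le> a i + b i" if "i \<in> {1..<n}" for i
      proof -
        have "lookup (part_of n \<nu>) (Suc i) \<le> lookup (part_of n \<nu>) i" for \<nu>
          using part_of_props(1)[OF assms(1), of \<nu>] that by auto
        then show ?thesis by (simp add: a_def b_def add_mono)
      qed
    qed (simp add: a_def b_def)
    then have "sum_squares n (part_of n \<mu>) \<le> sum_squares n (part_of n \<eta>)"
      by (simp add: sum_squares_def a_def b_def algebra_simps power2_eq_square sum_subtractf)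
    then show ?thesis by (simp add: part)
  qed
qed

subsection \<open>Nonsymmetric Macdonald polynomials\<close>

text \<open>Among the indices with nonzero coefficient take one of largest rank: no other member of
  the family reaches its leading exponent. The exponent map e is left general to cover both the
  polynomials and their inverted forms.\<close>

lemma triangular_independent:
  fixes rank :: "'a \<Rightarrow> nat"
  assumes fin: "finite A" and zero: "(\<Sum>\<mu>\<in>A. scal (x \<mu>) (F \<mu>)) = 0"
    and one: "\<And>\<mu>. \<mu> \<in> A \<Longrightarrow> lookup (F \<mu>) (e \<mu>) = 1"
    and tri: "\<And>\<mu> \<kappa>. \<lbrakk>\<mu> \<in> A; \<kappa> \<in> A; lookup (F \<mu>) (e \<kappa>) \<noteq> 0; \<kappa> \<noteq> \<mu>\<rbrakk> \<Longrightarrow> rank \<kappa> < rank \<mu>"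
    and "\<mu> \<in> A"
  shows "x \<mu> = 0"
proof (rule ccontr)
  assume "x \<mu> \<noteq> 0"
  let ?M = "{\<mu>\<in>A. x \<mu> \<noteq> 0}"
  have M: "finite (rank ` ?M)" "rank ` ?M \<noteq> {}" using fin \<open>x \<mu> \<noteq> 0\<close> \<open>\<mu> \<in> A\<close> by auto
  from Max_in[OF M] obtain \<nu> where \<nu>: "\<nu> \<in> A" "x \<nu> \<noteq> 0" "Max (rank ` ?M) = rank \<nu>" by auto
  have "x \<kappa> * lookup (F \<kappa>) (e \<nu>) = 0" if "\<kappa> \<in> A - {\<nu>}" for \<kappa>
  proof (rule ccontr)
    assume *: "x \<kappa> * lookup (F \<kappa>) (e \<nu>) \<noteq> 0"
    then have "rank \<nu> < rank \<kappa>" using tri[of \<kappa> \<nu>] that \<nu>(1) by auto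
    moreover have "rank \<kappa> \<le> rank \<nu>" using Max_ge[OF M(1), of "rank \<kappa>"] that * \<nu>(3) by auto
    ultimately show False by simp
  qed
  then have "(\<Sum>\<kappa>\<in>A - {\<nu>}. x \<kappa> * lookup (F \<kappa>) (e \<nu>)) = 0" by (rule sum.neutral[OF ballI])
  moreover have "(\<Sum>\<kappa>\<in>A. x \<kappa> * lookup (F \<kappa>) (e \<nu>)) = 0"
    using arg_cong[OF zero, of "\<lambda>f. lookup f (e \<nu>)"] by (simp add: lookup_sum lookup_scal)
  ultimately have "x \<nu> * lookup (F \<nu>) (e \<nu>) = 0"
    using fin \<nu>(1) by (simp add: sum.remove[of A \<nu>])
  with one[OF \<nu>(1)] \<nu>(2) show False by simp
qed

text \<open>The places preceding k when the entries are sorted decreasingly with ties kept in order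
  from left to right. In this form it is clear that exchanging two different neighbours carries the
  set along.\<close>

definition colength_set :: "nat \<Rightarrow> comp \<Rightarrow> nat \<Rightarrow> nat set" where
  "colength_set n \<eta> k = {j\<in>{1..n}. lookup \<eta> k < lookup \<eta> j \<or> lookup \<eta> j = lookup \<eta> k \<and> j < k}"

lemma leg_colength_eq_card: "leg_colength n \<eta> k = card (colength_set n \<eta> k)"
proof -
  have "leg_colength n \<eta> k = card ({j\<in>{1..n}. j < k \<and> lookup \<eta> j \<ge> lookup \<eta> k} \<union>
      {j\<in>{1..n}. j > k \<and> lookup \<eta> j > lookup \<eta> k})"
    unfolding leg_colength_def by (rule card_Un_disjoint[symmetric]) auto
  also have "{j\<in>{1..n}. j < k \<and> lookup \<eta> j \<ge> lookup \<eta> k} \<union>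
      {j\<in>{1..n}. j > k \<and> lookup \<eta> j > lookup \<eta> k} = colength_set n \<eta> k"
    unfolding colength_set_def using nat_neq_iff[of _ k] by fastforce
  finally show ?thesis .
qed

lemma leg_colength_swap:
  assumes i: "1 \<le> i" "i < n" and ne: "lookup \<eta> i \<noteq> lookup \<eta> (Suc i)" and k: "k \<in> {1..n}"
  shows "leg_colength n (swap_expo i \<eta>) (s i k) = leg_colength n \<eta> k"
proof -
  let ?L = "colength_set n"
  have range: "s i j \<in> {1..n} \<longleftrightarrow> j \<in> {1..n}" for j using i by (auto simp: transpose_def)
  have "j \<in> ?L (swap_expo i \<eta>) (s i k) \<longleftrightarrow> s i j \<in> ?L \<eta> k" for j
  proof -
    have "s i j < k \<longleftrightarrow> j < s i k" if "lookup \<eta> (s i j) = lookup \<eta> k"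
      using that ne by (auto simp: transpose_def split: if_splits)
    then show ?thesis by (auto simp: colength_set_def lookup_swap_expo range simp del: atLeastAtMost_iff One_nat_def)
  qed
  then have "bij_betw (s i) (?L (swap_expo i \<eta>) (s i k)) (?L \<eta> k)"
    by (intro bij_betwI[where g = "s i"]) auto
  then show ?thesis by (simp add: leg_colength_eq_card bij_betw_same_card)
qed

lemma eigenval_swap:
  assumes "1 \<le> i" "i < n" "lookup \<eta> i \<noteq> lookup \<eta> (Suc i)" "k \<in> {1..n}"
  shows "eigenval n (swap_expo i \<eta>) k = eigenval n \<eta> (s i k)"
proof -
  have "s i k \<in> {1..n}" using assms by (auto simp: transpose_def)
  from leg_colength_swap[OF assms(1-3) this] show ?thesis
    by (simp add: eigenval_def lookup_swap_expo)
qed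

lemma leg_colength_equal:
  assumes i: "1 \<le> i" "i < n" and eq: "lookup \<eta> i = lookup \<eta> (Suc i)"
  shows "leg_colength n \<eta> (Suc i) = Suc (leg_colength n \<eta> i)"
proof -
  have "{j\<in>{1..n}. j < Suc i \<and> lookup \<eta> j \<ge> lookup \<eta> (Suc i)}
      = insert i {j\<in>{1..n}. j < i \<and> lookup \<eta> j \<ge> lookup \<eta> i}"
    using i eq by (auto simp: less_Suc_eq)
  moreover have "{j\<in>{1..n}. j > Suc i \<and> lookup \<eta> j > lookup \<eta> (Suc i)}
      = {j\<in>{1..n}. j > i \<and> lookup \<eta> j > lookup \<eta> i}"
  proof -
    have "Suc i < j \<longleftrightarrow> i < j" if "lookup \<eta> i < lookup \<eta> j" for j
      using that eq by (cases "j = Suc i") auto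
    then show ?thesis using eq by auto
  qed
  ultimately show ?thesis by (simp add: leg_colength_def)
qed

lemma eigenval_eq_iff:
  "eigenval n \<eta> i = eigenval n \<mu> j
    \<longleftrightarrow> lookup \<eta> i = lookup \<mu> j \<and> leg_colength n \<eta> i = leg_colength n \<mu> j"
  by (simp add: eigenval_def q_t_powi_eq_iff)

lemma eigenval_nonzero: "eigenval n \<eta> i \<noteq> 0"
  by (simp add: eigenval_def)

lemma eigenval_equal:
  assumes "1 \<le> i" "i < n" "lookup \<eta> i = lookup \<eta> (Suc i)"
  shows "eigenval n \<eta> i = t * eigenval n \<eta> (Suc i)"
  using power_int_add_1'[of t "- int (leg_colength n \<eta> (Suc i))"]
  by (simp add: eigenval_def leg_colength_equal[OF assms] assms(3))

text \<open>For equal entries the colengths still differ by one. Hence the constant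
  \<open>kappa\<close> never has a zero denominator.\<close>

lemma eigenval_neq_Suc:
  assumes "1 \<le> i" "i < n"
  shows "eigenval n \<eta> i \<noteq> eigenval n \<eta> (Suc i)"
  using leg_colength_equal[OF assms, of \<eta>] by (auto simp: eigenval_eq_iff)

definition kappa :: "nat \<Rightarrow> comp \<Rightarrow> nat \<Rightarrow> qt" where
  "kappa n \<eta> i = (t - 1) * eigenval n \<eta> i / (eigenval n \<eta> (Suc i) - eigenval n \<eta> i)"

section \<open>The nonsymmetric polynomials as a basis of joint eigenvectors\<close>

context
  fixes n :: nat and E :: "comp \<Rightarrow> laurent"
  assumes n: "n \<ge> 1" and E: "\<forall>\<eta>. composition n \<eta> \<longrightarrow> is_nonsym_macdonald n \<eta> (E \<eta>)"
begin

lemma E_lookup_self: "composition n \<eta> \<Longrightarrow> lookup (E \<eta>) (expo \<eta>) = 1"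
  using E by (simp add: is_nonsym_macdonald_def)

lemma E_keys:
  assumes "composition n \<eta>" "b \<in> keys (E \<eta>)" "b \<noteq> expo \<eta>"
  shows "\<exists>\<nu>. composition n \<nu> \<and> prec n \<nu> \<eta> \<and> b = expo \<nu>"
  using E assms by (auto simp: is_nonsym_macdonald_def)

lemma E_lookup_nonzero:
  assumes "composition n \<mu>" "lookup (E \<mu>) (expo \<kappa>) \<noteq> 0" "\<kappa> \<noteq> \<mu>"
  shows "prec n \<kappa> \<mu>"
  using E_keys[OF assms(1), of "expo \<kappa>"] assms(2,3) by (auto simp: in_keys_iff expo_inj)

lemma E_Y: "composition n \<eta> \<Longrightarrow> k \<in> {1..n} \<Longrightarrow> Y n k (E \<eta>) = scal (eigenval n \<eta> k) (E \<eta>)"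
  using E by (simp add: is_nonsym_macdonald_def)

lemma E_is_polynomial: "composition n \<eta> \<Longrightarrow> is_polynomial n (E \<eta>)"
  using E_keys[of \<eta>] by (auto simp: is_polynomial_def)

lemma E_independent:
  assumes "finite A" "A \<subseteq> Collect (composition n)" "(\<Sum>\<mu>\<in>A. scal (x \<mu>) (E \<mu>)) = 0" "\<mu> \<in> A"
  shows "x \<mu> = 0"
proof (rule triangular_independent[OF assms(1,3), where e = expo and rank = "prec_rank n"])
  show "prec_rank n \<kappa> < prec_rank n \<nu>"
    if "\<nu> \<in> A" "\<kappa> \<in> A" "lookup (E \<nu>) (expo \<kappa>) \<noteq> 0" "\<kappa> \<noteq> \<nu>" for \<nu> \<kappa>
    using that assms(2) prec_rank_less[OF n E_lookup_nonzero[of \<nu> \<kappa>]] by auto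
qed (use assms E_lookup_self in auto)

definition in_E_span :: "laurent \<Rightarrow> bool" where
  "in_E_span f \<longleftrightarrow> (\<exists>A x. finite A \<and> A \<subseteq> Collect (composition n) \<and> f = (\<Sum>\<mu>\<in>A. scal (x \<mu>) (E \<mu>)))"

lemma in_E_span_E: "composition n \<eta> \<Longrightarrow> in_E_span (E \<eta>)"
  unfolding in_E_span_def by (intro exI[of _ "{\<eta>}"] exI[of _ "\<lambda>_. 1"]) (simp add: scal_simps)

lemma in_E_span_0: "in_E_span 0"
  unfolding in_E_span_def by force

lemma in_E_span_scal:
  assumes "in_E_span f"
  shows "in_E_span (scal c f)"
proof -
  obtain A x where A: "finite A" "A \<subseteq> Collect (composition n)" and f: "f = (\<Sum>\<mu>\<in>A. scal (x \<mu>) (E \<mu>))"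
    using assms unfolding in_E_span_def by blast
  have "scal c f = (\<Sum>\<mu>\<in>A. scal (c * x \<mu>) (E \<mu>))"
    by (simp add: f scal_sum scal_simps(5))
  with A show ?thesis
    unfolding in_E_span_def by (intro exI[of _ A] exI[of _ "\<lambda>\<mu>. c * x \<mu>"]) simp
qed

lemma in_E_span_add:
  assumes "in_E_span f" "in_E_span g"
  shows "in_E_span (f + g)"
proof -
  obtain A x B y where *: "finite A" "A \<subseteq> Collect (composition n)" "f = (\<Sum>\<mu>\<in>A. scal (x \<mu>) (E \<mu>))"
    "finite B" "B \<subseteq> Collect (composition n)" "g = (\<Sum>\<mu>\<in>B. scal (y \<mu>) (E \<mu>))"
    using assms unfolding in_E_span_def by blast
  have ext: "(\<Sum>\<mu>\<in>C. scal (z \<mu>) (E \<mu>)) = (\<Sum>\<mu>\<in>A \<union> B. scal (if \<mu> \<in> C then z \<mu> else 0) (E \<mu>))"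
    if "C \<subseteq> A \<union> B" for C z
    by (rule sum.mono_neutral_cong_left) (use * that in \<open>auto simp: scal_simps\<close>)
  have "f + g = (\<Sum>\<mu>\<in>A \<union> B. scal ((if \<mu> \<in> A then x \<mu> else 0) + (if \<mu> \<in> B then y \<mu> else 0)) (E \<mu>))"
    using ext[of A x] ext[of B y] * by (simp add: scal_simps(3) sum.distrib)
  with * show ?thesis
    unfolding in_E_span_def
    by (intro exI[of _ "A \<union> B"] exI[of _ "\<lambda>\<mu>. (if \<mu> \<in> A then x \<mu> else 0) + (if \<mu> \<in> B then y \<mu> else 0)"]) simp
qed

lemma in_E_span_sum: "(\<And>a. a \<in> A \<Longrightarrow> in_E_span (f a)) \<Longrightarrow> in_E_span (sum f A)"
  by (induction A rule: infinite_finite_induct) (auto intro: in_E_span_0 in_E_span_add)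

text \<open>Inverts the triangular expansion: a monomial is its E minus monomials of smaller
  \<open>prec_rank\<close>, which are covered by induction.\<close>

lemma polynomial_in_E_span:
  assumes "is_polynomial n f"
  shows "in_E_span f"
proof -
  have mono: "in_E_span (single (expo \<eta>) 1)" if "composition n \<eta>" for \<eta>
    using that
  proof (induction "prec_rank n \<eta>" arbitrary: \<eta> rule: less_induct)
    case less
    have "expo \<eta> \<in> keys (E \<eta>)" using E_lookup_self[OF less.prems] by (simp add: in_keys_iff)
    then have "E \<eta> = single (expo \<eta>) 1
        + (\<Sum>a\<in>keys (E \<eta>) - {expo \<eta>}. scal (lookup (E \<eta>) a) (single a 1))"
      using laurent_as_sum[of "E \<eta>"] E_lookup_self[OF less.prems]
      by (simp add: sum.remove[of _ "expo \<eta>"] scal_simps)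
    then have "single (expo \<eta>) 1 = E \<eta>
        + scal (- 1) (\<Sum>a\<in>keys (E \<eta>) - {expo \<eta>}. scal (lookup (E \<eta>) a) (single a 1))"
      by (simp add: scal_simps algebra_simps)
    moreover have "in_E_span (single a 1)" if "a \<in> keys (E \<eta>) - {expo \<eta>}" for a
      using E_keys[OF less.prems, of a] that less.hyps prec_rank_less[OF n _ _ less.prems] by auto
    ultimately show ?case
      by (simp only:) (intro in_E_span_add in_E_span_scal in_E_span_sum in_E_span_E less.prems)
  qed
  have "in_E_span (scal (lookup f a) (single a 1))" if "a \<in> keys f" for a
    using that assms mono by (auto simp: is_polynomial_def intro!: in_E_span_scal)
  then show ?thesis by (subst laurent_as_sum) (rule in_E_span_sum)
qed

text \<open>Applying Y_k - l_k to an expansion in the basis multiplies each coefficient by a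
  difference of eigenvalues, so independence kills all terms with a wrong eigenvalue. The set A may
  be empty, which is how vanishing is proved in \<open>T_E_equal\<close>.\<close>

lemma joint_eigenvector_expansion:
  assumes "is_polynomial n f" and ev: "\<And>k. k \<in> {1..n} \<Longrightarrow> Y n k f = scal (l k) f"
  shows "\<exists>A x. finite A \<and> A \<subseteq> {\<mu>. composition n \<mu> \<and> (\<forall>k\<in>{1..n}. eigenval n \<mu> k = l k)} \<and>
    f = (\<Sum>\<mu>\<in>A. scal (x \<mu>) (E \<mu>))"
proof -
  obtain A x where A: "finite A" "A \<subseteq> Collect (composition n)" and f: "f = (\<Sum>\<mu>\<in>A. scal (x \<mu>) (E \<mu>))"
    using polynomial_in_E_span[OF assms(1)] unfolding in_E_span_def by blast
  define B where "B = {\<mu>\<in>A. \<forall>k\<in>{1..n}. eigenval n \<mu> k = l k}"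
  have "x \<mu> = 0" if \<mu>: "\<mu> \<in> A - B" for \<mu>
  proof -
    obtain k where k: "k \<in> {1..n}" "eigenval n \<mu> k \<noteq> l k" using \<mu> by (auto simp: B_def)
    have "Y n k f = (\<Sum>\<mu>\<in>A. scal (x \<mu>) (scal (eigenval n \<mu> k) (E \<mu>)))"
      unfolding f using A k by (auto simp: linear_op_sum[OF linear_op_Y] Y_scal
        intro!: sum.cong E_Y arg_cong[of _ _ "scal _"])
    then have "(\<Sum>\<mu>\<in>A. scal (x \<mu> * (eigenval n \<mu> k - l k)) (E \<mu>)) = Y n k f - scal (l k) f"
      unfolding f by (simp add: scal_sum scal_simps(4) right_diff_distrib sum_subtractf mult.commute flip: scal_simps(5))
    also have "\<dots> = 0" using ev k by simp
    finally have "x \<mu> * (eigenval n \<mu> k - l k) = 0"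
      using E_independent[OF A, of "\<lambda>\<mu>. x \<mu> * (eigenval n \<mu> k - l k)"] \<mu> by blast
    with k show ?thesis by simp
  qed
  then have "f = (\<Sum>\<mu>\<in>B. scal (x \<mu>) (E \<mu>))"
    unfolding f by (intro sum.mono_neutral_right) (use A in \<open>auto simp: B_def scal_simps\<close>)
  moreover have "finite B" "B \<subseteq> {\<mu>. composition n \<mu> \<and> (\<forall>k\<in>{1..n}. eigenval n \<mu> k = l k)}"
    using A by (auto simp: B_def)
  ultimately show ?thesis by (intro exI[of _ B] exI[of _ x] conjI)
qed

lemma composition_determined_by_eigenval:
  assumes "composition n \<mu>" "composition n \<nu>" "\<And>k. k \<in> {1..n} \<Longrightarrow> eigenval n \<mu> k = eigenval n \<nu> k"
  shows "\<mu> = \<nu>"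
proof (rule poly_mapping_eqI)
  fix k show "lookup \<mu> k = lookup \<nu> k"
    using assms by (cases "k \<in> {1..n}") (auto simp: eigenval_eq_iff composition_lookup)
qed

lemma joint_eigenvector_multiple:
  assumes "is_polynomial n f" "composition n \<nu>"
    and "\<And>k. k \<in> {1..n} \<Longrightarrow> Y n k f = scal (eigenval n \<nu> k) f"
  shows "f = scal (lookup f (expo \<nu>)) (E \<nu>)"
proof -
  obtain A x where A: "A \<subseteq> {\<mu>. composition n \<mu> \<and> (\<forall>k\<in>{1..n}. eigenval n \<mu> k = eigenval n \<nu> k)}"
    and f: "f = (\<Sum>\<mu>\<in>A. scal (x \<mu>) (E \<mu>))"
    using joint_eigenvector_expansion[OF assms(1,3)] by blast
  have "A \<subseteq> {\<nu>}" using A composition_determined_by_eigenval[OF _ assms(2)] by blast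
  then have "A = {} \<or> A = {\<nu>}" by blast
  then show ?thesis
    using E_lookup_self[OF assms(2)] by (auto simp: f scal_simps lookup_scal)
qed

section \<open>The action of T on the basis\<close>

context
  fixes i :: nat and \<eta> :: comp
  assumes i: "1 \<le> i" "i < n" and \<eta>: "composition n \<eta>"
begin

lemma intertwiner_eigenvector:
  defines "F \<equiv> T i (E \<eta>) + scal (kappa n \<eta> i) (E \<eta>)"
  shows "is_polynomial n F"
    and "k \<in> {1..n} \<Longrightarrow> Y n k F = scal (eigenval n \<eta> (s i k)) F"
proof -
  show "is_polynomial n F"
    unfolding F_def by (intro is_polynomial_add is_polynomial_scal T_is_polynomial E_is_polynomial \<eta> i)
  note ev = Y_intertwiner[OF i E_Y[OF \<eta>] E_Y[OF \<eta>] eigenval_neq_Suc[OF i], folded kappa_def F_def]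
  assume k: "k \<in> {1..n}"
  consider "k = i" | "k = Suc i" | "k \<noteq> i" "k \<noteq> Suc i" by blast
  then show "Y n k F = scal (eigenval n \<eta> (s i k)) F"
  proof cases
    case 3
    then have "Y n k (T i (E \<eta>)) = scal (eigenval n \<eta> k) (T i (E \<eta>))"
      using k i by (simp add: Y_T_commute E_Y \<eta> T_scal)
    then have "Y n k F = scal (eigenval n \<eta> k) F"
      unfolding F_def using k
      by (simp add: Y_add Y_scal E_Y \<eta> scal_simps(1)
          mult.commute flip: scal_simps(5))
    with 3 show ?thesis by simp
  qed (use ev i in auto)
qed

text \<open>A composition with the exchanged eigenvalues would have the entries of
  \<open>\<eta>\<close> and so be \<open>\<eta>\<close> itself, whose eigenvalues at i and i+1
  differ. The intertwined vector is therefore 0, and the eigenvalue ratio t gives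
  \<open>kappa\<close> the value -t.\<close>

lemma T_E_equal:
  assumes eq: "lookup \<eta> i = lookup \<eta> (Suc i)"
  shows "T i (E \<eta>) = scal t (E \<eta>)"
proof -
  let ?F = "T i (E \<eta>) + scal (kappa n \<eta> i) (E \<eta>)"
  obtain A x where A: "A \<subseteq> {\<mu>. composition n \<mu> \<and> (\<forall>k\<in>{1..n}. eigenval n \<mu> k = eigenval n \<eta> (s i k))}"
    and F: "?F = (\<Sum>\<mu>\<in>A. scal (x \<mu>) (E \<mu>))"
    using joint_eigenvector_expansion[OF intertwiner_eigenvector] by blast
  have "A = {}"
  proof (rule ccontr)
    assume "A \<noteq> {}"
    then obtain \<mu> where \<mu>: "composition n \<mu>" and ev: "\<forall>k\<in>{1..n}. eigenval n \<mu> k = eigenval n \<eta> (s i k)"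
      using A by blast
    have "lookup \<mu> k = lookup \<eta> k" for k
    proof (cases "k \<in> {1..n}")
      case True
      with ev have "lookup \<mu> k = lookup \<eta> (s i k)" by (simp add: eigenval_eq_iff)
      with eq show ?thesis by (auto simp: transpose_def)
    qed (use \<mu> \<eta> in \<open>auto simp: composition_lookup\<close>)
    then have "\<mu> = \<eta>" by (rule poly_mapping_eqI)
    with ev[rule_format, of i] eigenval_neq_Suc[OF i, of \<eta>] i show False by simp
  qed
  then have "?F = 0" using F by simp
  moreover have "kappa n \<eta> i = - t"
  proof -
    let ?y = "eigenval n \<eta> (Suc i)"
    have "kappa n \<eta> i = (t - 1) * (t * ?y) / (?y - t * ?y)"
      by (simp add: kappa_def eigenval_equal[OF i eq])
    also have "?y - t * ?y = (1 - t) * ?y" by (simp add: algebra_simps)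
    also have "(t - 1) * (t * ?y) / ((1 - t) * ?y) = - t"
      using t_neq_1 eigenval_nonzero[of n \<eta> "Suc i"] by (simp add: field_simps)
    finally show ?thesis .
  qed
  ultimately show ?thesis by (simp add: scal_simps)
qed

lemma T_E_swap:
  assumes ne: "lookup \<eta> i \<noteq> lookup \<eta> (Suc i)"
  shows "\<exists>c. T i (E \<eta>) = scal (- kappa n \<eta> i) (E \<eta>) + scal c (E (swap_expo i \<eta>))"
    and "lookup \<eta> i < lookup \<eta> (Suc i) \<Longrightarrow>
      T i (E \<eta>) = scal (- kappa n \<eta> i) (E \<eta>) + scal t (E (swap_expo i \<eta>))"
proof -
  let ?F = "T i (E \<eta>) + scal (kappa n \<eta> i) (E \<eta>)" and ?\<nu> = "swap_expo i \<eta>"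
  have \<nu>: "composition n ?\<nu>" using composition_swap i \<eta> by simp
  have "?F = scal (lookup ?F (expo ?\<nu>)) (E ?\<nu>)"
    by (rule joint_eigenvector_multiple[OF intertwiner_eigenvector(1) \<nu>])
      (simp only: intertwiner_eigenvector(2) eigenval_swap[OF i ne])
  then have T: "T i (E \<eta>) = scal (- kappa n \<eta> i) (E \<eta>) + scal (lookup ?F (expo ?\<nu>)) (E ?\<nu>)"
    by (simp add: scal_simps algebra_simps)
  then show "\<exists>c. T i (E \<eta>) = scal (- kappa n \<eta> i) (E \<eta>) + scal c (E ?\<nu>)" by blast
  assume less: "lookup \<eta> i < lookup \<eta> (Suc i)"
  have ne\<nu>: "?\<nu> \<noteq> \<eta>" using ne by (metis lookup_swap_expo transpose_apply_first)
  have part: "part_of n ?\<nu> = part_of n \<eta>"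
    using part_of_act[OF s_permutes[of i n]] i by (simp add: act_s)
  \<comment> \<open>The decreasing rearrangements agree, so dominance of the compositions themselves
    would be needed; but exchanging an increasing pair raises the partial sums.\<close>
  have not_prec: "\<not> prec n ?\<nu> \<eta>"
  proof
    assume "prec n ?\<nu> \<eta>"
    then have "dom_less n ?\<nu> \<eta>" using part by (auto simp: prec_def dom_less_def)
    with partial_sums_less[OF this \<nu> \<eta>] partial_sums_swap[OF i less] show False by simp
  qed
  have "lookup (E \<eta>) (expo ?\<nu>) = 0" using E_lookup_nonzero[OF \<eta> _ ne\<nu>] not_prec by blast
  moreover have "lookup (T i (E \<eta>)) (expo ?\<nu>) = t"
  proof -
    \<comment> \<open>If another monomial mu of E contributed, it would agree with the swap of
      \<open>\<eta>\<close> off i and i+1 and share the sum of these two entries. The squares then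
      leave only the swap, which does not occur, and \<open>\<eta>\<close>, which is excluded
      here.\<close>
    have "lookup (T i (single a 1)) (expo ?\<nu>) = 0" if a: "a \<in> keys (E \<eta>) - {expo \<eta>}" for a
    proof (rule ccontr)
      obtain \<mu> where \<mu>: "composition n \<mu>" "prec n \<mu> \<eta>" "a = expo \<mu>" using E_keys[OF \<eta>, of a] a by blast
      assume "lookup (T i (single a 1)) (expo ?\<nu>) \<noteq> 0"
      then have "expo ?\<nu> \<in> keys (T i (single (expo \<mu>) 1))" by (simp add: in_keys_iff \<mu>)
      note * = T_single_keys[OF this, unfolded lookup_expo]
      define x y u v where "x = int (lookup ?\<nu> i)" and "y = int (lookup ?\<nu> (Suc i))"
        and "u = int (lookup \<mu> i)" and "v = int (lookup \<mu> (Suc i))"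
      have xy: "x + y = u + v" "min u v \<le> x" "x \<le> max u v"
        using *(2-4) by (simp_all add: x_def y_def u_def v_def)
      have other: "lookup ?\<nu> k = lookup \<mu> k" if "k \<noteq> i" "k \<noteq> Suc i" for k
        using *(1)[OF that] by simp
      have split: "sum_squares n \<kappa> = (\<Sum>k\<in>{1..n} - {i, Suc i}. (int (lookup \<kappa> k))\<^sup>2)
          + ((int (lookup \<kappa> i))\<^sup>2 + (int (lookup \<kappa> (Suc i)))\<^sup>2)" for \<kappa>
        unfolding sum_squares_def by (subst sum.subset_diff[of "{i, Suc i}"]) (use i in auto)
      have "sum_squares n ?\<nu> = sum_squares n \<eta>"
        using sum_squares_act[OF s_permutes[of i n], of \<eta>] i by (simp add: act_s)
      moreover have "(\<Sum>k\<in>{1..n} - {i, Suc i}. (int (lookup ?\<nu> k))\<^sup>2)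
          = (\<Sum>k\<in>{1..n} - {i, Suc i}. (int (lookup \<mu> k))\<^sup>2)"
        by (rule sum.cong) (auto simp: other)
      ultimately have "u\<^sup>2 + v\<^sup>2 \<le> x\<^sup>2 + y\<^sup>2"
        using prec_sum_squares[OF n \<mu>(2)] split[of \<mu>] split[of ?\<nu>]
        by (simp add: x_def y_def u_def v_def)
      \<comment> \<open>The product is at most 0 because x lies between u and v, and at least 0 by
        the comparison of squares; hence x is u or v.\<close>
      moreover have "x\<^sup>2 + y\<^sup>2 = u\<^sup>2 + v\<^sup>2 + 2 * ((x - u) * (x - v))"
      proof -
        have y: "y = u + v - x" using xy(1) by simp
        show ?thesis unfolding y by (simp add: power2_eq_square algebra_simps)
      qed
      ultimately have "0 \<le> (x - u) * (x - v)" by simp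
      with xy have "x = u \<or> x = v" by (auto simp: zero_le_mult_iff min_def max_def split: if_splits)
      then have "x = u \<and> y = v \<or> x = v \<and> y = u" using xy(1) by auto
      then have "\<mu> = ?\<nu> \<or> \<mu> = \<eta>"
      proof
        assume "x = u \<and> y = v"
        then have "lookup \<mu> k = lookup ?\<nu> k" for k
          using other[of k] by (cases "k = i"; cases "k = Suc i") (auto simp: x_def y_def u_def v_def)
        then show ?thesis by (simp add: poly_mapping_eqI)
      next
        assume "x = v \<and> y = u"
        then have "lookup \<mu> i = lookup \<eta> i" "lookup \<mu> (Suc i) = lookup \<eta> (Suc i)"
          by (auto simp: x_def y_def u_def v_def lookup_swap_expo)
        then have "lookup \<mu> k = lookup \<eta> k" for k
          using other[of k] by (cases "k = i"; cases "k = Suc i") (auto simp: lookup_swap_expo)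
        then show ?thesis by (simp add: poly_mapping_eqI)
      qed
      moreover have "\<mu> \<noteq> \<eta>" using \<mu> a by auto
      ultimately show False using not_prec \<mu> by auto
    qed
    moreover have "expo \<eta> \<in> keys (E \<eta>)" using E_lookup_self[OF \<eta>] by (simp add: in_keys_iff)
    moreover have "lookup (T i (single (expo \<eta>) 1)) (expo ?\<nu>) = t"
      using T_single_swap_coeff[of "expo \<eta>" i] less by (simp add: lookup_expo swap_expo_expo)
    ultimately show ?thesis
      by (simp add: lookup_T[of i "E \<eta>"] sum.remove[of _ "expo \<eta>"] E_lookup_self \<eta>)
  qed
  ultimately have "lookup ?F (expo ?\<nu>) = t" by (simp add: lookup_add lookup_scal)
  with T show "T i (E \<eta>) = scal (- kappa n \<eta> i) (E \<eta>) + scal t (E ?\<nu>)" by simp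
qed

end

end

subsection \<open>Leg lengths\<close>

definition leg_set :: "nat \<Rightarrow> comp \<Rightarrow> nat \<times> nat \<Rightarrow> nat set" where
  "leg_set n \<eta> = (\<lambda>(i, j). {k\<in>{1..n}. (k < i \<and> j \<le> lookup \<eta> k + 1 \<and> lookup \<eta> k + 1 \<le> lookup \<eta> i)
    \<or> (k > i \<and> j \<le> lookup \<eta> k \<and> lookup \<eta> k \<le> lookup \<eta> i)})"

lemma leg_eq_card: "leg n \<eta> x = card (leg_set n \<eta> x)"
proof -
  obtain i j where x: "x = (i, j)" by (cases x)
  have "leg n \<eta> x = card ({k\<in>{1..n}. k < i \<and> j \<le> lookup \<eta> k + 1 \<and> lookup \<eta> k + 1 \<le> lookup \<eta> i} \<union>
     {k\<in>{1..n}. k > i \<and> j \<le> lookup \<eta> k \<and> lookup \<eta> k \<le> lookup \<eta> i})"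
    unfolding leg_def x by (simp, rule card_Un_disjoint[symmetric]) auto
  also have "{k\<in>{1..n}. k < i \<and> j \<le> lookup \<eta> k + 1 \<and> lookup \<eta> k + 1 \<le> lookup \<eta> i} \<union>
     {k\<in>{1..n}. k > i \<and> j \<le> lookup \<eta> k \<and> lookup \<eta> k \<le> lookup \<eta> i} = leg_set n \<eta> x"
    by (auto simp: leg_set_def x)
  finally show ?thesis .
qed

lemma finite_diag: "finite (diag n \<eta>)"
proof -
  have "diag n \<eta> = (SIGMA i:{1..n}. {1..lookup \<eta> i})" by (auto simp: diag_def)
  then show ?thesis by simp
qed

text \<open>In every factor the exponent of q is positive, so the monomial differs from 1.\<close>

lemma d_nonzero: "d n \<eta> \<noteq> 0" and d'_nonzero: "d' n \<eta> \<noteq> 0"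
  using q_t_monomial_eq_1_iff by (auto simp: d_def d'_def finite_diag right_minus_eq simp del: power_Suc)

text \<open>The quotient of the i-th by the (i+1)-st eigenvalue when entry i is the larger one, see
  \<open>eigenval_ratio\<close>. Writing it through the leg of one box makes it visible as a factor
  of \<open>d\<close> and \<open>d'\<close>.\<close>

definition eigen_ratio :: "nat \<Rightarrow> nat \<Rightarrow> comp \<Rightarrow> qt" where
  "eigen_ratio n i \<eta>
    = q ^ (lookup \<eta> i - lookup \<eta> (Suc i)) * t ^ Suc (leg n \<eta> (i, Suc (lookup \<eta> (Suc i))))"

context
  fixes n i :: nat and \<eta> :: comp
  assumes i: "1 \<le> i" "i < n" and greater: "lookup \<eta> (Suc i) < lookup \<eta> i"
begin

text \<open>Reflecting the diagram, only the box to the right of the end of the shorter of the two rows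
  changes its leg length.\<close>

private abbreviation corner :: "nat \<times> nat" where "corner \<equiv> (i, Suc (lookup \<eta> (Suc i)))"
private abbreviation reflect :: "nat \<times> nat \<Rightarrow> nat \<times> nat" where "reflect \<equiv> \<lambda>(k, j). (s i k, j)"

lemma leg_swap:
  assumes "x \<in> diag n \<eta>"
  shows "leg n (swap_expo i \<eta>) (reflect x) = (if x = corner then Suc (leg n \<eta> x) else leg n \<eta> x)"
proof -
  obtain k j where x: "x = (k, j)" by (cases x)
  have k: "1 \<le> k" "k \<le> n" "1 \<le> j" "j \<le> lookup \<eta> k" using assms by (auto simp: x diag_def)
  have range: "s i m \<in> {1..n} \<longleftrightarrow> m \<in> {1..n}" for m using i by (auto simp: transpose_def)
  \<comment> \<open>The exchange keeps the relative order of all pairs of rows except rows i and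
    i+1. For a box of row i, row i+1 counts if j is at most its length; after the exchange it stands
    above and counts up to that length plus one. The extra value of j is the corner.\<close>
  have mem: "s i m \<in> leg_set n (swap_expo i \<eta>) (s i k, j) \<longleftrightarrow>
      m \<in> leg_set n \<eta> (k, j) \<or> m = Suc i \<and> x = corner" for m
  proof -
    have "(s i m < s i k \<longleftrightarrow> m < k) \<and> (s i m > s i k \<longleftrightarrow> m > k)"
      if "\<not> (k = i \<and> m = Suc i)" "\<not> (k = Suc i \<and> m = i)"
      using that by (cases "m = i"; cases "m = Suc i"; cases "k = i"; cases "k = Suc i") auto
    then consider "k = i" "m = Suc i" | "k = Suc i" "m = i" | "s i m < s i k \<longleftrightarrow> m < k" "s i m > s i k \<longleftrightarrow> m > k"
        "\<not> (m = Suc i \<and> k = i)"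
      by blast
    then show ?thesis
    proof cases
      case 3
      then show ?thesis
        using range[of m] by (auto simp: leg_set_def lookup_swap_expo x simp del: atLeastAtMost_iff One_nat_def)
    qed (use i k greater in \<open>auto simp: leg_set_def lookup_swap_expo x\<close>)
  qed
  have "leg_set n (swap_expo i \<eta>) (reflect x) = s i ` {m. s i m \<in> leg_set n (swap_expo i \<eta>) (s i k, j)}"
    by (auto simp: x image_iff) (metis s_involutive)
  also have "\<dots> = s i ` (leg_set n \<eta> x \<union> {m. m = Suc i \<and> x = corner})" by (auto simp: mem x)
  finally have "leg n (swap_expo i \<eta>) (reflect x) = card (leg_set n \<eta> x \<union> {m. m = Suc i \<and> x = corner})"
    by (simp add: leg_eq_card card_image)
  moreover have "Suc i \<notin> leg_set n \<eta> corner" by (simp add: leg_set_def)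
  moreover have "finite (leg_set n \<eta> x)" by (auto simp: leg_set_def x)
  ultimately show ?thesis by (auto simp: leg_eq_card)
qed

text \<open>All factors but the one at the corner match under the reflection. Cross multiplying by
  the two corner factors avoids any division.\<close>

lemma prod_diag_swap:
  fixes f :: "nat \<times> nat \<Rightarrow> qt" and g
  assumes "\<And>x. x \<in> diag n \<eta> - {corner} \<Longrightarrow> g (reflect x) = f x"
  shows "(\<Prod>x\<in>diag n (swap_expo i \<eta>). g x) * f corner = (\<Prod>x\<in>diag n \<eta>. f x) * g (reflect corner)"
proof -
  have range: "s i m \<in> {1..n} \<longleftrightarrow> m \<in> {1..n}" for m using i by (auto simp: transpose_def)
  then have mem: "reflect x \<in> diag n (swap_expo i \<eta>) \<longleftrightarrow> x \<in> diag n \<eta>" for x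
    by (cases x) (auto simp: diag_def lookup_swap_expo)
  have refl: "reflect (reflect x) = x" for x by (cases x) simp
  have mem': "reflect x \<in> diag n \<eta> \<longleftrightarrow> x \<in> diag n (swap_expo i \<eta>)" for x
    using mem[of "reflect x"] refl[of x] by simp
  have "bij_betw reflect (diag n \<eta>) (diag n (swap_expo i \<eta>))"
    by (rule bij_betwI[where g = reflect]) (use mem mem' refl in blast)+
  from prod.reindex_bij_betw[OF this, of g]
  have "(\<Prod>x\<in>diag n (swap_expo i \<eta>). g x) = (\<Prod>x\<in>diag n \<eta>. g (reflect x))" by simp
  moreover have "corner \<in> diag n \<eta>" using i greater by (auto simp: diag_def)
  moreover have "(\<Prod>x\<in>diag n \<eta> - {corner}. g (reflect x)) = (\<Prod>x\<in>diag n \<eta> - {corner}. f x)"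
    by (rule prod.cong) (use assms in auto)
  ultimately show ?thesis
    by (simp add: prod.remove[OF finite_diag, of corner])
qed

lemma arm_reflect: "arm (swap_expo i \<eta>) (reflect x) = arm \<eta> x"
  by (cases x) (simp add: arm_def lookup_swap_expo)

lemma arm_corner: "Suc (arm \<eta> corner) = lookup \<eta> i - lookup \<eta> (Suc i)"
  using greater by (simp add: arm_def)

lemma corner_in_diag: "corner \<in> diag n \<eta>"
  using i greater by (simp add: diag_def)

lemma d_swap: "d n (swap_expo i \<eta>) * (1 - eigen_ratio n i \<eta>) = d n \<eta> * (1 - t * eigen_ratio n i \<eta>)"
proof -
  let ?g = "\<lambda>\<eta> x. 1 - q ^ (arm \<eta> x + 1) * t ^ (leg n \<eta> x + 1)"
  have "(\<Prod>x\<in>diag n (swap_expo i \<eta>). ?g (swap_expo i \<eta>) x) * ?g \<eta> corner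
      = (\<Prod>x\<in>diag n \<eta>. ?g \<eta> x) * ?g (swap_expo i \<eta>) (reflect corner)"
    by (rule prod_diag_swap) (simp only: arm_reflect leg_swap Diff_iff singleton_iff if_False)
  moreover have "?g \<eta> corner = 1 - eigen_ratio n i \<eta>"
    using arm_corner by (simp add: eigen_ratio_def)
  moreover have "?g (swap_expo i \<eta>) (reflect corner) = 1 - t * eigen_ratio n i \<eta>"
    unfolding arm_reflect leg_swap[OF corner_in_diag] using arm_corner by (simp add: eigen_ratio_def)
  ultimately show ?thesis by (simp only: d_def)
qed

text \<open>In \<open>d'\<close> the exponent of t is the leg itself, one less than in
  \<open>d\<close>, so the corner factor is 1 - delta / t before the exchange and 1 - delta after
  it.\<close>

lemma d'_swap: "d' n (swap_expo i \<eta>) * (1 - eigen_ratio n i \<eta> / t) = d' n \<eta> * (1 - eigen_ratio n i \<eta>)"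
proof -
  let ?g = "\<lambda>\<eta> x. 1 - q ^ (arm \<eta> x + 1) * t ^ leg n \<eta> x"
  have "(\<Prod>x\<in>diag n (swap_expo i \<eta>). ?g (swap_expo i \<eta>) x) * ?g \<eta> corner
      = (\<Prod>x\<in>diag n \<eta>. ?g \<eta> x) * ?g (swap_expo i \<eta>) (reflect corner)"
    by (rule prod_diag_swap) (simp only: arm_reflect leg_swap Diff_iff singleton_iff if_False)
  moreover have "?g \<eta> corner = 1 - eigen_ratio n i \<eta> / t"
    using arm_corner by (simp add: eigen_ratio_def)
  moreover have "?g (swap_expo i \<eta>) (reflect corner) = 1 - eigen_ratio n i \<eta>"
    unfolding arm_reflect leg_swap[OF corner_in_diag] using arm_corner by (simp add: eigen_ratio_def)
  ultimately show ?thesis by (simp only: d'_def)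
qed

text \<open>Between place i and place i+1 in the decreasing sort lie the places whose entries fall
  between the two, and with the tie rules these are the rows counted by the leg of the corner. One
  more step accounts for place i itself.\<close>

lemma eigenval_ratio: "eigenval n \<eta> i = eigen_ratio n i \<eta> * eigenval n \<eta> (Suc i)"
proof -
  have sets: "colength_set n \<eta> (Suc i) = insert i (colength_set n \<eta> i \<union> leg_set n \<eta> corner)"
    using i greater by (auto simp: colength_set_def leg_set_def less_Suc_eq)
  have "colength_set n \<eta> i \<inter> leg_set n \<eta> corner = {}" "i \<notin> colength_set n \<eta> i \<union> leg_set n \<eta> corner"
    by (auto simp: colength_set_def leg_set_def)
  moreover have "finite (colength_set n \<eta> i)" "finite (leg_set n \<eta> corner)"
    by (auto simp: colength_set_def leg_set_def)
  ultimately have "leg_colength n \<eta> (Suc i) = Suc (leg_colength n \<eta> i + leg n \<eta> corner)"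
    by (simp add: leg_colength_eq_card leg_eq_card sets card_Un_disjoint)
  then have "- int (leg_colength n \<eta> i) = int (Suc (leg n \<eta> corner)) + - int (leg_colength n \<eta> (Suc i))"
    by simp
  then have "t powi (- int (leg_colength n \<eta> i))
      = t ^ Suc (leg n \<eta> corner) * t powi (- int (leg_colength n \<eta> (Suc i)))"
    using power_int_add[of t "int (Suc (leg n \<eta> corner))" "- int (leg_colength n \<eta> (Suc i))"]
    by (simp only: power_int_of_nat) simp
  moreover have "q ^ lookup \<eta> i = q ^ (lookup \<eta> i - lookup \<eta> (Suc i)) * q ^ lookup \<eta> (Suc i)"
    using greater by (simp flip: power_add)
  ultimately show ?thesis
    by (simp only: eigenval_def eigen_ratio_def mult_ac)
qed

lemma eigen_ratio_neq: "eigen_ratio n i \<eta> \<noteq> 0" "eigen_ratio n i \<eta> \<noteq> 1" "eigen_ratio n i \<eta> \<noteq> t"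
proof -
  show "eigen_ratio n i \<eta> \<noteq> 0" by (simp add: eigen_ratio_def)
  show "eigen_ratio n i \<eta> \<noteq> 1" unfolding eigen_ratio_def q_t_monomial_eq_1_iff by simp
  show "eigen_ratio n i \<eta> \<noteq> t"
    using q_t_monomial_eq_iff[of "lookup \<eta> i - lookup \<eta> (Suc i)" "Suc (leg n \<eta> corner)" 0 1] greater
    by (simp add: eigen_ratio_def)
qed

lemma kappa_ratio: "kappa n \<eta> i = (t - 1) * eigen_ratio n i \<eta> / (1 - eigen_ratio n i \<eta>)"
proof -
  have "eigenval n \<eta> (Suc i) - eigen_ratio n i \<eta> * eigenval n \<eta> (Suc i) = (1 - eigen_ratio n i \<eta>) * eigenval n \<eta> (Suc i)"
    by (simp add: algebra_simps)
  then show ?thesis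
    using eigenval_nonzero[of n \<eta> "Suc i"] by (simp add: kappa_def eigenval_ratio)
qed

end

subsection \<open>The coefficients\<close>

text \<open>Induction along a reduced word instead of an arbitrary one: each step lengthens the
  element, which is what fixes the direction of the exchanged entries.\<close>

lemma W_ascent_induct [consumes 2, case_names id s]:
  assumes K: "K \<subseteq> {1..<n}" and "\<sigma> \<in> W n K" and "P id"
    and step: "\<And>i \<sigma>. \<lbrakk>i \<in> K; \<sigma> \<in> W n K; ascent \<sigma> i; P \<sigma>\<rbrakk> \<Longrightarrow> P (s i \<circ> \<sigma>)"
  shows "P \<sigma>"
proof -
  obtain w where w: "reduced_word n \<sigma> w"
    using reduced_word_ex W_permutes[OF K assms(2)] by blast
  then show ?thesis using assms(2)
  proof (induction w arbitrary: \<sigma>)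
    case Nil
    then show ?case using assms(3) by (simp only: reduced_word_def word_perm_simps)
  next
    case (Cons i w)
    note * = reduced_word_ConsD[OF Cons.prems(1)]
    have i: "i \<in> K" using reduced_word_letters[OF K Cons.prems(2,1)] by simp
    have \<tau>: "s i \<circ> \<sigma> \<in> W n K" using W_s_comp[OF K i Cons.prems(2)] .
    have "ascent (s i \<circ> \<sigma>) i" using * ascent_s_comp[OF W_bij[OF K Cons.prems(2)]] by simp
    from step[OF i \<tau> this Cons.IH[OF *(2) \<tau>]] show ?case by (simp only: s_s_comp)
  qed
qed

text \<open>If r were missing from \<open>K\<close>, the inverse permutation would respect the
  border after r; the hypotheses place i and i+1 on its two sides, so r = i.\<close>

lemma W_ascent_between:
  assumes K: "K \<subseteq> {1..<n}" and \<sigma>: "\<sigma> \<in> W n K" and "i \<in> K"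
    and r: "inv' \<sigma> i \<le> r" "r < inv' \<sigma> (Suc i)"
  shows "r \<in> K"
proof (rule ccontr)
  assume "r \<notin> K"
  note * = W_preserves[OF K W_inv[OF K \<sigma>] this]
  have "i \<le> r" "\<not> Suc i \<le> r" using *[of i] *[of "Suc i"] r by simp_all
  then have "r = i" by simp
  with \<open>i \<in> K\<close> \<open>r \<notin> K\<close> show False by simp
qed

text \<open>Entries i and i+1 of the moved composition come from two places a < b, and every place
  from a up to b - 1 is in \<open>K\<close> by the preceding lemma. The inequalities along
  \<open>K\<close> chain up.\<close>

lemma ascent_act_decreasing:
  assumes K: "K \<subseteq> {1..<n}" and \<sigma>: "\<sigma> \<in> W n K" and i: "i \<in> K" and asc: "ascent \<sigma> i"
  shows "(\<And>r. r \<in> K \<Longrightarrow> lookup \<eta> (Suc r) \<le> lookup \<eta> r) \<Longrightarrow>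
      lookup (act \<sigma> \<eta>) (Suc i) \<le> lookup (act \<sigma> \<eta>) i"
    and "(\<And>r. r \<in> K \<Longrightarrow> lookup \<eta> (Suc r) < lookup \<eta> r) \<Longrightarrow>
      lookup (act \<sigma> \<eta>) (Suc i) < lookup (act \<sigma> \<eta>) i"
proof -
  let ?a = "inv' \<sigma> i" and ?b = "inv' \<sigma> (Suc i)"
  have ab: "?a < ?b" using asc by (simp add: ascent_def)
  have chain: "lookup \<eta> (?a + k) \<le> lookup \<eta> ?a"
    if "\<And>r. r \<in> K \<Longrightarrow> lookup \<eta> (Suc r) \<le> lookup \<eta> r" "?a + k \<le> ?b" for k
    using that(2)
  proof (induction k)
    case (Suc k)
    then have "?a + k \<in> K" by (intro W_ascent_between[OF K \<sigma> i]) auto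
    with that(1)[of "?a + k"] Suc show ?case by simp
  qed simp
  note lk = act_apply[OF W_bij[OF K \<sigma>]]
  show "lookup (act \<sigma> \<eta>) (Suc i) \<le> lookup (act \<sigma> \<eta>) i"
    if "\<And>r. r \<in> K \<Longrightarrow> lookup \<eta> (Suc r) \<le> lookup \<eta> r"
    using chain[OF that, of "?b - ?a"] ab by (simp add: lk)
  show "lookup (act \<sigma> \<eta>) (Suc i) < lookup (act \<sigma> \<eta>) i"
    if dec: "\<And>r. r \<in> K \<Longrightarrow> lookup \<eta> (Suc r) < lookup \<eta> r"
  proof -
    obtain c where c: "?b = Suc c" using ab by (cases ?b) auto
    then have "c \<in> K" using ab by (intro W_ascent_between[OF K \<sigma> i]) auto
    then have "lookup \<eta> (Suc c) < lookup \<eta> c" by (rule dec)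
    moreover have "lookup \<eta> c \<le> lookup \<eta> ?a"
      using chain[of "c - ?a"] dec less_imp_le ab c by force
    ultimately show ?thesis by (simp add: lk c)
  qed
qed

lemma act_s_comp: "bij \<sigma> \<Longrightarrow> act (s i \<circ> \<sigma>) \<eta> = swap_expo i (act \<sigma> \<eta>)"
  by (simp add: act_comp act_s)

text \<open>A lengthening step exchanges a pair that is not increasing, which cannot raise the
  partial sums.\<close>

lemma partial_sums_orbit_le:
  assumes K: "K \<subseteq> {1..<n}" and "\<sigma> \<in> W n K"
    and dec: "\<And>r. r \<in> K \<Longrightarrow> lookup \<eta> (Suc r) \<le> lookup \<eta> r"
  shows "partial_sums n (act \<sigma> \<eta>) \<le> partial_sums n \<eta>"
  using assms(1,2)
proof (induction rule: W_ascent_induct)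
  case (s i \<sigma>)
  let ?\<mu> = "act \<sigma> \<eta>"
  have i: "1 \<le> i" "i < n" using s K by auto
  have le: "lookup ?\<mu> (Suc i) \<le> lookup ?\<mu> i"
    using ascent_act_decreasing(1)[OF K s.hyps(2,1,3) dec] .
  have "partial_sums n (swap_expo i ?\<mu>) \<le> partial_sums n ?\<mu>"
  proof (cases "lookup ?\<mu> (Suc i) = lookup ?\<mu> i")
    case True
    then show ?thesis by (simp add: swap_expo_equal)
  next
    case False
    then show ?thesis
      using partial_sums_swap[OF i, of "swap_expo i ?\<mu>"] le by (simp add: lookup_swap_expo swap_swap)
  qed
  with s.IH show ?case by (simp only: act_s_comp W_bij[OF K s.hyps(2)])
qed (simp only: act_id order_refl)

section \<open>Inverted Laurent polynomials and sums of basis elements\<close>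

lemma lookup_laurent_inv: "lookup (laurent_inv f) (- a) = qt_inv (lookup f a)"
  by (auto simp: laurent_inv_def lookup_sum lookup_single when_def in_keys_iff)

lemma qt_inv_sum: "qt_inv (sum f A) = (\<Sum>a\<in>A. qt_inv (f a))"
  by (induction A rule: infinite_finite_induct) (auto simp: qt_inv_hom)

lemma laurent_inv_sum_scal:
  "laurent_inv (\<Sum>\<mu>\<in>A. scal (x \<mu>) (F \<mu>)) = (\<Sum>\<mu>\<in>A. scal (qt_inv (x \<mu>)) (laurent_inv (F \<mu>)))"
proof (rule poly_mapping_eqI)
  fix b
  have "lookup (laurent_inv f) b = qt_inv (lookup f (- b))" for f
    using lookup_laurent_inv[of f "- b"] by simp
  then show "lookup (laurent_inv (\<Sum>\<mu>\<in>A. scal (x \<mu>) (F \<mu>))) b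
      = lookup (\<Sum>\<mu>\<in>A. scal (qt_inv (x \<mu>)) (laurent_inv (F \<mu>))) b"
    by (simp add: lookup_sum lookup_scal qt_inv_sum qt_inv_hom)
qed

text \<open>One formula for all three relations between the two entries. The values left open, such
  as \<open>\<beta>\<close> at decreasing entries, do not enter the recursion.\<close>

lemma T_E_expansion:
  assumes n: "n \<ge> 1" and E: "\<forall>\<eta>. composition n \<eta> \<longrightarrow> is_nonsym_macdonald n \<eta> (E \<eta>)"
    and i: "1 \<le> i" "i < n"
  obtains \<alpha> \<beta> where
    "\<And>\<eta>. composition n \<eta> \<Longrightarrow> T i (E \<eta>) = scal (\<alpha> \<eta>) (E \<eta>) + scal (\<beta> \<eta>) (E (swap_expo i \<eta>))"
    "\<And>\<eta>. lookup \<eta> i < lookup \<eta> (Suc i) \<Longrightarrow> \<beta> \<eta> = t"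
    "\<And>\<eta>. lookup \<eta> i \<noteq> lookup \<eta> (Suc i) \<Longrightarrow> \<alpha> \<eta> = - kappa n \<eta> i"
proof -
  define \<alpha> where "\<alpha> \<eta> = (if lookup \<eta> i = lookup \<eta> (Suc i) then t else - kappa n \<eta> i)" for \<eta>
  \<comment> \<open>At equal entries the swap returns \<open>\<eta>\<close> itself, so the
    eigenvalue t is put into \<open>\<alpha>\<close> and 0 here; at decreasing entries mere
    existence is enough.\<close>
  define \<beta> where "\<beta> \<eta> = (if lookup \<eta> i = lookup \<eta> (Suc i) then 0 else if lookup \<eta> i < lookup \<eta> (Suc i) then t
    else SOME c. T i (E \<eta>) = scal (- kappa n \<eta> i) (E \<eta>) + scal c (E (swap_expo i \<eta>)))" for \<eta>
  show ?thesis
  proof (rule that[of \<alpha> \<beta>])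
    fix \<eta> assume \<eta>: "composition n \<eta>"
    consider "lookup \<eta> i = lookup \<eta> (Suc i)" | "lookup \<eta> i < lookup \<eta> (Suc i)" | "lookup \<eta> (Suc i) < lookup \<eta> i"
      by linarith
    then show "T i (E \<eta>) = scal (\<alpha> \<eta>) (E \<eta>) + scal (\<beta> \<eta>) (E (swap_expo i \<eta>))"
    proof cases
      case 1
      then show ?thesis using T_E_equal[OF n E i \<eta>] by (simp add: \<alpha>_def \<beta>_def scal_simps)
    next
      case 2
      then show ?thesis using T_E_swap(2)[OF n E i \<eta>] by (simp add: \<alpha>_def \<beta>_def)
    next
      case 3
      then have "\<exists>c. T i (E \<eta>) = scal (- kappa n \<eta> i) (E \<eta>) + scal c (E (swap_expo i \<eta>))"
        using T_E_swap(1)[OF n E i \<eta>] by simp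
      from someI_ex[OF this] 3 show ?thesis by (simp add: \<alpha>_def \<beta>_def)
    qed
  qed (auto simp: \<alpha>_def \<beta>_def)
qed

text \<open>The coefficient of E_mu receives a contribution from E_mu and one from E_{s_i mu}. When
  mu decreases at i, the second source increases there, so its factor is the known t.\<close>

lemma sum_T_E:
  assumes n: "n \<ge> 1" and E: "\<forall>\<eta>. composition n \<eta> \<longrightarrow> is_nonsym_macdonald n \<eta> (E \<eta>)"
    and i: "1 \<le> i" "i < n"
    and A: "A \<subseteq> Collect (composition n)" "\<And>\<mu>. \<mu> \<in> A \<Longrightarrow> swap_expo i \<mu> \<in> A"
  shows "\<exists>y. T i (\<Sum>\<mu>\<in>A. scal (c \<mu>) (E \<mu>)) = (\<Sum>\<mu>\<in>A. scal (y \<mu>) (E \<mu>)) \<and>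
    (\<forall>\<mu>\<in>A. lookup \<mu> (Suc i) < lookup \<mu> i \<longrightarrow> y \<mu> = t * c (swap_expo i \<mu>) - kappa n \<mu> i * c \<mu>)"
proof -
  obtain \<alpha> \<beta> where T: "\<And>\<eta>. composition n \<eta> \<Longrightarrow> T i (E \<eta>) = scal (\<alpha> \<eta>) (E \<eta>) + scal (\<beta> \<eta>) (E (swap_expo i \<eta>))"
    and \<beta>: "\<And>\<eta>. lookup \<eta> i < lookup \<eta> (Suc i) \<Longrightarrow> \<beta> \<eta> = t"
    and \<alpha>: "\<And>\<eta>. lookup \<eta> i \<noteq> lookup \<eta> (Suc i) \<Longrightarrow> \<alpha> \<eta> = - kappa n \<eta> i"
    using T_E_expansion[OF n E i] by blast
  define y where "y \<mu> = c \<mu> * \<alpha> \<mu> + c (swap_expo i \<mu>) * \<beta> (swap_expo i \<mu>)" for \<mu>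
  have "T i (\<Sum>\<mu>\<in>A. scal (c \<mu>) (E \<mu>)) = (\<Sum>\<mu>\<in>A. scal (c \<mu>) (T i (E \<mu>)))"
    by (simp add: T_sum T_scal)
  also have "\<dots> = (\<Sum>\<mu>\<in>A. scal (c \<mu> * \<alpha> \<mu>) (E \<mu>) + scal (c \<mu> * \<beta> \<mu>) (E (swap_expo i \<mu>)))"
    using A(1) by (intro sum.cong) (auto simp: T scal_simps(1,5))
  also have "\<dots> = (\<Sum>\<mu>\<in>A. scal (c \<mu> * \<alpha> \<mu>) (E \<mu>)) + (\<Sum>\<mu>\<in>A. scal (c \<mu> * \<beta> \<mu>) (E (swap_expo i \<mu>)))"
    by (rule sum.distrib)
  also have "(\<Sum>\<mu>\<in>A. scal (c \<mu> * \<beta> \<mu>) (E (swap_expo i \<mu>)))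
      = (\<Sum>\<mu>\<in>A. scal (c (swap_expo i \<mu>) * \<beta> (swap_expo i \<mu>)) (E \<mu>))"
    by (rule sum.reindex_bij_witness[where i = "swap_expo i" and j = "swap_expo i"])
      (use A(2) in \<open>auto simp: swap_swap\<close>)
  also have "(\<Sum>\<mu>\<in>A. scal (c \<mu> * \<alpha> \<mu>) (E \<mu>)) + \<dots> = (\<Sum>\<mu>\<in>A. scal (y \<mu>) (E \<mu>))"
    by (simp add: y_def scal_simps(3) sum.distrib)
  finally have "T i (\<Sum>\<mu>\<in>A. scal (c \<mu>) (E \<mu>)) = (\<Sum>\<mu>\<in>A. scal (y \<mu>) (E \<mu>))" .
  moreover have "y \<mu> = t * c (swap_expo i \<mu>) - kappa n \<mu> i * c \<mu>" if "lookup \<mu> (Suc i) < lookup \<mu> i" for \<mu>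
    using that \<alpha>[of \<mu>] \<beta>[of "swap_expo i \<mu>"] by (simp add: y_def lookup_swap_expo)
  ultimately show ?thesis by blast
qed

section \<open>The orbit of the given composition\<close>

context
  fixes n :: nat and I J :: "nat set" and \<eta>s :: comp
  assumes n: "n \<ge> 1" and adm: "admissible n I J" and \<eta>s: "composition n \<eta>s"
    and domI: "\<forall>i\<in>I. lookup \<eta>s i \<ge> lookup \<eta>s (i + 1)"
    and domJ: "\<forall>j\<in>J. lookup \<eta>s j > lookup \<eta>s (j + 1)"
begin

private abbreviation (input) orbit :: "comp set" where "orbit \<equiv> orbit_W n (I \<union> J) \<eta>s"

private lemmas sub = adm_subset[OF adm]

lemma orbit_composition: "\<mu> \<in> orbit \<Longrightarrow> composition n \<mu>"
  unfolding orbit_W_def using composition_act[OF W_permutes[OF sub(3)] \<eta>s] by blast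

lemma orbit_act: "\<sigma> \<in> W n (I \<union> J) \<Longrightarrow> act \<sigma> \<eta>s \<in> orbit"
  by (simp add: orbit_W_def)

lemma orbit_self: "\<eta>s \<in> orbit"
  using orbit_act[OF W_id[OF sub(3)]] by simp

lemma orbit_swap:
  assumes "i \<in> I \<union> J" "\<mu> \<in> orbit"
  shows "swap_expo i \<mu> \<in> orbit"
proof -
  obtain \<sigma> where \<sigma>: "\<sigma> \<in> W n (I \<union> J)" "\<mu> = act \<sigma> \<eta>s" using assms(2) by (auto simp: orbit_W_def)
  show ?thesis
    using orbit_act[OF W_s_comp[OF sub(3) assms(1) \<sigma>(1)]] by (simp only: \<sigma>(2) act_s_comp W_bij[OF sub(3) \<sigma>(1)])
qed

lemma finite_orbit: "finite orbit"
  unfolding orbit_W_def by (intro finite_imageI finite_W[OF sub(3)])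

lemma W_I_W_J_subset: "\<sigma> \<in> W n I \<Longrightarrow> \<sigma> \<in> W n (I \<union> J)" "\<sigma> \<in> W n J \<Longrightarrow> \<sigma> \<in> W n (I \<union> J)"
  using W_iff[OF sub(1)] W_iff[OF sub(2)] W_iff[OF sub(3)] by blast+

lemma orbit_part_of:
  assumes "\<mu> \<in> orbit"
  shows "part_of n \<mu> = part_of n \<eta>s"
  using assms part_of_act[OF W_permutes[OF sub(3)]] by (auto simp: orbit_W_def)

text \<open>\<open>\<eta>s\<close> has the largest partial sums in its orbit. Hence its monomial
  occurs in no other E of the orbit, which fixes the normalization.\<close>

lemma orbit_not_prec:
  assumes "\<mu> \<in> orbit"
  shows "\<not> prec n \<eta>s \<mu>"
proof
  assume "prec n \<eta>s \<mu>"
  then have "dom_less n \<eta>s \<mu>" using orbit_part_of[OF assms] by (auto simp: prec_def dom_less_def)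
  then have "partial_sums n \<eta>s < partial_sums n \<mu>"
    using partial_sums_less \<eta>s orbit_composition[OF assms] by blast
  moreover have "partial_sums n \<mu> \<le> partial_sums n \<eta>s"
  proof -
    obtain \<sigma> where \<sigma>: "\<sigma> \<in> W n (I \<union> J)" "\<mu> = act \<sigma> \<eta>s" using assms by (auto simp: orbit_W_def)
    have "lookup \<eta>s (Suc r) \<le> lookup \<eta>s r" if "r \<in> I \<union> J" for r using that domI domJ by fastforce
    from partial_sums_orbit_le[OF sub(3) \<sigma>(1) this] \<sigma>(2) show ?thesis by simp
  qed
  ultimately show False by simp
qed

text \<open>The common shape of both families of coefficients: \<open>u\<close> and \<open>v\<close> are the factors picked up
  along the simple reflections in \<open>I\<close> and in \<open>J\<close>.\<close>

lemma coefficient_formula: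
  assumes one: "x \<eta>s = 1"
    and recI: "\<And>i \<mu>. \<lbrakk>i \<in> I; \<mu> \<in> orbit; lookup \<mu> (Suc i) < lookup \<mu> i\<rbrakk> \<Longrightarrow>
      x (swap_expo i \<mu>) * d' n (swap_expo i \<mu>) = u * (x \<mu> * d' n \<mu>)"
    and recJ: "\<And>j \<mu>. \<lbrakk>j \<in> J; \<mu> \<in> orbit; lookup \<mu> (Suc j) < lookup \<mu> j\<rbrakk> \<Longrightarrow>
      x (swap_expo j \<mu>) * d n \<mu> = v * (x \<mu> * d n (swap_expo j \<mu>))"
    and \<sigma>: "\<sigma> \<in> W n I" and \<tau>: "\<tau> \<in> W n J"
    and min: "\<forall>\<rho>\<in>W n I. act \<rho> \<eta>s = act \<sigma> \<eta>s \<longrightarrow> len n \<sigma> \<le> len n \<rho>"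
  shows "x (act (\<sigma> \<circ> \<tau>) \<eta>s) = v ^ len n \<tau> * u ^ len n \<sigma> *
    ((d' n \<eta>s * d n (act (\<sigma> \<circ> \<tau>) \<eta>s)) / (d' n (act \<sigma> \<eta>s) * d n (act \<sigma> \<eta>s)))"
proof -
  let ?minimal = "\<lambda>\<sigma>. \<forall>\<rho>\<in>W n I. act \<rho> \<eta>s = act \<sigma> \<eta>s \<longrightarrow> len n \<sigma> \<le> len n \<rho>"
  have I: "x (act \<sigma> \<eta>s) * d' n (act \<sigma> \<eta>s) = u ^ len n \<sigma> * d' n \<eta>s"
    using sub(1) \<sigma> min
  proof (induction rule: W_ascent_induct)
    case id
    show ?case by (simp only: act_id one len_id power_0)
  next
    case (s i \<sigma>)
    have i: "i \<in> {1..<n}" using s.hyps sub by blast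
    have perm: "\<rho> permutes {1..n}" "bij \<rho>" if "\<rho> \<in> W n I" for \<rho>
      using W_permutes[OF sub(1) that] W_bij[OF sub(1) that] .
    have len: "len n (s i \<circ> \<sigma>) = Suc (len n \<sigma>)"
      by (rule len_ascent(1)[OF perm(1)[OF s.hyps(2)] i s.hyps(3)])
    have min: "?minimal (s i \<circ> \<sigma>)" using s.prems by (simp only: comp_def)
    \<comment> \<open>A shorter permutation with the same effect as \<open>\<sigma>\<close> would,
      followed by s_i, compete with the minimal one.\<close>
    have "?minimal \<sigma>"
    proof (intro ballI impI)
      fix \<rho> assume \<rho>: "\<rho> \<in> W n I" "act \<rho> \<eta>s = act \<sigma> \<eta>s"
      then have "act (s i \<circ> \<rho>) \<eta>s = act (s i \<circ> \<sigma>) \<eta>s" by (simp only: act_s_comp perm s.hyps)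
      then have "len n (s i \<circ> \<sigma>) \<le> len n (s i \<circ> \<rho>)"
        using min W_s_comp[OF sub(1) s.hyps(1) \<rho>(1)] by blast
      moreover have "len n (s i \<circ> \<rho>) \<le> Suc (len n \<rho>)"
        using len_ascent[OF perm(1)[OF \<rho>(1)] i] by (cases "ascent \<rho> i") linarith+
      ultimately show "len n \<sigma> \<le> len n \<rho>" using len by simp
    qed
    note IH = s.IH[OF this]
    let ?\<mu> = "act \<sigma> \<eta>s"
    have swap: "act (s i \<circ> \<sigma>) \<eta>s = swap_expo i ?\<mu>" by (simp only: act_s_comp perm s.hyps)
    have "lookup ?\<mu> (Suc i) \<le> lookup ?\<mu> i"
      using domI by (intro ascent_act_decreasing(1)[OF sub(1) s.hyps(2,1,3)]) auto
    \<comment> \<open>Were the entries equal, the last reflection would be idle and could be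
      dropped, against minimality. This is what makes the number of factors u equal to the
      length.\<close>
    moreover have "lookup ?\<mu> (Suc i) \<noteq> lookup ?\<mu> i"
    proof
      assume "lookup ?\<mu> (Suc i) = lookup ?\<mu> i"
      then have "swap_expo i ?\<mu> = ?\<mu>" by (simp add: swap_expo_equal)
      then have "len n (s i \<circ> \<sigma>) \<le> len n \<sigma>" using min s.hyps(2) swap by metis
      with len show False by simp
    qed
    ultimately have "x (swap_expo i ?\<mu>) * d' n (swap_expo i ?\<mu>) = u * (x ?\<mu> * d' n ?\<mu>)"
      using orbit_act[OF W_I_W_J_subset(1)[OF s.hyps(2)]] by (intro recI s.hyps(1)) auto
    then show ?case unfolding swap len IH by simp
  qed
  let ?\<mu>I = "act \<sigma> \<eta>s"
  \<comment> \<open>Elements of W_I fix j and j + 1, so the strict inequalities of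
    \<open>\<eta>s\<close> along \<open>J\<close> survive.\<close>
  have strict: "lookup ?\<mu>I (Suc j) < lookup ?\<mu>I j" if "j \<in> J" for j
    using W_I_fixes_J[OF adm that W_inv[OF sub(1) \<sigma>]] domJ that by (simp add: act_apply W_bij[OF sub(1) \<sigma>])
  have J: "x (act \<tau> ?\<mu>I) * d n ?\<mu>I = v ^ len n \<tau> * x ?\<mu>I * d n (act \<tau> ?\<mu>I)"
    using sub(2) \<tau>
  proof (induction rule: W_ascent_induct)
    case id
    show ?case by (simp only: act_id len_id power_0 mult_1)
  next
    case (s j \<tau>)
    let ?\<mu> = "act \<tau> ?\<mu>I"
    have bij: "bij \<sigma>" "bij \<tau>" using W_bij[OF sub(1) \<sigma>] W_bij[OF sub(2) s.hyps(2)] .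
    have len: "len n (s j \<circ> \<tau>) = Suc (len n \<tau>)"
      using s.hyps sub by (intro len_ascent(1) W_permutes[OF sub(2)]) auto
    have swap: "act (s j \<circ> \<tau>) ?\<mu>I = swap_expo j ?\<mu>" by (simp only: act_s_comp bij)
    have "?\<mu> = act (\<tau> \<circ> \<sigma>) \<eta>s" by (simp only: act_comp bij)
    then have "?\<mu> \<in> orbit"
      using orbit_act[OF W_comp[OF sub(3) W_I_W_J_subset(2)[OF s.hyps(2)] W_I_W_J_subset(1)[OF \<sigma>]]] by simp
    then have "x (swap_expo j ?\<mu>) * d n ?\<mu> = v * (x ?\<mu> * d n (swap_expo j ?\<mu>))"
      using strict by (intro recJ s.hyps(1) ascent_act_decreasing(2)[OF sub(2) s.hyps(2,1,3)])
    then have "d n ?\<mu> * (x (swap_expo j ?\<mu>) * d n ?\<mu>I)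
        = v * (x ?\<mu> * d n ?\<mu>I) * d n (swap_expo j ?\<mu>)"
      by (simp add: mult_ac)
    also have "\<dots> = d n ?\<mu> * (v ^ Suc (len n \<tau>) * x ?\<mu>I * d n (swap_expo j ?\<mu>))"
      unfolding s.IH by (simp add: mult_ac)
    finally show ?case unfolding swap len by (simp add: d_nonzero)
  qed
  \<comment> \<open>The two parts commute, so the J-part may act on the composition already moved by
    the I-part.\<close>
  have "\<sigma> \<circ> \<tau> = \<tau> \<circ> \<sigma>" using W_J_commute_W_I[OF adm \<tau> \<sigma>] by simp
  then have act: "act (\<sigma> \<circ> \<tau>) \<eta>s = act \<tau> ?\<mu>I"
    using W_bij[OF sub(1) \<sigma>] W_bij[OF sub(2) \<tau>] by (simp only: act_comp)
  have "x ?\<mu>I = u ^ len n \<sigma> * d' n \<eta>s / d' n ?\<mu>I"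
    using I d'_nonzero[of n ?\<mu>I] by (simp add: field_simps)
  moreover have "x (act \<tau> ?\<mu>I) = v ^ len n \<tau> * x ?\<mu>I * d n (act \<tau> ?\<mu>I) / d n ?\<mu>I"
    using J d_nonzero[of n ?\<mu>I] by (simp add: field_simps)
  ultimately show ?thesis unfolding act by (simp add: field_simps)
qed

section \<open>Expansion of the polynomial with prescribed symmetry\<close>

context
  fixes E :: "comp \<Rightarrow> laurent" and S :: laurent
  assumes E: "\<forall>\<eta>. composition n \<eta> \<longrightarrow> is_nonsym_macdonald n \<eta> (E \<eta>)"
    and S: "is_prescribed_macdonald n E I J \<eta>s S"
begin

lemma orbit_E_independent:
  assumes "(\<Sum>\<mu>\<in>orbit. scal (x \<mu>) (E \<mu>)) = (\<Sum>\<mu>\<in>orbit. scal (y \<mu>) (E \<mu>))" "\<mu> \<in> orbit"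
  shows "x \<mu> = y \<mu>"
proof -
  have "(\<Sum>\<mu>\<in>orbit. scal (x \<mu> - y \<mu>) (E \<mu>)) = 0"
    using assms(1) by (simp add: scal_simps(4) sum_subtractf)
  then have "x \<mu> - y \<mu> = 0"
    using assms(2) orbit_composition by (intro E_independent[OF n E finite_orbit]) auto
  then show ?thesis by simp
qed

text \<open>Inversion negates exponents and keeps track of vanishing coefficients, so the same
  triangularity holds with negated leading exponents.\<close>

lemma orbit_E_inv_independent:
  assumes "(\<Sum>\<mu>\<in>orbit. scal (x \<mu>) (laurent_inv (E \<mu>))) = (\<Sum>\<mu>\<in>orbit. scal (y \<mu>) (laurent_inv (E \<mu>)))"
    and "\<mu> \<in> orbit"
  shows "x \<mu> = y \<mu>"
proof -
  have "(\<Sum>\<mu>\<in>orbit. scal (x \<mu> - y \<mu>) (laurent_inv (E \<mu>))) = 0"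
    using assms(1) by (simp add: scal_simps(4) sum_subtractf)
  then have "x \<mu> - y \<mu> = 0"
  proof (rule triangular_independent[OF finite_orbit, where e = "\<lambda>\<mu>. - expo \<mu>" and rank = "prec_rank n"])
    show "prec_rank n \<kappa> < prec_rank n \<nu>"
      if "\<nu> \<in> orbit" "\<kappa> \<in> orbit" "lookup (laurent_inv (E \<nu>)) (- expo \<kappa>) \<noteq> 0" "\<kappa> \<noteq> \<nu>" for \<nu> \<kappa>
    proof -
      have "lookup (E \<nu>) (expo \<kappa>) \<noteq> 0" using that(3) by (auto simp: lookup_laurent_inv)
      then show ?thesis
        using that orbit_composition E_lookup_nonzero[OF n E] by (intro prec_rank_less[OF n]) auto
    qed
  qed (use assms(2) orbit_composition in \<open>auto simp: lookup_laurent_inv E_lookup_self[OF n E]\<close>)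
  then show ?thesis by simp
qed

lemma T_orbit_sum: "i \<in> I \<union> J \<Longrightarrow> \<exists>y. T i (\<Sum>\<mu>\<in>orbit. scal (c \<mu>) (E \<mu>)) = (\<Sum>\<mu>\<in>orbit. scal (y \<mu>) (E \<mu>)) \<and>
    (\<forall>\<mu>\<in>orbit. lookup \<mu> (Suc i) < lookup \<mu> i \<longrightarrow> y \<mu> = t * c (swap_expo i \<mu>) - kappa n \<mu> i * c \<mu>)"
  using sub(3) orbit_composition orbit_swap by (intro sum_T_E[OF n E]) auto

lemma T_word_orbit_sum:
  assumes "set w \<subseteq> I \<union> J"
  shows "\<exists>y. T_word w (\<Sum>\<mu>\<in>orbit. scal (c \<mu>) (E \<mu>)) = (\<Sum>\<mu>\<in>orbit. scal (y \<mu>) (E \<mu>))"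
  using assms
proof (induction w)
  case (Cons i w)
  then obtain y where "T_word w (\<Sum>\<mu>\<in>orbit. scal (c \<mu>) (E \<mu>)) = (\<Sum>\<mu>\<in>orbit. scal (y \<mu>) (E \<mu>))" by auto
  then show ?case using T_orbit_sum[of i y] Cons.prems by auto
qed auto

lemma O_IJ_orbit_sum: "\<exists>y. O_IJ n I J (\<Sum>\<mu>\<in>orbit. scal (c \<mu>) (E \<mu>)) = (\<Sum>\<mu>\<in>orbit. scal (y \<mu>) (E \<mu>))"
proof -
  let ?f = "\<Sum>\<mu>\<in>orbit. scal (c \<mu>) (E \<mu>)" and ?c = "\<lambda>\<omega>. (- 1 / t) ^ len n (J_part n I J \<omega>)"
  have "\<exists>y. T_perm n \<omega> ?f = (\<Sum>\<mu>\<in>orbit. scal (y \<mu>) (E \<mu>))" if \<omega>: "\<omega> \<in> W n (I \<union> J)" for \<omega>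
  proof -
    obtain w where w: "reduced_word n \<omega> w" using reduced_word_ex W_permutes[OF sub(3) \<omega>] by blast
    from T_word_orbit_sum[OF reduced_word_letters[OF sub(3) \<omega> w]] show ?thesis
      by (simp add: T_perm_eq_T_word[OF w])
  qed
  then have "\<forall>\<omega>\<in>W n (I \<union> J). \<exists>y. T_perm n \<omega> ?f = (\<Sum>\<mu>\<in>orbit. scal (y \<mu>) (E \<mu>))" by blast
  from bchoice[OF this] obtain y
    where y: "\<forall>\<omega>\<in>W n (I \<union> J). T_perm n \<omega> ?f = (\<Sum>\<mu>\<in>orbit. scal (y \<omega> \<mu>) (E \<mu>))" by blast
  have "O_IJ n I J ?f = (\<Sum>\<omega>\<in>W n (I \<union> J). \<Sum>\<mu>\<in>orbit. scal (?c \<omega> * y \<omega> \<mu>) (E \<mu>))"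
    unfolding O_IJ_def by (rule sum.cong) (simp_all add: y scal_sum scal_simps(5))
  also have "\<dots> = (\<Sum>\<mu>\<in>orbit. \<Sum>\<omega>\<in>W n (I \<union> J). scal (?c \<omega> * y \<omega> \<mu>) (E \<mu>))" by (rule sum.swap)
  also have "\<dots> = (\<Sum>\<mu>\<in>orbit. scal (\<Sum>\<omega>\<in>W n (I \<union> J). ?c \<omega> * y \<omega> \<mu>) (E \<mu>))"
  proof -
    have "(\<Sum>a\<in>A. scal (f a) g) = scal (sum f A) g" for A :: "(nat \<Rightarrow> nat) set" and f g
      by (induction A rule: infinite_finite_induct) (auto simp: scal_simps)
    then show ?thesis by simp
  qed
  finally show ?thesis
    by (intro exI[of _ "\<lambda>\<mu>. \<Sum>\<omega>\<in>W n (I \<union> J). ?c \<omega> * y \<omega> \<mu>"])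
qed

lemma S_expansion:
  obtains c where "S = (\<Sum>\<mu>\<in>orbit. scal (c \<mu>) (E \<mu>))" "c \<eta>s = 1"
    "\<And>i. i \<in> I \<Longrightarrow> T i S = scal t S" "\<And>j. j \<in> J \<Longrightarrow> T j S = - S"
proof -
  obtain a where a: "a \<noteq> 0" "O_IJ n I J (E \<eta>s) = scal a S"
    using S orbit_self by (auto simp: is_prescribed_macdonald_def)
  then have S': "S = scal (1 / a) (O_IJ n I J (E \<eta>s))"
    by (simp add: scal_simps(6) flip: scal_simps(5))
  have "E \<eta>s = (\<Sum>\<mu>\<in>orbit. scal (if \<mu> = \<eta>s then 1 else 0) (E \<mu>))"
    using finite_orbit orbit_self
    by (simp add: if_distrib[of "\<lambda>x. scal x _"] scal_simps(6,7) cong: if_cong)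
  then obtain y where "O_IJ n I J (E \<eta>s) = (\<Sum>\<mu>\<in>orbit. scal (y \<mu>) (E \<mu>))"
    using O_IJ_orbit_sum[of "\<lambda>\<mu>. if \<mu> = \<eta>s then 1 else 0"] by auto
  then have c: "S = (\<Sum>\<mu>\<in>orbit. scal (1 / a * y \<mu>) (E \<mu>))"
    unfolding S' scal_simps(5) by (simp add: scal_sum)
  \<comment> \<open>Compare the coefficients of the monomial of \<open>\<eta>s\<close>: within the
    orbit only its own E contains it.\<close>
  moreover have "1 / a * y \<eta>s = 1"
  proof -
    have "lookup (E \<mu>) (expo \<eta>s) = (if \<mu> = \<eta>s then 1 else 0)" if "\<mu> \<in> orbit" for \<mu>
      using E_lookup_nonzero[OF n E, of \<mu> \<eta>s] E_lookup_self[OF n E \<eta>s] orbit_composition orbit_not_prec that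
      by auto
    then have "lookup S (expo \<eta>s) = (\<Sum>\<mu>\<in>orbit. 1 / a * y \<mu> * (if \<mu> = \<eta>s then 1 else 0))"
      unfolding c lookup_sum lookup_scal by (intro sum.cong) auto
    also have "\<dots> = 1 / a * y \<eta>s"
      using finite_orbit orbit_self by (simp add: if_distrib[of "(*) _"] cong: if_cong)
    finally show ?thesis using S by (simp add: is_prescribed_macdonald_def)
  qed
  moreover have "T i S = scal t S" if "i \<in> I" for i
    unfolding S' T_scal T_O_IJ(1)[OF adm that]
    by (simp add: mult.commute flip: scal_simps(5))
  moreover have "T j S = - S" if "j \<in> J" for j
    unfolding S' T_scal T_O_IJ(2)[OF adm that] by (simp add: scal_simps)
  ultimately show ?thesis by (rule that)
qed

text \<open>Compares the coefficients of E_mu in T_i S = l S and clears the denominator of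
  \<open>kappa\<close>. With l = t the right factor is t - delta, with l = -1 it is -(1 - t
  delta).\<close>

lemma S_coefficient_recursion:
  assumes c: "S = (\<Sum>\<mu>\<in>orbit. scal (c \<mu>) (E \<mu>))"
    and i: "i \<in> I \<union> J" and T: "T i S = scal l S"
    and \<mu>: "\<mu> \<in> orbit" "lookup \<mu> (Suc i) < lookup \<mu> i"
  shows "t * c (swap_expo i \<mu>) * (1 - eigen_ratio n i \<mu>)
    = c \<mu> * (l * (1 - eigen_ratio n i \<mu>) + (t - 1) * eigen_ratio n i \<mu>)"
proof -
  have in': "1 \<le> i" "i < n" using i sub(3) by auto
  obtain y where y: "T i S = (\<Sum>\<mu>\<in>orbit. scal (y \<mu>) (E \<mu>))"
    "y \<mu> = t * c (swap_expo i \<mu>) - kappa n \<mu> i * c \<mu>"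
    using T_orbit_sum[OF i, of c] \<mu> c by auto
  have "T i S = (\<Sum>\<mu>\<in>orbit. scal (l * c \<mu>) (E \<mu>))"
    unfolding T by (subst c) (simp add: scal_sum scal_simps(5))
  with y(1) have "y \<mu> = l * c \<mu>"
    by (intro orbit_E_independent[of y "\<lambda>\<mu>. l * c \<mu>", OF _ \<mu>(1)]) simp
  with y(2) have "t * c (swap_expo i \<mu>) = (l + kappa n \<mu> i) * c \<mu>" by (simp add: algebra_simps)
  then have "t * c (swap_expo i \<mu>) * (1 - eigen_ratio n i \<mu>)
      = c \<mu> * (l * (1 - eigen_ratio n i \<mu>) + kappa n \<mu> i * (1 - eigen_ratio n i \<mu>))"
    by (simp only: mult_ac distrib_left distrib_right)
  moreover have "kappa n \<mu> i * (1 - eigen_ratio n i \<mu>) = (t - 1) * eigen_ratio n i \<mu>"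
    using eigen_ratio_neq(2)[OF in' \<mu>(2)] by (simp add: kappa_ratio[OF in' \<mu>(2)])
  ultimately show ?thesis by (simp only:)
qed

end

end

lemma qt_inv_eigen_ratio: "qt_inv (eigen_ratio n i \<eta>) = 1 / eigen_ratio n i \<eta>"
  by (simp add: eigen_ratio_def qt_inv_hom qt_inv_power qt_inv_divide field_simps)

text \<open>Eliminates the eigenvalue ratio r between the recursion of the coefficients and that of
  D, which stands for \<open>d'\<close> in the first part and for \<open>d\<close> in the
  second.\<close>

lemma ratio_recursion:
  fixes x x' :: "'a::field"
  shows "\<lbrakk>x' * (1 - r) = u * (x * (1 - w)); D' * (1 - w) = D * (1 - r); r \<noteq> 1; w \<noteq> 1\<rbrakk>
      \<Longrightarrow> x' * D' = u * (x * D)"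
    and "\<lbrakk>x' * (1 - r) = v * (x * w); D' * (1 - r) = D * w; r \<noteq> 1\<rbrakk> \<Longrightarrow> x' * D = v * (x * D')"
proof -
  assume *: "x' * (1 - r) = u * (x * (1 - w))" "D' * (1 - w) = D * (1 - r)" "r \<noteq> 1" "w \<noteq> 1"
  have "(x' * D') * ((1 - r) * (1 - w)) = (x' * (1 - r)) * (D' * (1 - w))" by (simp only: mult_ac)
  also have "\<dots> = (u * (x * D)) * ((1 - r) * (1 - w))" unfolding *(1,2) by (simp only: mult_ac)
  finally show "x' * D' = u * (x * D)" using *(3,4) by simp
next
  assume *: "x' * (1 - r) = v * (x * w)" "D' * (1 - r) = D * w" "r \<noteq> 1"
  have "(x' * D) * (1 - r) = (x' * (1 - r)) * D" by (simp only: mult_ac)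
  also have "\<dots> = v * (x * (D * w))" unfolding *(1) by (simp only: mult_ac)
  also have "\<dots> = (v * (x * D')) * (1 - r)" unfolding *(2)[symmetric] by (simp only: mult_ac)
  finally show "x' * D = v * (x * D')" using *(3) by simp
qed

theorem proposition2:
  fixes n :: nat and I J :: "nat set" and \<eta>s :: comp
    and E :: "comp \<Rightarrow> laurent" and S :: laurent
  assumes "n \<ge> 1"
    and "admissible n I J"
    and "composition n \<eta>s"
    and "\<forall>i\<in>I. lookup \<eta>s i \<ge> lookup \<eta>s (i + 1)"
    and "\<forall>j\<in>J. lookup \<eta>s j > lookup \<eta>s (j + 1)"
    and E: "\<forall>\<eta>. composition n \<eta> \<longrightarrow> is_nonsym_macdonald n \<eta> (E \<eta>)"
    and S: "is_prescribed_macdonald n E I J \<eta>s S"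
  shows
    "(\<exists>b. laurent_inv S = (\<Sum>\<mu>\<in>orbit_W n (I \<union> J) \<eta>s. scal (b \<mu>) (laurent_inv (E \<mu>)))) \<and>
     (\<forall>b. laurent_inv S = (\<Sum>\<mu>\<in>orbit_W n (I \<union> J) \<eta>s. scal (b \<mu>) (laurent_inv (E \<mu>))) \<longrightarrow>
        b \<eta>s = 1 \<and>
        (\<forall>\<omega>\<in>W n (I \<union> J). \<forall>\<omega>I\<in>W n I. \<forall>\<omega>J\<in>W n J. \<forall>\<mu> \<mu>I.
           \<omega> = \<omega>I \<circ> \<omega>J \<and> \<mu> = act \<omega> \<eta>s \<and> \<mu>I = act \<omega>I \<eta>s \<and>
           (\<forall>\<sigma>\<in>W n I. act \<sigma> \<eta>s = \<mu>I \<longrightarrow> len n \<omega>I \<le> len n \<sigma>) \<longrightarrow>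
           b \<mu> = (- 1) ^ len n \<omega>J * t ^ len n \<omega>I *
                  ((d' n \<eta>s * d n \<mu>) / (d' n \<mu>I * d n \<mu>I)))) \<and>
     (\<exists>c. S = (\<Sum>\<mu>\<in>orbit_W n (I \<union> J) \<eta>s. scal (c \<mu>) (E \<mu>))) \<and>
     (\<forall>c. S = (\<Sum>\<mu>\<in>orbit_W n (I \<union> J) \<eta>s. scal (c \<mu>) (E \<mu>)) \<longrightarrow>
        c \<eta>s = 1 \<and>
        (\<forall>\<omega>\<in>W n (I \<union> J). \<forall>\<omega>I\<in>W n I. \<forall>\<omega>J\<in>W n J. \<forall>\<mu> \<mu>I.
           \<omega> = \<omega>I \<circ> \<omega>J \<and> \<mu> = act \<omega> \<eta>s \<and> \<mu>I = act \<omega>I \<eta>s \<longrightarrow>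
           c \<mu> = (- 1 / t) ^ len n \<omega>J *
                  ((d' n \<eta>s * d n \<mu>) / (d' n \<mu>I * d n \<mu>I))))"
proof -
  let ?O = "orbit_W n (I \<union> J) \<eta>s"
  note ctx = assms(1-5)
  note adm = assms(2)
  obtain c where c: "S = (\<Sum>\<mu>\<in>?O. scal (c \<mu>) (E \<mu>))" and c1: "c \<eta>s = 1"
    and TI: "\<And>i. i \<in> I \<Longrightarrow> T i S = scal t S" and TJ: "\<And>j. j \<in> J \<Longrightarrow> T j S = - S"
    using S_expansion[OF ctx E S] by blast
  define b where "b \<mu> = qt_inv (c \<mu>)" for \<mu>
  have b: "laurent_inv S = (\<Sum>\<mu>\<in>?O. scal (b \<mu>) (laurent_inv (E \<mu>)))"
    unfolding b_def by (subst c) (rule laurent_inv_sum_scal)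
  have b1: "b \<eta>s = 1" by (simp add: b_def c1)
  note sub = adm_subset[OF adm]
  have recI: "c (swap_expo i \<mu>) * d' n (swap_expo i \<mu>) = 1 * (c \<mu> * d' n \<mu>)"
      "b (swap_expo i \<mu>) * d' n (swap_expo i \<mu>) = t * (b \<mu> * d' n \<mu>)"
    if i: "i \<in> I" and \<mu>: "\<mu> \<in> ?O" "lookup \<mu> (Suc i) < lookup \<mu> i" for i \<mu>
  proof -
    have in': "1 \<le> i" "i < n" using i sub by auto
    define r where "r = eigen_ratio n i \<mu>"
    have r: "r \<noteq> 0" "r \<noteq> 1" "r / t \<noteq> 1"
      using eigen_ratio_neq[OF in' \<mu>(2)] by (auto simp: r_def)
    note D = d'_swap[OF in' \<mu>(2), folded r_def]
    have "t * (c (swap_expo i \<mu>) * (1 - r)) = t * (c \<mu> * (1 - r / t))"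
      using S_coefficient_recursion[OF ctx E S c UnI1[OF i] TI[OF i] \<mu>, folded r_def]
      by (simp add: algebra_simps)
    then have rec: "c (swap_expo i \<mu>) * (1 - r) = c \<mu> * (1 - r / t)" by simp
    then show "c (swap_expo i \<mu>) * d' n (swap_expo i \<mu>) = 1 * (c \<mu> * d' n \<mu>)"
      by (intro ratio_recursion(1)[OF _ D r(2,3)]) simp
    have inv: "qt_inv r = 1 / r" by (simp only: r_def qt_inv_eigen_ratio)
    \<comment> \<open>Inversion sends 1 - r / t to 1 - t / r. Multiplying by -r restores the factors
      of the direct recursion and leaves one t, the source of the power of t in the inverted
      formula.\<close>
    have eq: "b (swap_expo i \<mu>) * (1 - 1 / r) = b \<mu> * (1 - t / r)"
      using arg_cong[OF rec, of qt_inv]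
      by (simp add: b_def qt_inv_hom qt_inv_diff qt_inv_divide qt_inv_inverse inv divide_inverse mult.commute)
    have "b (swap_expo i \<mu>) * (1 - r) = - r * (b (swap_expo i \<mu>) * (1 - 1 / r))"
      using r(1) by (simp add: algebra_simps)
    also have "\<dots> = t * (b \<mu> * (1 - r / t))"
      unfolding eq using r(1) by (simp add: algebra_simps)
    finally show "b (swap_expo i \<mu>) * d' n (swap_expo i \<mu>) = t * (b \<mu> * d' n \<mu>)"
      by (rule ratio_recursion(1)[OF _ D r(2,3)])
  qed
  have recJ: "c (swap_expo j \<mu>) * d n \<mu> = (- 1 / t) * (c \<mu> * d n (swap_expo j \<mu>))"
      "b (swap_expo j \<mu>) * d n \<mu> = (- 1) * (b \<mu> * d n (swap_expo j \<mu>))"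
    if j: "j \<in> J" and \<mu>: "\<mu> \<in> ?O" "lookup \<mu> (Suc j) < lookup \<mu> j" for j \<mu>
  proof -
    have in': "1 \<le> j" "j < n" using j sub by auto
    define r where "r = eigen_ratio n j \<mu>"
    have r: "r \<noteq> 0" "r \<noteq> 1" using eigen_ratio_neq[OF in' \<mu>(2)] by (auto simp: r_def)
    note D = d_swap[OF in' \<mu>(2), folded r_def]
    have "T j S = scal (- 1) S" using TJ[OF j] by (simp add: scal_simps)
    from S_coefficient_recursion[OF ctx E S c UnI2[OF j] this \<mu>, folded r_def]
    have "t * (c (swap_expo j \<mu>) * (1 - r)) = - (c \<mu> * (1 - t * r))"
      by (simp add: algebra_simps)
    then have rec: "c (swap_expo j \<mu>) * (1 - r) = (- 1 / t) * (c \<mu> * (1 - t * r))"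
      by (simp add: field_simps)
    then show "c (swap_expo j \<mu>) * d n \<mu> = (- 1 / t) * (c \<mu> * d n (swap_expo j \<mu>))"
      by (rule ratio_recursion(2)[OF _ D r(2)])
    have inv: "qt_inv r = 1 / r" by (simp only: r_def qt_inv_eigen_ratio)
    \<comment> \<open>Here the inverted factor -1 / t becomes -t, and restoring 1 - r and 1 - t r
      absorbs this t, so only the sign survives.\<close>
    have eq: "b (swap_expo j \<mu>) * (1 - 1 / r) = (- t) * (b \<mu> * (1 - 1 / (t * r)))"
      using arg_cong[OF rec, of qt_inv]
      by (simp add: b_def qt_inv_hom qt_inv_diff qt_inv_divide qt_inv_uminus qt_inv_inverse inv divide_inverse mult.commute)
    have "b (swap_expo j \<mu>) * (1 - r) = - r * (b (swap_expo j \<mu>) * (1 - 1 / r))"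
      using r(1) by (simp add: algebra_simps)
    also have "\<dots> = (- 1) * (b \<mu> * (1 - t * r))"
      unfolding eq using r(1) by (simp add: algebra_simps)
    finally show "b (swap_expo j \<mu>) * d n \<mu> = (- 1) * (b \<mu> * d n (swap_expo j \<mu>))"
      by (rule ratio_recursion(2)[OF _ D r(2)])
  qed
  have act_commute: "act (\<sigma> \<circ> \<tau>) \<eta>s = act \<tau> (act \<sigma> \<eta>s)" if "\<sigma> \<in> W n I" "\<tau> \<in> W n J" for \<sigma> \<tau>
  proof -
    have "\<sigma> \<circ> \<tau> = \<tau> \<circ> \<sigma>" using W_J_commute_W_I[OF adm that(2,1)] by simp
    then show ?thesis using W_bij[OF sub(1) that(1)] W_bij[OF sub(2) that(2)] by (simp only: act_comp)
  qed
  have formula_b: "b \<mu> = (- 1) ^ len n \<tau> * t ^ len n \<sigma> * ((d' n \<eta>s * d n \<mu>) / (d' n \<mu>I * d n \<mu>I))"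
    if "\<sigma> \<in> W n I" "\<tau> \<in> W n J" "\<mu> = act (\<sigma> \<circ> \<tau>) \<eta>s" "\<mu>I = act \<sigma> \<eta>s"
      "\<forall>\<rho>\<in>W n I. act \<rho> \<eta>s = \<mu>I \<longrightarrow> len n \<sigma> \<le> len n \<rho>" for \<sigma> \<tau> \<mu> \<mu>I
    using coefficient_formula[OF ctx, of b t "- 1" \<sigma> \<tau>] b1 recI(2) recJ(2) that by blast
  have formula_c: "c \<mu> = (- 1 / t) ^ len n \<tau> * ((d' n \<eta>s * d n \<mu>) / (d' n \<mu>I * d n \<mu>I))"
    if h: "\<sigma> \<in> W n I" "\<tau> \<in> W n J" "\<mu> = act (\<sigma> \<circ> \<tau>) \<eta>s" "\<mu>I = act \<sigma> \<eta>s" for \<sigma> \<tau> \<mu> \<mu>I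
  proof -
    \<comment> \<open>The right side involves the I-part only through \<open>\<mu>I\<close>, so it
      may be replaced by a shortest permutation with the same effect; the J-part acts afterwards and
      yields the same composition.\<close>
    obtain \<rho> where \<rho>: "\<rho> \<in> W n I" "act \<rho> \<eta>s = \<mu>I"
      and min: "\<And>\<rho>'. \<rho>' \<in> W n I \<and> act \<rho>' \<eta>s = \<mu>I \<Longrightarrow> len n \<rho> \<le> len n \<rho>'"
      using ex_has_least_nat[of "\<lambda>\<rho>. \<rho> \<in> W n I \<and> act \<rho> \<eta>s = \<mu>I" \<sigma> "len n"] h(1,4) by blast
    have \<mu>: "act (\<rho> \<circ> \<tau>) \<eta>s = \<mu>"
      using h(1,2,4) \<rho> by (simp only: h(3) act_commute)
    have "c (act (\<rho> \<circ> \<tau>) \<eta>s) = (- 1 / t) ^ len n \<tau> * 1 ^ len n \<rho> *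
        ((d' n \<eta>s * d n (act (\<rho> \<circ> \<tau>) \<eta>s)) / (d' n (act \<rho> \<eta>s) * d n (act \<rho> \<eta>s)))"
      by (rule coefficient_formula[OF ctx c1 recI(1) recJ(1) \<rho>(1) h(2)]) (use \<rho>(2) min in auto)
    then show ?thesis unfolding \<mu> \<rho>(2) by simp
  qed
  have mem: "act (\<sigma> \<circ> \<tau>) \<eta>s \<in> ?O" if "\<sigma> \<in> W n I" "\<tau> \<in> W n J" for \<sigma> \<tau>
    using W_I_W_J_subset[OF ctx] that by (intro orbit_act[OF ctx] W_comp[OF sub(3)])
  have self: "\<eta>s \<in> ?O" by (rule orbit_self[OF ctx])
  have uniq_b: "\<beta> \<mu> = b \<mu>"
    if "laurent_inv S = (\<Sum>\<mu>\<in>?O. scal (\<beta> \<mu>) (laurent_inv (E \<mu>)))" "\<mu> \<in> ?O" for \<beta> \<mu>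
    by (rule orbit_E_inv_independent[OF ctx E S _ that(2)]) (use that(1) b in simp)
  have uniq_c: "\<gamma> \<mu> = c \<mu>"
    if "S = (\<Sum>\<mu>\<in>?O. scal (\<gamma> \<mu>) (E \<mu>))" "\<mu> \<in> ?O" for \<gamma> \<mu>
    by (rule orbit_E_independent[OF ctx E S _ that(2)]) (use that(1) c in metis)
  show ?thesis
  proof (intro conjI allI impI ballI)
    show "\<exists>b. laurent_inv S = (\<Sum>\<mu>\<in>?O. scal (b \<mu>) (laurent_inv (E \<mu>)))" using b by blast
    show "\<exists>c. S = (\<Sum>\<mu>\<in>?O. scal (c \<mu>) (E \<mu>))" using c by blast
  next
    fix \<beta> assume \<beta>: "laurent_inv S = (\<Sum>\<mu>\<in>?O. scal (\<beta> \<mu>) (laurent_inv (E \<mu>)))"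
    show "\<beta> \<eta>s = 1" using uniq_b[OF \<beta> self] b1 by simp
    fix \<omega> \<omega>I \<omega>J \<mu> \<mu>I
    assume *: "\<omega>I \<in> W n I" "\<omega>J \<in> W n J" "\<omega> = \<omega>I \<circ> \<omega>J \<and> \<mu> = act \<omega> \<eta>s \<and> \<mu>I = act \<omega>I \<eta>s \<and>
      (\<forall>\<sigma>\<in>W n I. act \<sigma> \<eta>s = \<mu>I \<longrightarrow> len n \<omega>I \<le> len n \<sigma>)"
    then show "\<beta> \<mu> = (- 1) ^ len n \<omega>J * t ^ len n \<omega>I * ((d' n \<eta>s * d n \<mu>) / (d' n \<mu>I * d n \<mu>I))"
      using uniq_b[OF \<beta> mem[OF *(1,2)]] formula_b[OF *(1,2), of \<mu> \<mu>I] by metis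
  next
    fix \<gamma> assume \<gamma>: "S = (\<Sum>\<mu>\<in>?O. scal (\<gamma> \<mu>) (E \<mu>))"
    show "\<gamma> \<eta>s = 1" using uniq_c[OF \<gamma> self] c1 by simp
    fix \<omega> \<omega>I \<omega>J \<mu> \<mu>I
    assume *: "\<omega>I \<in> W n I" "\<omega>J \<in> W n J" "\<omega> = \<omega>I \<circ> \<omega>J \<and> \<mu> = act \<omega> \<eta>s \<and> \<mu>I = act \<omega>I \<eta>s"
    then show "\<gamma> \<mu> = (- 1 / t) ^ len n \<omega>J * ((d' n \<eta>s * d n \<mu>) / (d' n \<mu>I * d n \<mu>I))"
      using uniq_c[OF \<gamma> mem[OF *(1,2)]] formula_c[OF *(1,2), of \<mu> \<mu>I] by metis
  qed
qed

end
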